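(* Let $k\geq 1$ be an integer and $d=4k+1$. Then the data consisting of $\widetilde\Sigma=\Sigma=S$, the degree $d$, and the three partitions of $d$ $$(2^{2k},1),\quad (4^{k},1),\quad (4^{k},1)$$ form a candidate surface branched cover, and it is realizable if and only if $d$ can be expressed as $x^2+y^2$ for some $x,y\in\mathbb{N}$.
   Context: $\mathbb{N}$ denotes the non-negative integers and $S$ the 2-sphere. A partition of $d$ is a finite unordered list (multiset) of positive integers with sum $d$; $\ell(\Pi)$ is the number of entries of $\Pi$; $(a^m,b,\ldots)$ means that $a$ is repeated $m$ times. For closed connected orientable surfaces $\widetilde\Sigma,\Sigma$, a branched cover $f:\widetilde\Sigma\to\Sigma$ is a map locally modelled on $(\mathbb{C},0)\to(\mathbb{C},0)$, $z\mapsto z^k$ with $k\geq 1$; $k$ is the local degree at the source point, and a point of $\Sigma$ having a preimage with local degree $>1$ is a branching point. The degree $d$ of $f$ is the degree of the genuine cover obtained by removing the branching points and their preimages; the local degrees at the preimages of a branching point form a partition of $d$. A candidate surface branched cover consists of closed connected orientable surfaces $\widetilde\Sigma,\Sigma$, integers $d\geq 2$ and $n\geq 1$, and an unordered collection (repetitions allowed) $\Pi_1,\ldots,\Pi_n$ of partitions of $d$ satisfying the Riemann-Hurwitz condition $\chi(\widetilde\Sigma)-\sum_i\ell(\Pi_i)=d\,(\chi(\Sigma)-n)$. It is realizable if there is a degree-$d$ branched cover $f:\widetilde\Sigma\to\Sigma$ with $n$ branching points whose associated partitions of local degrees are $\Pi_1,\ldots,\Pi_n$. *)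

theory Defs
  imports "HOL-Analysis.Analysis" "HOL-Homology.Homology" "HOL-Library.Multiset"
begin

section \<open>Closed connected orientable surfaces\<close>

(* Compactness makes second countability automatic. *)
definition closed_connected_surface :: "'a topology \<Rightarrow> bool" where
  "closed_connected_surface X \<longleftrightarrow>
     topspace X \<noteq> {} \<and> compact_space X \<and> connected_space X \<and> Hausdorff_space X \<and>
     (\<forall>x\<in>topspace X. \<exists>U (W :: complex set). openin X U \<and> x \<in> U \<and> open W \<and>
        subtopology X U homeomorphic_space top_of_set W)"

definition local_orientation_at :: "'a topology \<Rightarrow> 'a \<Rightarrow> 'a chain set \<Rightarrow> bool" where
  "local_orientation_at X x a \<longleftrightarrow>
     (let H = relative_homology_group 2 X (topspace X - {x}) in
        a \<in> carrier H \<and> carrier (subgroup_generated H {a}) = carrier H)"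

(* Orientability of a topological 2-manifold in the usual homological sense: a choice \<mu> x of
   a generator of H_2(X, X - x) at every point x, such that near every point these generators
   all come from one class in H_2(X, X - U) for some neighbourhood U. *)
definition orientable_surface :: "'a topology \<Rightarrow> bool" where
  "orientable_surface X \<longleftrightarrow>
     (\<exists>\<mu>. (\<forall>x\<in>topspace X. local_orientation_at X x (\<mu> x)) \<and>
          (\<forall>x\<in>topspace X. \<exists>U. openin X U \<and> x \<in> U \<and>
             (\<exists>\<alpha>\<in>carrier (relative_homology_group 2 X (topspace X - U)).
                \<forall>y\<in>U. hom_induced 2 X (topspace X - U) X (topspace X - {y}) id \<alpha> = \<mu> y)))"

definition closed_connected_orientable_surface :: "'a topology \<Rightarrow> bool" where
  "closed_connected_orientable_surface X \<longleftrightarrow>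
     closed_connected_surface X \<and> orientable_surface X"

abbreviation S2 :: "(real^3) topology" where
  "S2 \<equiv> top_of_set (sphere 0 1)"


section \<open>Euler characteristic\<close>

definition int_independent :: "('a, 'b) monoid_scheme \<Rightarrow> 'a set \<Rightarrow> bool" where
  "int_independent G B \<longleftrightarrow>
     (\<forall>c :: 'a \<Rightarrow> int. finprod G (\<lambda>b. b [^]\<^bsub>G\<^esub> c b) B = \<one>\<^bsub>G\<^esub> \<longrightarrow> (\<forall>b\<in>B. c b = 0))"

(* Rank of a (multiplicatively written) abelian group of finite rank.  For infinite rank
   this is a junk value; homology groups of closed surfaces are finitely generated. *)
definition abelian_group_rank :: "('a, 'b) monoid_scheme \<Rightarrow> nat" where
  "abelian_group_rank G = Sup {card B | B. finite B \<and> B \<subseteq> carrier G \<and> int_independent G B}"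

definition betti_number :: "nat \<Rightarrow> 'a topology \<Rightarrow> nat" where
  "betti_number p X = abelian_group_rank (homology_group (int p) X)"

definition euler_characteristic :: "'a topology \<Rightarrow> int" where
  "euler_characteristic X =
     (\<Sum>p | betti_number p X \<noteq> 0. (-1) ^ p * int (betti_number p X))"


section \<open>Branched covers\<close>

(* In suitable charts around x and f x, identified with the whole of the complex plane,
   f is the map z \<mapsto> z^k. *)
definition has_local_degree ::
    "'a topology \<Rightarrow> 'b topology \<Rightarrow> ('a \<Rightarrow> 'b) \<Rightarrow> 'a \<Rightarrow> nat \<Rightarrow> bool" where
  "has_local_degree X Y f x k \<longleftrightarrow> k \<ge> 1 \<and>
     (\<exists>U V (\<phi> :: 'a \<Rightarrow> complex) (\<psi> :: 'b \<Rightarrow> complex).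
        openin X U \<and> x \<in> U \<and> openin Y V \<and> f ` U \<subseteq> V \<and>
        homeomorphic_map (subtopology X U) euclidean \<phi> \<and> \<phi> x = 0 \<and>
        homeomorphic_map (subtopology Y V) euclidean \<psi> \<and> \<psi> (f x) = 0 \<and>
        (\<forall>u\<in>U. \<psi> (f u) = \<phi> u ^ k))"

definition branched_cover :: "'a topology \<Rightarrow> 'b topology \<Rightarrow> ('a \<Rightarrow> 'b) \<Rightarrow> bool" where
  "branched_cover X Y f \<longleftrightarrow> (\<forall>x\<in>topspace X. \<exists>k. has_local_degree X Y f x k)"

(* The local degree is unique: it is the number of preimages near x of a point near f x. *)
definition local_degree :: "'a topology \<Rightarrow> 'b topology \<Rightarrow> ('a \<Rightarrow> 'b) \<Rightarrow> 'a \<Rightarrow> nat" where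
  "local_degree X Y f x = (THE k. has_local_degree X Y f x k)"

definition fibre :: "'a topology \<Rightarrow> ('a \<Rightarrow> 'b) \<Rightarrow> 'b \<Rightarrow> 'a set" where
  "fibre X f y = {x \<in> topspace X. f x = y}"

definition branching_points :: "'a topology \<Rightarrow> 'b topology \<Rightarrow> ('a \<Rightarrow> 'b) \<Rightarrow> 'b set" where
  "branching_points X Y f = {y \<in> topspace Y. \<exists>x\<in>fibre X f y. local_degree X Y f x > 1}"

(* Away from the branching points a branched cover of closed surfaces is a genuine cover;
   its degree is the number of its sheets. *)
definition branched_cover_of_degree ::
    "'a topology \<Rightarrow> 'b topology \<Rightarrow> ('a \<Rightarrow> 'b) \<Rightarrow> nat \<Rightarrow> bool" where
  "branched_cover_of_degree X Y f d \<longleftrightarrow> branched_cover X Y f \<and>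
     (\<forall>y\<in>topspace Y - branching_points X Y f. finite (fibre X f y) \<and> card (fibre X f y) = d)"

definition local_degrees_over ::
    "'a topology \<Rightarrow> 'b topology \<Rightarrow> ('a \<Rightarrow> 'b) \<Rightarrow> 'b \<Rightarrow> nat multiset" where
  "local_degrees_over X Y f y = image_mset (local_degree X Y f) (mset_set (fibre X f y))"


section \<open>Candidate surface branched covers and realizability\<close>

definition is_partition_of :: "nat \<Rightarrow> nat multiset \<Rightarrow> bool" where
  "is_partition_of d P \<longleftrightarrow> 0 \<notin># P \<and> \<Sum>\<^sub># P = d"

(* The number n of partitions is size Ps. *)
definition candidate_surface_branched_cover ::
    "'a topology \<Rightarrow> 'b topology \<Rightarrow> nat \<Rightarrow> nat multiset multiset \<Rightarrow> bool" where
  "candidate_surface_branched_cover X Y d Ps \<longleftrightarrow>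
     closed_connected_orientable_surface X \<and> closed_connected_orientable_surface Y \<and>
     d \<ge> 2 \<and> size Ps \<ge> 1 \<and> (\<forall>P\<in>#Ps. is_partition_of d P) \<and>
     euler_characteristic X - (\<Sum>P\<in>#Ps. int (size P))
       = int d * (euler_characteristic Y - int (size Ps))"

definition realizable ::
    "'a topology \<Rightarrow> 'b topology \<Rightarrow> nat \<Rightarrow> nat multiset multiset \<Rightarrow> bool" where
  "realizable X Y d Ps \<longleftrightarrow>
     (\<exists>f. branched_cover_of_degree X Y f d \<and>
          finite (branching_points X Y f) \<and>
          image_mset (local_degrees_over X Y f) (mset_set (branching_points X Y f)) = Ps)"

end

theory Submission
  imports Defs "HOL-Complex_Analysis.Complex_Analysis"
begin

text \<open>Let \<open>\<Gamma>\<close> be the group of maps \<open>z \<mapsto> u z + \<gamma>\<close> of the plane with \<open>u ^ 4 = 1\<close> and \<open>\<gamma>\<close> a Gaussian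
  integer. Its quotient is a sphere with cone points of orders 2, 4, 4; let \<open>p\<close> be the projection of the
  plane onto this sphere. If \<open>d = x\<^sup>2 + y\<^sup>2\<close>, multiplication by \<open>x + i y\<close> descends along \<open>p\<close> to a
  branched cover with the required data. Conversely, place the cone points at the branching points of a
  branched cover \<open>f\<close> with these data. All local degrees of \<open>f\<close> divide the cone orders, so that \<open>p\<close> lifts
  to maps \<open>s\<close> from the plane to the source with \<open>f \<circ> s = p\<close>, and \<open>\<Gamma>\<close> permutes these \<open>d\<close> lifts transitively.
  The unramified point over a cone point of order 4 yields a lift invariant under a rotation of order 4.
  The periods of this lift form an ideal of index \<open>d\<close> in the Gaussian integers; the ideal is
  principal, so \<open>d\<close> is the norm of a generator.\<close>

section \<open>The homology of the sphere\<close>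

text \<open>The three partitions are tied to the flat orbifold of type (2,4,4), for which 1/2 + 1/4
  + 1/4 = 1: over each cone point every local degree is the cone order, apart from one unramified
  point, so that the pulled-back flat structure on the source has exactly three cone points, again
  of orders 2, 4, 4. A covering between two such orbifolds lifts to a similarity of the plane whose
  multiplier is a Gaussian integer, and its degree is the squared modulus of the multiplier. A
  realization \<open>f\<close> is, however, only a map with local power models in topological
  charts; no metric or complex structure comes with it. The proof therefore stays topological: the
  quotient sphere is given by explicit trigonometric coordinates, its cone points can be put at any
  three distinct points of the sphere, and lifts through \<open>f\<close> are made from continuous
  roots. Cone points obstruct the usual covering arguments, since several lifts can pass through one
  ramified point. Lifts are therefore compared at points with trivial stabiliser only; these form
  the complement of a countable set, which is connected and dense.\<close>

lemma homeomorphic_nsphere_S2: "S2 homeomorphic_space nsphere 2"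
proof -
  define f :: "real^3 \<Rightarrow> nat \<Rightarrow> real" where
    "f = (\<lambda>v n. if n = 0 then v$1 else if n = 1 then v$2 else if n = 2 then v$3 else 0)"
  define g :: "(nat \<Rightarrow> real) \<Rightarrow> real^3" where "g = (\<lambda>x. vector [x 0, x 1, x 2])"
  have nrm: "norm v = 1 \<longleftrightarrow> (v$1)\<^sup>2 + (v$2)\<^sup>2 + (v$3)\<^sup>2 = 1" for v :: "real^3"
    by (simp add: norm_eq_sqrt_inner inner_vec_def sum_3 power2_eq_square)
  have sm: "(\<Sum>i\<le>2. x i ^ 2) = (x 0)\<^sup>2 + (x 1)\<^sup>2 + (x 2)\<^sup>2" for x :: "nat \<Rightarrow> real"
    by (simp add: numeral_2_eq_2)
  have tn: "topspace (nsphere 2) = {x. (x 0)\<^sup>2 + (x 1)\<^sup>2 + (x 2)\<^sup>2 = 1 \<and> (\<forall>i>2. x i = 0)}"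
    unfolding nsphere by (simp only: sm topspace_subtopology topspace_product_topology) auto
  have cf: "continuous_map S2 (nsphere 2) f"
    unfolding nsphere
  proof (rule continuous_map_into_subtopology)
    show "continuous_map S2 (powertop_real UNIV) f"
      unfolding continuous_map_componentwise_UNIV
    proof
      fix n :: nat
      have "n = 0 \<or> n = 1 \<or> n = 2 \<or> n > 2" by auto
      then show "continuous_map S2 euclideanreal (\<lambda>x. f x n)"
        by (elim disjE) (simp_all add: f_def continuous_on_component)
    qed
    show "f \<in> topspace S2 \<rightarrow> {x. (\<Sum>i\<le>2. (x i)\<^sup>2) = 1 \<and> (\<forall>i>2. x i = 0)}"
      by (simp only: sm) (auto simp: f_def nrm)
  qed
  have cg: "continuous_map (nsphere 2) S2 g"
  proof (rule continuous_map_into_subtopology)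
    have "g = (\<lambda>x. x 0 *\<^sub>R axis 1 1 + x 1 *\<^sub>R axis 2 1 + x 2 *\<^sub>R axis 3 1)"
      by (auto simp: g_def vec_eq_iff forall_3 axis_def)
    moreover have "continuous_on T (\<lambda>x. x 0 *\<^sub>R axis 1 1 + x 1 *\<^sub>R axis 2 1 + x 2 *\<^sub>R axis 3 1 :: real^3)"
      for T :: "(nat \<Rightarrow> real) set"
      by (intro continuous_intros continuous_on_subset[OF continuous_on_product_coordinates]) auto
    ultimately show "continuous_map (nsphere 2) euclidean g"
      by (simp only: nsphere euclidean_product_topology continuous_map_iff_continuous)
    show "g \<in> topspace (nsphere 2) \<rightarrow> sphere 0 1"
      by (auto simp: tn g_def nrm)
  qed
  have "homeomorphic_maps S2 (nsphere 2) f g"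
    unfolding homeomorphic_maps_def
  proof (intro conjI cf cg ballI)
    show "g (f x) = x" for x by (simp add: g_def f_def vec_eq_iff forall_3)
    show "f (g y) = y" if "y \<in> topspace (nsphere 2)" for y
    proof
      fix n :: nat
      have "n = 0 \<or> n = 1 \<or> n = 2 \<or> n > 2" by auto
      then show "f (g y) n = y n" using that by (auto simp: tn f_def g_def)
    qed
  qed
  then show ?thesis by (auto simp: homeomorphic_space_def)
qed

lemma homology_group_S2_top: "homology_group 2 S2 \<cong> integer_group"
proof -
  have "homology_group 2 S2 = reduced_homology_group 2 S2"
    by (simp add: un_reduced_homology_group)
  also have "\<dots> \<cong> reduced_homology_group 2 (nsphere 2)"
    by (rule homeomorphic_space_imp_isomorphic_reduced_homology_groups[OF homeomorphic_nsphere_S2])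
  also have "\<dots> \<cong> integer_group"
    using reduced_homology_group_nsphere(1)[of 2] by simp
  finally (iso_trans) show ?thesis .
qed

lemma homology_group_S2_zero: "homology_group 0 S2 \<cong> integer_group"
proof (rule isomorphic_integer_zeroth_homology_group)
  have "path_connectedin euclidean (sphere (0 :: real^3) 1)"
    by (simp add: path_connected_sphere)
  then show "path_connected_space S2" by (simp add: path_connectedin_def)
qed (metis norm_axis_1 empty_iff mem_sphere_0 topspace_euclidean_subtopology)

lemma trivial_homology_group_S2:
  assumes "p \<noteq> 0" "p \<noteq> 2"
  shows "trivial_group (homology_group p S2)"
proof -
  have "homology_group p S2 = reduced_homology_group p S2"
    using assms by (simp add: un_reduced_homology_group)
  also have "\<dots> \<cong> reduced_homology_group p (nsphere 2)"
    by (rule homeomorphic_space_imp_isomorphic_reduced_homology_groups[OF homeomorphic_nsphere_S2])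
  finally have "homology_group p S2 \<cong> reduced_homology_group p (nsphere 2)" .
  moreover have "trivial_group (reduced_homology_group p (nsphere 2))"
    using reduced_homology_group_nsphere(2)[of p 2] assms by simp
  ultimately show ?thesis
    using isomorphic_group_triviality group_relative_homology_group group_reduced_homology_group by blast
qed

section \<open>Ranks of abelian groups and the Euler characteristic of the sphere\<close>

text \<open>Besides the empty set the only candidate is the singleton of the identity, and it is
  dependent: the coefficient 1 already gives the identity.\<close>

lemma abelian_group_rank_trivial:
  assumes "trivial_group G"
  shows "abelian_group_rank G = 0"
proof -
  interpret group G using assms by (simp add: trivial_group_def)
  have c: "carrier G = {\<one>\<^bsub>G\<^esub>}" using assms by (simp add: trivial_group_def)
  have "{card B | B. finite B \<and> B \<subseteq> carrier G \<and> int_independent G B} = {0}"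
  proof -
    have "B = {}" if B: "B \<subseteq> carrier G" "int_independent G B" for B
    proof (rule ccontr)
      assume "B \<noteq> {}"
      then have Be: "B = {\<one>\<^bsub>G\<^esub>}" using B c by auto
      have "comm_group G" using c by unfold_locales auto
      then interpret comm_group G .
      have "finprod G (\<lambda>b. b [^]\<^bsub>G\<^esub> (1::int)) B = \<one>\<^bsub>G\<^esub>"
        by (rule finprod_one_eqI) (use Be in auto)
      with B(2) show False unfolding int_independent_def Be by (auto dest: spec[of _ "\<lambda>_. 1"])
    qed
    moreover have "int_independent G {}" by (simp add: int_independent_def)
    ultimately show ?thesis by auto (metis card.empty finite.emptyI empty_subsetI)
  qed
  then show ?thesis by (simp add: abelian_group_rank_def)
qed


text \<open>Two distinct powers \<open>a^m\<close> and \<open>a^n\<close> of a generator satisfy the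
  relation with coefficients \<open>n\<close> and \<open>- m\<close>, so an independent set has at
  most one element.\<close>

lemma abelian_group_rank_infinite_cyclic:
  fixes G (structure)
  assumes G: "comm_group G" and iso: "G \<cong> integer_group"
  shows "abelian_group_rank G = 1"
proof -
  interpret comm_group G by (rule G)
  obtain g where g: "g \<in> iso integer_group G"
    using iso_sym[OF iso] by (auto simp: is_iso_def)
  define a where "a = g 1"
  have ac [simp]: "a \<in> carrier G"
    using g by (auto simp: a_def iso_def hom_def)
  have gp: "g n = a [^] n" for n :: int
  proof -
    have "g (1 [^]\<^bsub>integer_group\<^esub> n) = a [^] n"
      unfolding a_def using g by (intro hom_int_pow) (auto simp: iso_def)
    then show ?thesis by simp
  qed
  have inj: "a [^] m = a [^] n \<longleftrightarrow> m = n" for m n :: int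
    using g by (auto simp: iso_def bij_betw_def inj_on_def gp[symmetric])
  have rng: "carrier G = range (\<lambda>n::int. a [^] n)"
    using g by (auto simp: iso_def bij_betw_def gp)
  have pow_one: "a [^] n = \<one> \<longleftrightarrow> n = 0" for n :: int
    using inj[of n 0] by simp
  have "int_independent G {a}"
    unfolding int_independent_def
  proof (intro allI impI ballI)
    fix c :: "_ \<Rightarrow> int" and b
    assume "finprod G (\<lambda>b. b [^] c b) {a} = \<one>" "b \<in> {a}"
    then show "c b = 0" by (simp add: pow_one)
  qed
  moreover have "card B \<le> 1" if B: "finite B" "B \<subseteq> carrier G" "int_independent G B" for B
  proof (rule ccontr)
    assume "\<not> card B \<le> 1"
    then obtain u v where uv: "u \<in> B" "v \<in> B" "u \<noteq> v"
      using B(1) card_le_Suc0_iff_eq[of B] by auto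
    obtain m n :: int where mn: "u = a [^] m" "v = a [^] n"
      using uv B(2) rng by blast
    define c where "c = (\<lambda>b. if b = u then n else if b = v then - m else (0::int))"
    have "finprod G (\<lambda>b. b [^] c b) {u, v} = finprod G (\<lambda>b. b [^] c b) B"
      by (rule finprod_mono_neutral_cong_left) (use uv B in \<open>auto simp: c_def\<close>)
    moreover have "finprod G (\<lambda>b. b [^] c b) {u, v} = a [^] (m * n) \<otimes> a [^] (n * - m)"
      using uv by (simp add: c_def mn int_pow_pow)
    also have "\<dots> = \<one>"
      by (simp add: int_pow_mult[symmetric] mult.commute)
    ultimately have "\<forall>b\<in>B. c b = 0" using B(3) unfolding int_independent_def by metis
    then have "n = 0" "m = 0" using uv by (auto simp: c_def dest: bspec)
    then show False using uv mn by simp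
  qed
  ultimately have "Sup {card B | B. finite B \<and> B \<subseteq> carrier G \<and> int_independent G B} = 1"
    by (intro cSup_eq_maximum) (auto intro!: exI[of _ "{a}"])
  then show ?thesis by (simp add: abelian_group_rank_def)
qed

lemma euler_characteristic_S2: "euler_characteristic S2 = 2"
proof -
  have b: "betti_number p S2 = (if p = 0 \<or> p = 2 then 1 else 0)" for p
    using trivial_homology_group_S2[of "int p"]
    by (auto simp: betti_number_def abelian_group_rank_trivial abelian_group_rank_infinite_cyclic
        homology_group_S2_top homology_group_S2_zero abelian_homology_group)
  have "{p. betti_number p S2 \<noteq> 0} = {0, 2}" by (auto simp: b)
  then show ?thesis by (simp add: euler_characteristic_def b)
qed

section \<open>Orientability of the sphere\<close>

text \<open>Stereographic projection turns the complement into a plane. Its first homology therefore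
  vanishes, which makes the second homology of the sphere map onto the local homology at
  \<open>y\<close>.\<close>

lemma contractible_punctured_S2:
  assumes "y \<in> sphere (0 :: real^3) 1"
  shows "contractible (sphere 0 1 - {y})"
proof -
  have "y \<noteq> 0" using assms by auto
  then have "(sphere 0 1 - {y}) homeomorphic {x. y \<bullet> x = 0}"
    using assms by (intro homeomorphic_punctured_sphere_hyperplane) auto
  moreover have "contractible {x. y \<bullet> x = 0}"
    by (intro convex_imp_contractible convex_hyperplane)
  ultimately show ?thesis using homeomorphic_contractible_eq by blast
qed

text \<open>The local orientations are the images of a fixed generator of the second homology group.\<close>

lemma orientable_S2: "orientable_surface S2"
proof -
  have "cyclic_group (homology_group 2 S2)"
    using isomorphic_group_cyclicity[OF homology_group_S2_top] by simp
  then obtain \<alpha> where a: "\<alpha> \<in> carrier (homology_group 2 S2)"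
      and ag: "carrier (homology_group 2 S2) = range (\<lambda>n::int. \<alpha> [^]\<^bsub>homology_group 2 S2\<^esub> n)"
    by (auto simp: group.cyclic_group)
  let ?h = "\<lambda>y. hom_induced 2 S2 {} S2 (topspace S2 - {y}) id"
  have "local_orientation_at S2 y (?h y \<alpha>)" if y: "y \<in> topspace S2" for y
  proof -
    let ?A = "topspace S2 - {y}"
    let ?H = "relative_homology_group 2 S2 ?A"
    interpret H: group ?H by simp
    interpret h: group_hom "homology_group 2 S2" ?H "?h y"
      by (simp add: group_hom_def group_hom_axioms_def hom_induced_hom)
    have sub: "subtopology S2 ?A = top_of_set (sphere 0 1 - {y})"
      by (simp add: subtopology_subtopology Int_absorb1)
    have "contractible_space (subtopology S2 ?A)"
      unfolding sub using contractible_punctured_S2 y by simp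
    then have "trivial_group (reduced_homology_group 1 (subtopology S2 ?A))"
      by (rule trivial_reduced_homology_group_contractible_space)
    then have triv: "trivial_group (homology_group 1 (subtopology S2 ?A))"
      by (simp add: un_reduced_homology_group)
    \<comment> \<open>The image of \<open>?h y\<close> is the kernel of the boundary map, and the
      boundary map ends in a trivial group; hence \<open>?h y\<close> is onto and carries a
      generator to a generator.\<close>
    have "exact_seq ([homology_group 1 (subtopology S2 ?A), ?H, homology_group 2 S2],
              [hom_boundary 2 S2 ?A, ?h y])"
      using homology_exactness_axiom_1[of 2 S2 ?A] by simp
    then have ker: "?h y ` carrier (homology_group 2 S2)
        = kernel ?H (homology_group 1 (subtopology S2 ?A)) (hom_boundary 2 S2 ?A)"
      by simp
    have "hom_boundary 2 S2 ?A \<in> hom ?H (homology_group 1 (subtopology S2 ?A))"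
      using hom_boundary_hom[of 2 S2 ?A] by simp
    then have surj: "carrier ?H = ?h y ` carrier (homology_group 2 S2)"
      unfolding ker using triv by (auto simp: kernel_def trivial_group_def hom_def)
    have ac: "?h y \<alpha> \<in> carrier ?H" using a h.hom_closed by blast
    have "carrier ?H = range (\<lambda>n::int. ?h y \<alpha> [^]\<^bsub>?H\<^esub> n)"
      unfolding surj ag image_image using h.hom_int_pow[OF a] by simp
    then have "carrier (subgroup_generated ?H {?h y \<alpha>}) = carrier ?H"
      using ac H.carrier_subgroup_generated_by_singleton by simp
    with ac show ?thesis by (simp add: local_orientation_at_def Let_def)
  qed
  moreover have "\<exists>U. openin S2 U \<and> x \<in> U \<and>
       (\<exists>\<beta>\<in>carrier (relative_homology_group 2 S2 (topspace S2 - U)).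
          \<forall>y\<in>U. hom_induced 2 S2 (topspace S2 - U) S2 (topspace S2 - {y}) id \<beta> = ?h y \<alpha>)"
    if "x \<in> topspace S2" for x
    using that a by (intro exI[of _ "topspace S2"]) (auto intro!: bexI[of _ \<alpha>])
  ultimately show ?thesis
    unfolding orientable_surface_def by (intro exI[of _ "\<lambda>y. ?h y \<alpha>"]) blast
qed

section \<open>Gaussian integers\<close>

definition gauss_ints :: "complex set" where
  "gauss_ints = {z. Re z \<in> \<int> \<and> Im z \<in> \<int>}"

lemma gauss_ints_iff: "z \<in> gauss_ints \<longleftrightarrow> (\<exists>a b :: int. z = Complex (of_int a) (of_int b))"
  by (auto simp: gauss_ints_def complex_eq_iff elim!: Ints_cases)

lemma gauss_ints_intros [simp, intro]:
  "0 \<in> gauss_ints" "1 \<in> gauss_ints" "\<i> \<in> gauss_ints"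
  "of_int n \<in> gauss_ints" "numeral m \<in> gauss_ints"
  "z \<in> gauss_ints \<Longrightarrow> w \<in> gauss_ints \<Longrightarrow> z + w \<in> gauss_ints"
  "z \<in> gauss_ints \<Longrightarrow> w \<in> gauss_ints \<Longrightarrow> z - w \<in> gauss_ints"
  "z \<in> gauss_ints \<Longrightarrow> w \<in> gauss_ints \<Longrightarrow> z * w \<in> gauss_ints"
  "z \<in> gauss_ints \<Longrightarrow> - z \<in> gauss_ints"
  by (auto simp: gauss_ints_def)

lemma gauss_ints_uminus_iff [simp]: "- z \<in> gauss_ints \<longleftrightarrow> z \<in> gauss_ints"
  by (metis gauss_ints_intros(9) minus_minus)

lemma gauss_ints_power [simp, intro]: "z \<in> gauss_ints \<Longrightarrow> z ^ n \<in> gauss_ints"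
  by (induction n) auto

lemma norm_gauss_ints_sq:
  assumes "z \<in> gauss_ints"
  shows "\<exists>n :: nat. (norm z)\<^sup>2 = of_nat n"
proof -
  obtain a b :: int where "z = Complex (of_int a) (of_int b)" using assms gauss_ints_iff by blast
  then have "(norm z)\<^sup>2 = of_nat (nat (a\<^sup>2 + b\<^sup>2))" by (simp add: cmod_power2)
  then show ?thesis by blast
qed

lemma norm_gauss_ints_ge_1:
  assumes "z \<in> gauss_ints" "z \<noteq> 0"
  shows "norm z \<ge> 1"
proof -
  obtain n :: nat where n: "(norm z)\<^sup>2 = of_nat n" using norm_gauss_ints_sq assms(1) by blast
  with assms(2) have "n \<noteq> 0" by (metis of_nat_0 zero_eq_power2 norm_eq_zero)
  then have "(norm z)\<^sup>2 \<ge> 1\<^sup>2" using n by simp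
  then show ?thesis using power2_le_imp_le norm_ge_zero by blast
qed

lemma closed_gauss_ints: "closed gauss_ints"
proof -
  have "gauss_ints = Re -` \<int> \<inter> Im -` \<int>" by (auto simp: gauss_ints_def)
  moreover have "closed (Re -` \<int>)" "closed (Im -` \<int>)"
    by (auto intro!: continuous_closed_vimage continuous_intros)
  ultimately show ?thesis by (metis closed_Int)
qed

lemma countable_gauss_ints: "countable gauss_ints"
proof -
  have "gauss_ints \<subseteq> range (\<lambda>(a, b). Complex (of_int a) (of_int b))"
    by (force simp: gauss_ints_iff)
  then show ?thesis by (rule countable_subset) simp
qed

lemma infinite_gauss_ints: "infinite gauss_ints"
proof
  assume "finite gauss_ints"
  then have "finite (range (of_int :: int \<Rightarrow> complex))"
    by (rule finite_subset[rotated]) auto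
  moreover have "inj (of_int :: int \<Rightarrow> complex)" by (simp add: inj_on_def)
  ultimately show False using finite_imageD by fastforce
qed

text \<open>Discreteness of the lattice. Applied to \<open>u * z - z\<close>, it separates
  \<open>z\<close> from the other points of its orbit.\<close>

lemma gauss_translate_discrete:
  "\<exists>r>0. \<forall>\<gamma>\<in>gauss_ints. w + \<gamma> \<noteq> 0 \<longrightarrow> r \<le> norm (w + \<gamma>)"
proof (cases "w \<in> gauss_ints")
  case True
  then show ?thesis by (intro exI[of _ 1]) (auto simp: norm_gauss_ints_ge_1)
next
  case False
  then have "open (- gauss_ints)" "- w \<in> - gauss_ints" using closed_gauss_ints by auto
  then obtain r where "r > 0" and r: "ball (- w) r \<subseteq> - gauss_ints"
    using open_contains_ball by blast
  have "r \<le> norm (w + \<gamma>)" if "\<gamma> \<in> gauss_ints" for \<gamma>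
  proof (rule ccontr)
    assume "\<not> r \<le> norm (w + \<gamma>)"
    moreover have "dist (- w) \<gamma> = norm (w + \<gamma>)"
      by (metis dist_norm add.commute diff_minus_eq_add dist_commute)
    ultimately have "\<gamma> \<in> ball (- w) r" by simp
    then show False using r that by blast
  qed
  with \<open>r > 0\<close> show ?thesis by blast
qed

section \<open>Units, stabilisers and cone points\<close>

lemma unit_cases:
  assumes "u ^ 4 = (1 :: complex)"
  shows "u = 1 \<or> u = - 1 \<or> u = \<i> \<or> u = - \<i>"
proof -
  have "(u - 1) * (u + 1) * (u - \<i>) * (u + \<i>) = u ^ 4 - 1"
    by (simp add: power4_eq_xxxx algebra_simps)
  with assms have "(u - 1) * (u + 1) * (u - \<i>) * (u + \<i>) = 0" by simp
  then show ?thesis by (auto simp: eq_neg_iff_add_eq_0)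
qed

lemma unit_gauss_ints [simp, intro]: "u ^ 4 = 1 \<Longrightarrow> u \<in> gauss_ints"
  using unit_cases by force

lemma norm_unit: "u ^ 4 = 1 \<Longrightarrow> norm (u :: complex) = 1"
  using unit_cases by force

text \<open>The order of the stabiliser of a point under the group of maps \<open>z \<mapsto> u z + \<gamma>\<close>
  with \<open>u ^ 4 = 1\<close> and \<open>\<gamma>\<close> a Gaussian integer.\<close>

definition rot_ord :: "complex \<Rightarrow> nat" where
  "rot_ord z = (if (1 - \<i>) * z \<in> gauss_ints then 4 else if 2 * z \<in> gauss_ints then 2 else 1)"

lemma rot_ord_cases: "rot_ord z = 1 \<or> rot_ord z = 2 \<or> rot_ord z = 4"
  by (simp add: rot_ord_def)

lemma rot_ord_pos [simp]: "rot_ord z > 0"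
  by (simp add: rot_ord_def)

lemma rot_ord_dvd_4: "rot_ord z dvd 4"
  by (simp add: rot_ord_def)

lemma unit_of_rot_ord: "u ^ rot_ord z = 1 \<Longrightarrow> u ^ 4 = (1 :: complex)"
  using rot_ord_dvd_4[of z] by (metis dvdE power_mult power_one)

text \<open>The left side says that some group element with rotation part \<open>u\<close> fixes
  \<open>z\<close>, so the stabiliser is cyclic of order \<open>rot_ord z\<close>. For the units
  \<open>\<i>\<close> and \<open>- \<i>\<close> the condition reads
  \<open>(1 - \<i>) * z \<in> gauss_ints\<close>, for \<open>- 1\<close> it reads
  \<open>2 * z \<in> gauss_ints\<close>; the first implies the second as 2 is divisible by
  \<open>1 - \<i>\<close>.\<close>

lemma unit_rot_ord_iff:
  assumes u: "u ^ 4 = (1 :: complex)"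
  shows "u * z - z \<in> gauss_ints \<longleftrightarrow> u ^ rot_ord z = 1"
proof -
  have two: "2 * z \<in> gauss_ints" if "(1 - \<i>) * z \<in> gauss_ints"
  proof -
    have "2 * z = (1 + \<i>) * ((1 - \<i>) * z)" by (simp add: algebra_simps)
    then show ?thesis using that by (metis gauss_ints_intros(2,3,6,8))
  qed
  have a: "- z - z \<in> gauss_ints \<longleftrightarrow> 2 * z \<in> gauss_ints"
    by (metis gauss_ints_uminus_iff minus_add_distrib mult_2 uminus_add_conv_diff add.commute)
  have b: "\<i> * z - z \<in> gauss_ints \<longleftrightarrow> (1 - \<i>) * z \<in> gauss_ints"
    by (metis gauss_ints_uminus_iff left_diff_distrib minus_diff_eq mult_1)
  have "- \<i> * z - z = - \<i> * ((1 - \<i>) * z)" "(1 - \<i>) * z = \<i> * (- \<i> * z - z)"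
    by (simp_all add: algebra_simps)
  then have c: "- \<i> * z - z \<in> gauss_ints \<longleftrightarrow> (1 - \<i>) * z \<in> gauss_ints"
    by (metis gauss_ints_intros(3,8,9))
  have o1: "2 * z \<in> gauss_ints \<longleftrightarrow> rot_ord z \<noteq> 1" and o4: "(1 - \<i>) * z \<in> gauss_ints \<longleftrightarrow> rot_ord z = 4"
    using two by (auto simp: rot_ord_def)
  have mi: "- \<i> \<noteq> 1" by (simp add: complex_eq_iff)
  consider "u = 1" | "u = - 1" | "u = \<i>" | "u = - \<i>" using unit_cases[OF u] by blast
  then show ?thesis
  proof cases
    case 1
    then show ?thesis by simp
  next
    case 2
    have "(- 1) ^ rot_ord z = (1 :: complex) \<longleftrightarrow> rot_ord z \<noteq> 1" using rot_ord_cases[of z] by auto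
    then show ?thesis unfolding 2 mult_minus1 a o1 by simp
  next
    case 3
    have "\<i> ^ rot_ord z = 1 \<longleftrightarrow> rot_ord z = 4"
      using rot_ord_cases[of z] by (auto simp: power4_eq_xxxx)
    then show ?thesis unfolding 3 b o4 by simp
  next
    case 4
    have "(- \<i>) ^ rot_ord z = 1 \<longleftrightarrow> rot_ord z = 4"
      using rot_ord_cases[of z] mi by (auto simp: power4_eq_xxxx)
    then show ?thesis unfolding 4 c o4 by simp
  qed
qed

text \<open>Lying in the same orbit of the group; the classes will be the fibres of the projection
  to the quotient sphere.\<close>

definition gauss_rel :: "complex \<Rightarrow> complex \<Rightarrow> bool" where
  "gauss_rel z w \<longleftrightarrow> (\<exists>u \<gamma>. u ^ 4 = 1 \<and> \<gamma> \<in> gauss_ints \<and> w = u * z + \<gamma>)"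

lemma gauss_relI: "u ^ 4 = 1 \<Longrightarrow> \<gamma> \<in> gauss_ints \<Longrightarrow> gauss_rel z (u * z + \<gamma>)"
  by (auto simp: gauss_rel_def)

text \<open>Stabilisers along an orbit are conjugate. In the computation \<open>u ^ 3\<close> serves
  as the inverse of \<open>u\<close>.\<close>

lemma rot_ord_gauss_rel:
  assumes "gauss_rel z w"
  shows "rot_ord w = rot_ord z"
proof -
  obtain u \<gamma> where u: "u ^ 4 = 1" and l: "\<gamma> \<in> gauss_ints" and w: "w = u * z + \<gamma>"
    using assms by (auto simp: gauss_rel_def)
  have "\<kappa> * w \<in> gauss_ints \<longleftrightarrow> \<kappa> * z \<in> gauss_ints" if k: "\<kappa> \<in> gauss_ints" for \<kappa>
  proof
    assume "\<kappa> * w \<in> gauss_ints"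
    then have "u ^ 3 * (\<kappa> * w - \<kappa> * \<gamma>) \<in> gauss_ints" using u l k by blast
    moreover have "u ^ 3 * (\<kappa> * w - \<kappa> * \<gamma>) = u ^ 4 * (\<kappa> * z)"
      by (simp add: w algebra_simps power3_eq_cube power4_eq_xxxx)
    ultimately show "\<kappa> * z \<in> gauss_ints" using u by simp
  next
    assume "\<kappa> * z \<in> gauss_ints"
    then have "u * (\<kappa> * z) + \<kappa> * \<gamma> \<in> gauss_ints" using u l k by blast
    then show "\<kappa> * w \<in> gauss_ints" by (simp add: w algebra_simps)
  qed
  from this[of 2] this[of "1 - \<i>"] show ?thesis by (simp add: rot_ord_def)
qed

lemma rot_ord_0 [simp]: "rot_ord 0 = 4"
  by (simp add: rot_ord_def)

lemma rot_ord_center [simp]: "rot_ord ((1 + \<i>) / 2) = 4"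
proof -
  have "(1 - \<i>) * ((1 + \<i>) / 2) = 1" by (simp add: field_simps)
  then show ?thesis by (simp only: rot_ord_def) simp
qed

lemma half_not_Ints: "(1 / 2 :: real) \<notin> \<int>"
  by (auto elim!: Ints_cases simp: field_simps)

lemma rot_ord_half [simp]: "rot_ord (1 / 2) = 2"
  using half_not_Ints by (auto simp: rot_ord_def gauss_ints_def)

lemma not_gauss_rel_0_center: "\<not> gauss_rel 0 ((1 + \<i>) / 2)"
proof
  assume "gauss_rel 0 ((1 + \<i>) / 2)"
  then have "(1 + \<i>) / 2 \<in> gauss_ints" by (auto simp: gauss_rel_def)
  then show False using half_not_Ints by (simp add: gauss_ints_def)
qed

text \<open>If \<open>(1 - \<i>) * z = a + b \<i>\<close>, the coordinates of \<open>z\<close> are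
  \<open>(a - b) / 2\<close> and \<open>(a + b) / 2\<close>, whose numerators have the same parity.
  Even numerators give lattice points, odd ones translates of the centre of the unit square.\<close>

lemma rot_ord_4:
  assumes "rot_ord z = 4"
  shows "gauss_rel 0 z \<or> gauss_rel ((1 + \<i>) / 2) z"
proof -
  have "(1 - \<i>) * z \<in> gauss_ints" using assms by (auto simp: rot_ord_def split: if_splits)
  then obtain a b :: int where ab: "(1 - \<i>) * z = Complex (of_int a) (of_int b)"
    using gauss_ints_iff by blast
  have "z = (1 + \<i>) * ((1 - \<i>) * z) / 2" by (simp add: field_simps)
  then have z: "z = Complex (of_int (a - b) / 2) (of_int (a + b) / 2)"
    unfolding ab by (simp add: complex_eq_iff)
  show ?thesis
  proof (cases "even (a + b)")
    case True
    then obtain m n where "a + b = 2 * m" "a - b = 2 * n" by (metis dvdE even_add even_diff)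
    then have "z \<in> gauss_ints" by (simp add: z gauss_ints_def)
    then show ?thesis using gauss_relI[of 1 z 0] by simp
  next
    case False
    then have "odd (a - b)" by simp
    then obtain n where "a - b = 2 * n + 1" by (rule oddE)
    moreover from False obtain m where "a + b = 2 * m + 1" by (rule oddE)
    ultimately have "z = 1 * ((1 + \<i>) / 2) + Complex (of_int n) (of_int m)"
      by (simp add: z complex_eq_iff add_divide_distrib)
    moreover have "Complex (of_int n) (of_int m) \<in> gauss_ints" by (simp add: gauss_ints_def)
    ultimately show ?thesis using gauss_relI[of 1] by (metis power_one)
  qed
qed

text \<open>The numerators of the half-integral coordinates of \<open>z\<close> must have different
  parity, since equal parity would put \<open>(1 - \<i>) * z\<close> into the lattice. This leaves
  the midpoints of horizontal and vertical edges, which multiplication by \<open>\<i>\<close>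
  interchanges.\<close>

lemma rot_ord_2:
  assumes "rot_ord z = 2"
  shows "gauss_rel (1 / 2) z"
proof -
  have n4: "(1 - \<i>) * z \<notin> gauss_ints" and "2 * z \<in> gauss_ints"
    using assms by (auto simp: rot_ord_def split: if_splits)
  then obtain a b :: int where "2 * z = Complex (of_int a) (of_int b)"
    using gauss_ints_iff by blast
  then have z: "z = Complex (of_int a / 2) (of_int b / 2)" by (simp add: complex_eq_iff)
  have "odd (a + b)"
  proof
    assume "even (a + b)"
    then obtain m n where "a + b = 2 * m" "b - a = 2 * n" by (metis dvdE even_add even_diff)
    then have "(1 - \<i>) * z = Complex (of_int m) (of_int n)"
      by (simp add: z complex_eq_iff field_simps flip: of_int_add of_int_diff)
    then show False using n4 by (auto simp: gauss_ints_def)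
  qed
  then consider "odd a" "even b" | "even a" "odd b" by auto
  then show ?thesis
  proof cases
    case 1
    then obtain m n where "a = 2 * m + 1" "b = 2 * n" by (auto elim!: evenE oddE)
    then have "z = 1 * (1 / 2) + Complex (of_int m) (of_int n)"
      by (simp add: z complex_eq_iff add_divide_distrib)
    moreover have "Complex (of_int m) (of_int n) \<in> gauss_ints" by (simp add: gauss_ints_def)
    ultimately show ?thesis using gauss_relI[of 1] by (metis power_one)
  next
    case 2
    then obtain m n where "a = 2 * m" "b = 2 * n + 1" by (auto elim!: evenE oddE)
    then have "z = \<i> * (1 / 2) + Complex (of_int m) (of_int n)"
      by (simp add: z complex_eq_iff add_divide_distrib)
    moreover have "Complex (of_int m) (of_int n) \<in> gauss_ints" by (simp add: gauss_ints_def)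
    moreover have "\<i> ^ 4 = 1" by (simp add: power4_eq_xxxx)
    ultimately show ?thesis using gauss_relI by metis
  qed
qed

text \<open>All these points are halves of lattice points. Countability ensures that removing them
  from a connected open set of the plane leaves it connected.\<close>

lemma countable_rot_ord: "countable {z. rot_ord z \<noteq> 1}"
proof -
  have "{z. rot_ord z \<noteq> 1} \<subseteq> (\<lambda>z. z / 2) ` gauss_ints"
  proof
    fix z assume "z \<in> {z. rot_ord z \<noteq> 1}"
    then have "(- 1) ^ rot_ord z = (1 :: complex)" using rot_ord_cases[of z] by auto
    then have "- 1 * z - z \<in> gauss_ints" by (subst unit_rot_ord_iff) auto
    then have "2 * z \<in> gauss_ints"
      by (metis gauss_ints_uminus_iff minus_add_distrib mult_2 uminus_add_conv_diff add.commute mult_minus1)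
    then show "z \<in> (\<lambda>z. z / 2) ` gauss_ints" by (intro image_eqI[of _ _ "2 * z"]) auto
  qed
  then show ?thesis using countable_gauss_ints countable_subset by blast
qed

text \<open>Close to \<open>z\<close> only the stabiliser of \<open>z\<close> identifies points. It
  acts on \<open>h\<close> by the roots of unity of order \<open>rot_ord z\<close>, and the power
  \<open>h ^ rot_ord z\<close> separates the orbits of this action.\<close>

lemma gauss_rel_local:
  "\<exists>r>0. \<forall>h h'. norm h < r \<longrightarrow> norm h' < r \<longrightarrow>
     (gauss_rel (z + h) (z + h') \<longleftrightarrow> h ^ rot_ord z = h' ^ rot_ord z)"
proof -
  have "\<forall>u. \<exists>r>0. \<forall>\<gamma>\<in>gauss_ints. (u * z - z) + \<gamma> \<noteq> 0 \<longrightarrow> r \<le> norm ((u * z - z) + \<gamma>)"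
    using gauss_translate_discrete by blast
  then obtain R where R: "\<And>u. R u > 0"
    "\<And>u \<gamma>. \<gamma> \<in> gauss_ints \<Longrightarrow> (u * z - z) + \<gamma> \<noteq> 0 \<Longrightarrow> R u \<le> norm ((u * z - z) + \<gamma>)"
    by metis
  \<comment> \<open>An identification of \<open>z + h\<close> with \<open>z + h'\<close> moves
    \<open>z\<close> by \<open>h' - u * h\<close>, of norm below \<open>2 * r\<close>. Halving the
    least of the four gaps forces this displacement to vanish.\<close>
  define r where "r = Min (R ` {1, - 1, \<i>, - \<i>}) / 2"
  have "r > 0" using R(1) by (simp add: r_def)
  have rR: "2 * r \<le> R u" if "u ^ 4 = 1" for u
    unfolding r_def using unit_cases[OF that] by auto
  have "gauss_rel (z + h) (z + h') \<longleftrightarrow> h ^ rot_ord z = h' ^ rot_ord z"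
    if h: "norm h < r" "norm h' < r" for h h'
  proof
    assume "gauss_rel (z + h) (z + h')"
    then obtain u \<gamma> where u: "u ^ 4 = 1" "\<gamma> \<in> gauss_ints" and eq: "z + h' = u * (z + h) + \<gamma>"
      by (auto simp: gauss_rel_def)
    have "(u * z - z) + \<gamma> = h' - u * h" using eq by (simp add: algebra_simps)
    moreover have "norm (h' - u * h) \<le> norm h' + norm (u * h)" by (rule norm_triangle_ineq4)
    moreover have "norm (u * h) = norm h" using u by (simp add: norm_mult norm_unit)
    ultimately have "norm ((u * z - z) + \<gamma>) < R u" using h rR[OF u(1)] by simp
    with R(2)[OF u(2)] have 0: "(u * z - z) + \<gamma> = 0" by force
    then have "u * z - z = - \<gamma>" by (simp add: eq_neg_iff_add_eq_0)
    then have "u * z - z \<in> gauss_ints" using u by simp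
    then have "u ^ rot_ord z = 1" using unit_rot_ord_iff u by blast
    moreover have "h' - u * h = (z + h') - (u * (z + h) + \<gamma>) + ((u * z - z) + \<gamma>)"
      by (simp add: algebra_simps)
    then have "h' = u * h" using 0 eq by simp
    ultimately show "h ^ rot_ord z = h' ^ rot_ord z" by (simp add: power_mult_distrib)
  next
    assume eq: "h ^ rot_ord z = h' ^ rot_ord z"
    have "\<exists>u. u ^ rot_ord z = 1 \<and> h' = u * h"
    proof (cases "h = 0")
      case True
      then have "h' = 0" using eq by (metis power_eq_0_iff rot_ord_pos power_0_left less_irrefl)
      with True show ?thesis by (intro exI[of _ 1]) auto
    next
      case False
      then have "h ^ rot_ord z \<noteq> 0" by simp
      then have "(h' / h) ^ rot_ord z = 1" using eq by (simp add: power_divide)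
      then show ?thesis using False by (intro exI[of _ "h' / h"]) auto
    qed
    then obtain u where u: "u ^ rot_ord z = 1" "h' = u * h" by blast
    have u4: "u ^ 4 = 1" by (rule unit_of_rot_ord[OF u(1)])
    then have "u * z - z \<in> gauss_ints" using unit_rot_ord_iff u by blast
    then have "- (u * z - z) \<in> gauss_ints" by blast
    moreover have "z + h' = u * (z + h) + (- (u * z - z))" using u by (simp add: algebra_simps)
    ultimately show "gauss_rel (z + h) (z + h')" using gauss_relI[OF u4] by metis
  qed
  with \<open>r > 0\<close> show ?thesis by blast
qed

section \<open>Ideals and residues in the Gaussian integers\<close>

text \<open>Division with remainder: rounding both coordinates of \<open>\<gamma> / \<mu>\<close>
  leaves an error of squared norm at most 1/2, so a nonzero element \<open>\<mu>\<close> of least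
  norm in \<open>L\<close> leaves remainder 0.\<close>

lemma gauss_principal:
  assumes sub: "L \<subseteq> gauss_ints" and nz: "\<exists>\<gamma>\<in>L. \<gamma> \<noteq> 0"
    and diff: "\<And>z w. z \<in> L \<Longrightarrow> w \<in> L \<Longrightarrow> z - w \<in> L"
    and mult: "\<And>z w. z \<in> gauss_ints \<Longrightarrow> w \<in> L \<Longrightarrow> z * w \<in> L"
  obtains \<mu> where "\<mu> \<in> L" "\<mu> \<noteq> 0" "L = (\<lambda>\<kappa>. \<mu> * \<kappa>) ` gauss_ints"
proof -
  define N where "N = (\<lambda>z :: complex. nat \<lfloor>(norm z)\<^sup>2\<rfloor>)"
  have N: "(norm z)\<^sup>2 = real (N z)" if "z \<in> L" for z
  proof -
    have "z \<in> gauss_ints" using that sub by auto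
    from norm_gauss_ints_sq[OF this] obtain n :: nat where "(norm z)\<^sup>2 = real n" ..
    then show ?thesis by (simp add: N_def)
  qed
  obtain \<mu> where m: "\<mu> \<in> L" "\<mu> \<noteq> 0" and min: "\<And>w. w \<in> L \<Longrightarrow> w \<noteq> 0 \<Longrightarrow> N \<mu> \<le> N w"
    using ex_has_least_nat[of "\<lambda>w. w \<in> L \<and> w \<noteq> 0" _ N] nz by blast
  have "\<gamma> \<in> (\<lambda>\<kappa>. \<mu> * \<kappa>) ` gauss_ints" if l: "\<gamma> \<in> L" for \<gamma>
  proof -
    define q where "q = Complex (of_int (round (Re (\<gamma> / \<mu>)))) (of_int (round (Im (\<gamma> / \<mu>))))"
    have q: "q \<in> gauss_ints" by (simp add: q_def gauss_ints_def)
    have half: "(x - of_int (round x))\<^sup>2 \<le> 1 / 4" for x :: real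
    proof -
      have "\<bar>x - of_int (round x)\<bar> \<le> 1 / 2" using of_int_round_abs_le[of x] by (simp add: abs_minus_commute)
      then have "\<bar>x - of_int (round x)\<bar>\<^sup>2 \<le> (1 / 2)\<^sup>2" by (intro power_mono) auto
      then show ?thesis by (simp add: power2_eq_square)
    qed
    have "(norm (\<gamma> / \<mu> - q))\<^sup>2 \<le> 1 / 4 + 1 / 4"
      unfolding cmod_power2 by (intro add_mono) (simp_all only: q_def complex.sel minus_complex.sel half)
    then have "(norm (\<gamma> / \<mu> - q))\<^sup>2 < 1" by simp
    moreover have "\<gamma> - q * \<mu> = (\<gamma> / \<mu> - q) * \<mu>" using m by (simp add: field_simps)
    ultimately have "(norm (\<gamma> - q * \<mu>))\<^sup>2 < (norm \<mu>)\<^sup>2"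
      using m by (simp add: norm_mult power_mult_distrib)
    moreover have in_L: "\<gamma> - q * \<mu> \<in> L" using l m q diff mult by blast
    ultimately have "\<not> N \<mu> \<le> N (\<gamma> - q * \<mu>)" using N m by simp
    then have "\<gamma> - q * \<mu> = 0" using min in_L by blast
    then show ?thesis using q by (auto simp: mult.commute)
  qed
  then have "L = (\<lambda>\<kappa>. \<mu> * \<kappa>) ` gauss_ints" using m mult by (auto simp: mult.commute)
  with m that show thesis by blast
qed

text \<open>Residues modulo \<open>x + i y\<close>: with \<open>g = gcd x y\<close> the imaginary part can be reduced modulo \<open>g\<close>,
  and the multiples of \<open>x + i y\<close> with vanishing imaginary part are those of \<open>(x\<^sup>2 + y\<^sup>2) / g\<close>.\<close>

lemma gauss_residues:
  assumes m: "\<mu> \<in> gauss_ints" "\<mu> \<noteq> 0" and d: "(norm \<mu>)\<^sup>2 = real d"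
  obtains D where "finite D" "card D = d" "D \<subseteq> gauss_ints"
    "\<And>\<gamma>. \<gamma> \<in> gauss_ints \<Longrightarrow> \<exists>\<delta>\<in>D. \<exists>\<kappa>\<in>gauss_ints. \<gamma> = \<delta> + \<mu> * \<kappa>"
    "\<And>\<delta> \<delta>' \<kappa>. \<delta> \<in> D \<Longrightarrow> \<delta>' \<in> D \<Longrightarrow> \<kappa> \<in> gauss_ints \<Longrightarrow> \<delta> = \<delta>' + \<mu> * \<kappa> \<Longrightarrow> \<delta> = \<delta>'"
proof -
  obtain x y :: int where mu: "\<mu> = Complex (of_int x) (of_int y)" using m gauss_ints_iff by blast
  define g where "g = gcd x y"
  have xy: "x \<noteq> 0 \<or> y \<noteq> 0" using m by (auto simp: mu complex_eq_iff)
  then have g: "g > 0" by (simp add: g_def)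
  obtain x' y' where x': "x = g * x'" and y': "y = g * y'"
    unfolding g_def by (metis dvdE gcd_dvd1 gcd_dvd2)
  obtain u v where bez: "u * x + v * y = g" unfolding g_def using bezout_int by blast
  then have "g * (u * x' + v * y') = g * 1" by (simp add: x' y' algebra_simps)
  then have uv: "u * x' + v * y' = 1" using g by simp
  \<comment> \<open>\<open>M\<close> is the product of \<open>\<mu>\<close> and
    \<open>Complex x' (- y')\<close>, a real multiple of \<open>\<mu>\<close>.\<close>
  define M where "M = x' * x + y' * y"
  have "real_of_int (x\<^sup>2 + y\<^sup>2) = real d" using d by (simp add: mu cmod_power2)
  then have "x\<^sup>2 + y\<^sup>2 = int d" by linarith
  then have gM: "g * M = int d" by (simp add: M_def x' y' power2_eq_square algebra_simps)
  have "int d > 0" using xy \<open>x\<^sup>2 + y\<^sup>2 = int d\<close> by (metis sum_power2_gt_zero_iff)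
  then have "0 < g * M" using gM by simp
  then have M: "M > 0" using g by (simp add: zero_less_mult_iff)
  define c where "c = (\<lambda>(a :: int, b :: int). Complex (of_int a) (of_int b))"
  have injc: "inj c" by (auto simp: c_def inj_on_def)
  define D where "D = c ` ({0..<M} \<times> {0..<g})"
  show thesis
  proof
    show "finite D" by (simp add: D_def)
    have "card D = card ({0..<M} \<times> {0..<g})"
      unfolding D_def using injc by (intro card_image) (auto intro: inj_on_subset)
    then have "int (card D) = int d"
      using g M gM by (simp add: card_cartesian_product algebra_simps)
    then show "card D = d" by simp
    show "D \<subseteq> gauss_ints" by (auto simp: D_def c_def gauss_ints_def)
  next
    fix \<gamma> assume "\<gamma> \<in> gauss_ints"
    then obtain a b :: int where l: "\<gamma> = Complex (of_int a) (of_int b)" using gauss_ints_iff by blast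
    \<comment> \<open>The product of \<open>\<mu>\<close> and \<open>Complex v u\<close> has
      imaginary part \<open>g\<close>. Subtracting \<open>e\<close> times this product reduces the
      imaginary part modulo \<open>g\<close>; subtracting \<open>s\<close> times \<open>M\<close>
      then reduces the real part without disturbing it.\<close>
    define e where "e = b div g"
    define a' where "a' = a - e * (v * x - u * y)"
    define s where "s = a' div M"
    have "b = b mod g + e * g" by (simp add: e_def)
    moreover have "a = a' mod M + s * M + e * (v * x - u * y)" by (simp add: s_def a'_def)
    moreover have "e * g = y * (e * v + s * x') + x * (e * u - s * y')"
    proof -
      have "e * g = e * (u * x + v * y)" using bez by simp
      moreover have "y * (s * x') = x * (s * y')"
        unfolding x' y' by (simp only: mult_ac)
      moreover have "y * (e * v + s * x') + x * (e * u - s * y')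
          = e * (u * x + v * y) + (y * (s * x') - x * (s * y'))"
        by (simp add: algebra_simps)
      ultimately show ?thesis by (simp only: diff_self add_0_right)
    qed
    moreover have "s * M + e * (v * x - u * y) = x * (e * v + s * x') - y * (e * u - s * y')"
      by (simp add: M_def algebra_simps)
    ultimately have "\<gamma> = c (a' mod M, b mod g) + \<mu> * c (e * v + s * x', e * u - s * y')"
      unfolding l mu c_def
      by (simp add: complex_eq_iff flip: of_int_add of_int_mult of_int_diff)
    moreover have "c (a' mod M, b mod g) \<in> D" unfolding D_def using g M by (intro imageI) auto
    moreover have "c q \<in> gauss_ints" for q by (cases q) (auto simp: c_def gauss_ints_def)
    ultimately show "\<exists>\<delta>\<in>D. \<exists>\<kappa>\<in>gauss_ints. \<gamma> = \<delta> + \<mu> * \<kappa>" by blast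
  next
    fix \<delta> \<delta>' \<kappa> assume "\<delta> \<in> D" "\<delta>' \<in> D" "\<kappa> \<in> gauss_ints" and eq: "\<delta> = \<delta>' + \<mu> * \<kappa>"
    then obtain a b a' b' p q where ab: "\<delta> = c (a, b)" "a \<in> {0..<M}" "b \<in> {0..<g}"
      and ab': "\<delta>' = c (a', b')" "a' \<in> {0..<M}" "b' \<in> {0..<g}"
      and k: "\<kappa> = Complex (of_int p) (of_int q)"
      by (auto simp: D_def gauss_ints_iff)
    have "real_of_int a = real_of_int (a' + (x * p - y * q))"
         "real_of_int b = real_of_int (b' + (x * q + y * p))"
      using eq by (simp_all add: ab ab' k mu c_def complex_eq_iff)
    then have aa: "a - a' = x * p - y * q" and bb: "b - b' = x * q + y * p" by linarith+
    have "g dvd b - b'" unfolding bb by (simp add: x' y')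
    then have b0: "b = b'" using ab ab'
      by (metis atLeastLessThan_iff mod_eq_dvd_iff mod_pos_pos_trivial)
    then have "g * (x' * q + y' * p) = 0" using bb by (simp add: x' y' algebra_simps)
    then have pq: "x' * q = - (y' * p)" using g by simp
    \<comment> \<open>As \<open>x'\<close> and \<open>y'\<close> are coprime, \<open>pq\<close>
      forces \<open>p = x' * t\<close> and \<open>q = - y' * t\<close>; the Bezout relation
      \<open>uv\<close> recovers the factor \<open>t\<close>.\<close>
    define t where "t = u * p - v * q"
    have "x' * t = u * x' * p - v * (x' * q)" by (simp add: t_def algebra_simps)
    also have "\<dots> = (u * x' + v * y') * p" unfolding pq by (simp add: algebra_simps)
    also have "\<dots> = p" by (simp add: uv)
    finally have p: "p = x' * t" by simp
    have "q = (u * x' + v * y') * q" by (simp add: uv)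
    also have "\<dots> = u * (x' * q) + v * y' * q" by (simp add: algebra_simps)
    also have "\<dots> = - y' * t" unfolding pq by (simp add: t_def algebra_simps)
    finally have q: "q = - y' * t" .
    have "a - a' = M * t" unfolding aa p q by (simp add: M_def algebra_simps)
    then have "M dvd a - a'" by simp
    then have "a = a'" using ab ab'
      by (metis atLeastLessThan_iff mod_eq_dvd_iff mod_pos_pos_trivial)
    with b0 ab ab' show "\<delta> = \<delta>'" by simp
  qed
qed

section \<open>The square orbifold\<close>

lemma gauss_rel_refl [simp]: "gauss_rel z z"
  using gauss_relI[of 1 0 z] by simp

lemma gauss_rel_sym:
  assumes "gauss_rel z w"
  shows "gauss_rel w z"
proof -
  obtain u \<gamma> where u: "u ^ 4 = 1" "\<gamma> \<in> gauss_ints" "w = u * z + \<gamma>"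
    using assms by (auto simp: gauss_rel_def)
  have "u ^ 3 * w + - (u ^ 3 * \<gamma>) = u ^ 4 * z"
    by (simp add: u(3) algebra_simps power3_eq_cube power4_eq_xxxx)
  then have "z = u ^ 3 * w + - (u ^ 3 * \<gamma>)" using u by simp
  moreover have "(u ^ 3) ^ 4 = (u ^ 4) ^ 3" by (simp flip: power_mult)
  then have "(u ^ 3) ^ 4 = 1" using u by simp
  moreover have "- (u ^ 3 * \<gamma>) \<in> gauss_ints" using u by blast
  ultimately show ?thesis unfolding gauss_rel_def by blast
qed

lemma gauss_rel_trans:
  assumes "gauss_rel z w" "gauss_rel w v"
  shows "gauss_rel z v"
proof -
  obtain u \<gamma> where u: "u ^ 4 = 1" "\<gamma> \<in> gauss_ints" "w = u * z + \<gamma>"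
    using assms by (auto simp: gauss_rel_def)
  obtain u' \<gamma>' where u': "u' ^ 4 = 1" "\<gamma>' \<in> gauss_ints" "v = u' * w + \<gamma>'"
    using assms by (auto simp: gauss_rel_def)
  have "v = (u' * u) * z + (u' * \<gamma> + \<gamma>')" by (simp add: u u' algebra_simps)
  moreover have "(u' * u) ^ 4 = 1" using u u' by (simp add: power_mult_distrib)
  moreover have "u' * \<gamma> + \<gamma>' \<in> gauss_ints" using u u' by blast
  ultimately show ?thesis unfolding gauss_rel_def by blast
qed

lemma gauss_rel_mult_i: "gauss_rel z (\<i> * z)"
  using gauss_relI[of \<i> 0 z] by (simp add: power4_eq_xxxx)

section \<open>Trigonometric coordinates for the orbits\<close>

lemma cos_2pi_eqD:
  assumes "cos (2 * pi * a) = cos (2 * pi * (b :: real))"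
  shows "\<exists>n :: int. b = a + of_int n \<or> b = - a + of_int n"
proof -
  have "2 * sin ((2 * pi * a + 2 * pi * b) / 2) * sin ((2 * pi * b - 2 * pi * a) / 2) = 0"
    unfolding cos_diff_cos[symmetric] using assms by simp
  then have "sin (pi * (a + b)) = 0 \<or> sin (pi * (b - a)) = 0"
    by (auto simp: algebra_simps add_divide_distrib diff_divide_distrib)
  then consider i :: int where "pi * (a + b) = of_int i * pi" | i :: int where "pi * (b - a) = of_int i * pi"
    unfolding sin_zero_iff_int2 by blast
  then show ?thesis
  proof cases
    case 1
    then have "a + b = of_int i" by (simp add: mult.commute)
    then show ?thesis by (intro exI[of _ i]) linarith
  next
    case 2
    then have "b - a = of_int i" by (simp add: mult.commute)
    then show ?thesis by (intro exI[of _ i]) linarith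
  qed
qed

lemma sin_2pi_eq_0D:
  assumes "sin (2 * pi * (a :: real)) = 0"
  shows "\<exists>n :: int. 2 * a = of_int n"
proof -
  obtain i :: int where "2 * pi * a = of_int i * pi" using assms unfolding sin_zero_iff_int2 by blast
  then have "pi * (2 * a) = pi * of_int i" by (simp add: mult_ac)
  then have "2 * a = of_int i" using pi_neq_zero mult_cancel_left by blast
  then show ?thesis by blast
qed

lemma cos_2pi_add_int [simp]: "cos (2 * pi * (x + of_int n)) = cos (2 * pi * x)"
  using cos_int_2pin[of n] sin_int_2pin[of n] by (simp add: distrib_left cos_add)

lemma sin_2pi_add_int [simp]: "sin (2 * pi * (x + of_int n)) = sin (2 * pi * x)"
  using cos_int_2pin[of n] sin_int_2pin[of n] by (simp add: distrib_left sin_add)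

lemma cos_2pi_int_pm [simp]:
  "cos (2 * pi * (of_int n + x)) = cos (2 * pi * x)" "cos (2 * pi * (of_int n - x)) = cos (2 * pi * x)"
proof -
  show "cos (2 * pi * (of_int n + x)) = cos (2 * pi * x)"
    by (subst add.commute) (rule cos_2pi_add_int)
  have "cos (2 * pi * (of_int n - x)) = cos (2 * pi * (- x + of_int n))" by (simp only: uminus_add_conv_diff)
  also have "\<dots> = cos (2 * pi * (- x))" by (rule cos_2pi_add_int)
  finally show "cos (2 * pi * (of_int n - x)) = cos (2 * pi * x)" by simp
qed

lemma sin_2pi_int_pm [simp]:
  "sin (2 * pi * (of_int n + x)) = sin (2 * pi * x)" "sin (2 * pi * (of_int n - x)) = - sin (2 * pi * x)"
proof -
  show "sin (2 * pi * (of_int n + x)) = sin (2 * pi * x)"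
    by (subst add.commute) (rule sin_2pi_add_int)
  have "sin (2 * pi * (of_int n - x)) = sin (2 * pi * (- x + of_int n))" by (simp only: uminus_add_conv_diff)
  also have "\<dots> = sin (2 * pi * (- x))" by (rule sin_2pi_add_int)
  finally show "sin (2 * pi * (of_int n - x)) = - sin (2 * pi * x)" by simp
qed

text \<open>The quotient of the plane by the orientation preserving symmetry group of the square
  lattice is the double of the fundamental triangle of the full symmetry group, cut out by
  \<open>1 \<ge> X \<ge> Y \<ge> - 1\<close> in the coordinates below. Barycentric coordinates locate the point in the
  triangle; the sign of \<open>chir\<close> tells the two copies apart and vanishes on the boundary.\<close>

context
begin

private definition A :: "complex \<Rightarrow> real" where "A z = cos (2 * pi * Re z)"
private definition B :: "complex \<Rightarrow> real" where "B z = cos (2 * pi * Im z)"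
private definition chir :: "complex \<Rightarrow> real" where
  "chir z = sin (2 * pi * Re z) * sin (2 * pi * Im z) * (A z - B z)"
private definition l1 :: "complex \<Rightarrow> real" where "l1 z = (1 - max (A z) (B z)) / 2"
private definition l2 :: "complex \<Rightarrow> real" where "l2 z = (max (A z) (B z) - min (A z) (B z)) / 2"
private definition l3 :: "complex \<Rightarrow> real" where "l3 z = (1 + min (A z) (B z)) / 2"
private definition lmin :: "complex \<Rightarrow> real" where "lmin z = min (l1 z) (min (l2 z) (l3 z))"
text \<open>The modulus of the height is the smallest barycentric coordinate. It vanishes on the
  sides, so the two copies of the triangle become two roofs glued along their common boundary,
  forming a bipyramid.\<close>

private definition height :: "complex \<Rightarrow> real" where "height z = sgn (chir z) * lmin z"

private lemma l_nonneg: "l1 z \<ge> 0" "l2 z \<ge> 0" "l3 z \<ge> 0" "lmin z \<ge> 0"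
proof -
  have "\<bar>A z\<bar> \<le> 1" "\<bar>B z\<bar> \<le> 1" by (auto simp: A_def B_def)
  then show "l1 z \<ge> 0" "l2 z \<ge> 0" "l3 z \<ge> 0" by (auto simp: l1_def l2_def l3_def)
  then show "lmin z \<ge> 0" by (simp add: lmin_def)
qed

private lemma l_sum: "l1 z + l2 z + l3 z = 1"
  by (simp add: l1_def l2_def l3_def field_simps)

text \<open>Both sides describe the mirrors of the full symmetry group: a factor of
  \<open>chir\<close> vanishes exactly where one of the two cosines is 1 or - 1 or where they agree,
  that is, on a side of the triangle.\<close>

private lemma chir_eq_0_iff: "chir z = 0 \<longleftrightarrow> lmin z = 0"
proof -
  have s: "sin x = 0 \<longleftrightarrow> cos x = 1 \<or> cos x = - 1" for x :: real
  proof -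
    have "(sin x)\<^sup>2 = (1 - cos x) * (1 + cos x)"
      by (simp add: sin_squared_eq algebra_simps power2_eq_square)
    then have "sin x = 0 \<longleftrightarrow> 1 - cos x = 0 \<or> 1 + cos x = 0"
      by (metis mult_eq_0_iff zero_eq_power2)
    then show ?thesis by linarith
  qed
  have AB: "\<bar>A z\<bar> \<le> 1" "\<bar>B z\<bar> \<le> 1" by (auto simp: A_def B_def)
  have "chir z = 0 \<longleftrightarrow> A z = 1 \<or> A z = - 1 \<or> B z = 1 \<or> B z = - 1 \<or> A z = B z"
    by (auto simp: chir_def s A_def B_def)
  also have "\<dots> \<longleftrightarrow> l1 z = 0 \<or> l2 z = 0 \<or> l3 z = 0"
    using AB by (auto simp: l1_def l2_def l3_def max_def min_def)
  also have "\<dots> \<longleftrightarrow> lmin z = 0"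
    using l_nonneg[of z] by (auto simp: lmin_def min_def)
  finally show ?thesis .
qed

private lemma abs_height: "\<bar>height z\<bar> = lmin z"
  using l_nonneg(4)[of z] chir_eq_0_iff[of z] by (auto simp: height_def abs_mult abs_sgn_eq)

private lemma continuous_A: "continuous_on S A" and continuous_B: "continuous_on S B"
  by (auto simp: A_def[abs_def] B_def[abs_def] intro!: continuous_intros)

private lemma continuous_l1: "continuous_on S l1" and continuous_l2: "continuous_on S l2"
  and continuous_l3: "continuous_on S l3"
  by (auto simp: l1_def[abs_def] l2_def[abs_def] l3_def[abs_def]
      intro!: continuous_intros continuous_A continuous_B)

private lemma continuous_lmin: "continuous_on S lmin"
  by (auto simp: lmin_def[abs_def] intro!: continuous_intros continuous_l1 continuous_l2 continuous_l3)

private lemma continuous_chir: "continuous_on S chir"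
  by (auto simp: chir_def[abs_def] intro!: continuous_intros continuous_A continuous_B)

text \<open>The jump of \<open>sgn\<close> does no harm, because \<open>lmin\<close> vanishes
  wherever \<open>chir\<close> does; the two signs are glued along closed sets.\<close>

private lemma continuous_height: "continuous_on UNIV height"
proof -
  let ?S = "{z. 0 \<le> chir z}" and ?T = "{z. chir z \<le> 0}"
  have cl: "closed ?S" "closed ?T"
    by (auto intro!: closed_Collect_le continuous_chir continuous_intros)
  have "continuous_on (?S \<union> ?T) height"
  proof (rule continuous_on_closed_Un[OF cl])
    have "height z = lmin z" if "z \<in> ?S" for z
      using that chir_eq_0_iff[of z] by (auto simp: height_def sgn_if)
    then show "continuous_on ?S height" using continuous_lmin continuous_on_cong by metis
    have "height z = - lmin z" if "z \<in> ?T" for z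
      using that chir_eq_0_iff[of z] by (auto simp: height_def sgn_if)
    moreover have "continuous_on ?T (\<lambda>z. - lmin z)" by (intro continuous_intros continuous_lmin)
    ultimately show "continuous_on ?T height" using continuous_on_cong by (metis (mono_tags, lifting))
  qed
  moreover have "?S \<union> ?T = UNIV" by auto
  ultimately show ?thesis by simp
qed

text \<open>Multiplication by \<open>\<i>\<close> swaps the two cosines. It reverses the sign of the
  product of the sines and of the difference of the cosines, so their product \<open>chir\<close> is
  unchanged.\<close>

private lemma coords_gauss_rel:
  assumes "gauss_rel z w"
  shows "l1 w = l1 z" "l3 w = l3 z" "height w = height z"
proof -
  obtain u \<gamma> where u: "u ^ 4 = 1" "\<gamma> \<in> gauss_ints" "w = u * z + \<gamma>"
    using assms by (auto simp: gauss_rel_def)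
  obtain a b :: int where g: "\<gamma> = Complex (of_int a) (of_int b)" using u gauss_ints_iff by blast
  let ?sa = "\<lambda>z. sin (2 * pi * Re z)" and ?sb = "\<lambda>z. sin (2 * pi * Im z)"
  consider "u = 1" | "u = - 1" | "u = \<i>" | "u = - \<i>" using unit_cases[OF u(1)] by blast
  then have "(A w = A z \<and> B w = B z \<and> ?sa w * ?sb w = ?sa z * ?sb z)
    \<or> (A w = B z \<and> B w = A z \<and> ?sa w * ?sb w = - (?sa z * ?sb z))"
  proof cases
    case 1
    show ?thesis unfolding u(3) g A_def B_def 1 by simp
  next
    case 2
    show ?thesis unfolding u(3) g A_def B_def 2 by simp
  next
    case 3
    show ?thesis unfolding u(3) g A_def B_def 3 by simp
  next
    case 4
    show ?thesis unfolding u(3) g A_def B_def 4 by simp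
  qed
  then have "max (A w) (B w) = max (A z) (B z) \<and> min (A w) (B w) = min (A z) (B z) \<and> chir w = chir z"
  proof
    assume "A w = A z \<and> B w = B z \<and> ?sa w * ?sb w = ?sa z * ?sb z"
    then show ?thesis by (simp add: chir_def)
  next
    assume *: "A w = B z \<and> B w = A z \<and> ?sa w * ?sb w = - (?sa z * ?sb z)"
    then have "chir w = - (?sa z * ?sb z) * (B z - A z)" by (simp only: chir_def)
    also have "\<dots> = chir z" unfolding chir_def by (simp only: minus_mult_commute minus_diff_eq)
    finally show ?thesis using * by (simp add: max.commute min.commute)
  qed
  then have e: "max (A w) (B w) = max (A z) (B z)" "min (A w) (B w) = min (A z) (B z)" "chir w = chir z"
    by blast+
  show "l1 w = l1 z" "l3 w = l3 z" "height w = height z"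
    by (simp_all only: l1_def l2_def l3_def lmin_def height_def e)
qed

text \<open>The cosines determine both coordinates up to signs and integers. Equal signs come from a
  group element. Opposite signs come from a reflection, which negates the height; equal heights then
  put \<open>z\<close> on a mirror, where the reflection can be replaced by a rotation.\<close>

private lemma gauss_rel_coords_aux:
  assumes AB: "A w = A z" "B w = B z" and h: "height w = height z"
  shows "gauss_rel z w"
proof -
  have rel: "gauss_rel z w" if "u ^ 4 = 1" "Re w = Re (u * z) + of_int n" "Im w = Im (u * z) + of_int m"
    for u n m
  proof -
    have "w = u * z + Complex (of_int n) (of_int m)" using that by (simp add: complex_eq_iff)
    then show ?thesis using gauss_relI[OF that(1)] by (auto simp: gauss_ints_def)
  qed
  obtain n :: int where n: "Re w = Re z + of_int n \<or> Re w = - Re z + of_int n"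
    using cos_2pi_eqD[of "Re z" "Re w"] AB by (auto simp: A_def)
  obtain m :: int where m: "Im w = Im z + of_int m \<or> Im w = - Im z + of_int m"
    using cos_2pi_eqD[of "Im z" "Im w"] AB by (auto simp: B_def)
  consider "Re w = Re z + of_int n" "Im w = Im z + of_int m"
    | "Re w = - Re z + of_int n" "Im w = - Im z + of_int m"
    | e :: int where "e = 1 \<or> e = - 1" "Re w = of_int e * Re z + of_int n" "Im w = - of_int e * Im z + of_int m"
    using n m by (metis mult_1 mult_minus1 of_int_1 of_int_minus minus_minus)
  then show ?thesis
  proof cases
    case 1
    then show ?thesis using rel[of 1 n m] by simp
  next
    case 2
    then show ?thesis using rel[of "- 1" n m] by simp
  next
    case 3
    \<comment> \<open>The reflected case: up to translation, \<open>e = 1\<close> conjugates and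
      \<open>e = - 1\<close> negates the real part.\<close>
    have sw: "sin (2 * pi * Re w) = of_int e * sin (2 * pi * Re z)"
      "sin (2 * pi * Im w) = - of_int e * sin (2 * pi * Im z)"
      using 3(1) unfolding 3(2,3) by auto
    have alg: "(x * a) * (- x * b) * c = - ((x * x) * (a * b * c))" for x a b c :: real by simp
    have "chir w = - ((of_int e * of_int e) * chir z)" unfolding chir_def AB sw by (rule alg)
    moreover have "of_int e * of_int e = (1 :: real)" using 3(1) by auto
    ultimately have "chir w = - chir z" by simp
    moreover have "lmin w = lmin z" by (simp only: lmin_def l1_def l2_def l3_def AB)
    ultimately have "height w = - height z" by (simp only: height_def sgn_minus mult_minus_left)
    then have "lmin z = 0" using h abs_height[of z] by simp
    then have "chir z = 0" using chir_eq_0_iff by blast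
    then consider "sin (2 * pi * Re z) = 0" | "sin (2 * pi * Im z) = 0" | "A z = B z"
      by (auto simp: chir_def)
    then show ?thesis
    proof cases
      case 1
      then obtain k :: int where "2 * Re z = of_int k" using sin_2pi_eq_0D by blast
      then have "Re z = - Re z + of_int k" by linarith
      with 3 have "Re w = Re (of_int (- e) * z) + of_int (n + e * k)" "Im w = Im (of_int (- e) * z) + of_int m"
        by auto
      then show ?thesis using 3(1) rel[of "of_int (- e)" "n + e * k" m] by auto
    next
      case 2
      then obtain k :: int where "2 * Im z = of_int k" using sin_2pi_eq_0D by blast
      then have "Im z = - Im z + of_int k" by linarith
      with 3 have "Re w = Re (of_int e * z) + of_int n" "Im w = Im (of_int e * z) + of_int (m - e * k)"
        by auto
      then show ?thesis using 3(1) rel[of "of_int e" n "m - e * k"] by auto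
    next
      case 4: 3
      then obtain k :: int where k: "Im z = Re z + of_int k \<or> Im z = - Re z + of_int k"
        using cos_2pi_eqD[of "Re z" "Im z"] by (auto simp: A_def B_def)
      then show ?thesis
      proof
        assume k: "Im z = Re z + of_int k"
        have "Re w = Re (of_int (- e) * \<i> * z) + of_int (n - e * k)"
             "Im w = Im (of_int (- e) * \<i> * z) + of_int (m - e * k)"
          using 3 k by auto
        then show ?thesis using 3(1) rel[of "of_int (- e) * \<i>" "n - e * k" "m - e * k"]
          by (auto simp: power4_eq_xxxx)
      next
        assume k: "Im z = - Re z + of_int k"
        have "Re w = Re (of_int e * \<i> * z) + of_int (n + e * k)"
             "Im w = Im (of_int e * \<i> * z) + of_int (m - e * k)"
          using 3 k by auto
        then show ?thesis using 3(1) rel[of "of_int e * \<i>" "n + e * k" "m - e * k"]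
          by (auto simp: power4_eq_xxxx)
      qed
    qed
  qed
qed

text \<open>Maximum and minimum give the two cosines up to order, and multiplication by
  \<open>\<i>\<close> exchanges them.\<close>

private lemma gauss_rel_coords:
  assumes l: "l1 w = l1 z" "l3 w = l3 z" and h: "height w = height z"
  shows "gauss_rel z w"
proof -
  have "max (A w) (B w) = max (A z) (B z)" "min (A w) (B w) = min (A z) (B z)"
    using l by (auto simp: l1_def l3_def)
  then consider "A w = A z" "B w = B z" | "A w = B z" "B w = A z"
    by (auto simp: max_def min_def split: if_splits)
  then show ?thesis
  proof cases
    case 1
    then show ?thesis using gauss_rel_coords_aux h by blast
  next
    case 2
    have "A (\<i> * w) = A z" "B (\<i> * w) = B z" using 2 by (auto simp: A_def B_def)
    moreover have "height (\<i> * w) = height z" using coords_gauss_rel(3)[OF gauss_rel_mult_i[of w]] h by simp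
    ultimately have "gauss_rel z (\<i> * w)" by (rule gauss_rel_coords_aux)
    then show ?thesis using gauss_rel_mult_i gauss_rel_sym gauss_rel_trans by blast
  qed
qed

text \<open>\<open>arccos\<close> yields a point with nonnegative sines, hence with nonnegative
  \<open>chir\<close>. Its complex conjugate has the same barycentric coordinates and lies in the
  other copy of the triangle.\<close>

private lemma coords_surj:
  assumes "a \<ge> 0" "b \<ge> 0" "c \<ge> 0" "a + b + c = 1" "\<bar>t\<bar> = min a (min b c)"
  shows "\<exists>z. l1 z = a \<and> l3 z = c \<and> height z = t"
proof -
  define z where "z = Complex (arccos (1 - 2 * a) / (2 * pi)) (arccos (2 * c - 1) / (2 * pi))"
  have "A z = 1 - 2 * a" "B z = 2 * c - 1"
    using assms by (auto simp: z_def A_def B_def)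
  moreover have Az: "A (cnj z) = A z" "B (cnj z) = B z" by (auto simp: A_def B_def)
  moreover have "1 - 2 * a \<ge> 2 * c - 1" using assms by simp
  ultimately have l: "l1 z = a" "l3 z = c" "l2 z = b"
    "l1 (cnj z) = a" "l3 (cnj z) = c" "l2 (cnj z) = b" and BA: "B z \<le> A z"
    using assms by (auto simp: l1_def l2_def l3_def field_simps)
  have "0 \<le> sin (2 * pi * Re z)" "0 \<le> sin (2 * pi * Im z)"
    using assms by (auto simp: z_def intro!: sin_ge_zero arccos_lbound arccos_ubound)
  then have c: "chir z \<ge> 0" using BA by (simp add: chir_def)
  have c': "chir (cnj z) = - chir z" by (simp add: chir_def Az)
  have lm: "lmin z = \<bar>t\<bar>" "lmin (cnj z) = \<bar>t\<bar>" using assms by (auto simp: lmin_def l)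
  show ?thesis
  proof (cases "t \<ge> 0")
    case True
    then have "height z = t" using c chir_eq_0_iff[of z] lm by (auto simp: height_def sgn_if)
    then show ?thesis using l by blast
  next
    case False
    then have "height (cnj z) = t" using c chir_eq_0_iff[of z] lm by (auto simp: height_def sgn_if c')
    then show ?thesis using l by blast
  qed
qed

private lemma coords_special:
  "l1 0 = 0" "l3 0 = 1" "height 0 = 0"
  "l1 (1 / 2) = 0" "l3 (1 / 2) = 0" "height (1 / 2) = 0"
  "l1 ((1 + \<i>) / 2) = 1" "l3 ((1 + \<i>) / 2) = 0" "height ((1 + \<i>) / 2) = 0"
proof -
  have "Re ((1 + \<i>) / 2) = 1 / 2" "Im ((1 + \<i>) / 2) = 1 / 2" "Re (1 / 2) = 1 / 2" "Im (1 / 2) = 0"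
    by simp_all
  moreover have "2 * pi * (1 / 2) = pi" by simp
  ultimately have AB: "A 0 = 1" "B 0 = 1" "A (1 / 2) = - 1" "B (1 / 2) = 1"
    "A ((1 + \<i>) / 2) = - 1" "B ((1 + \<i>) / 2) = - 1"
    unfolding A_def B_def by (simp_all only: cos_pi zero_complex.sel mult_zero_right cos_zero)
  show l: "l1 0 = 0" "l3 0 = 1" "l1 (1 / 2) = 0" "l3 (1 / 2) = 0"
    "l1 ((1 + \<i>) / 2) = 1" "l3 ((1 + \<i>) / 2) = 0"
    unfolding l1_def l3_def AB by simp_all
  have "height z = 0" if "l1 z = 0 \<or> l3 z = 0" for z
    using that l_nonneg[of z] abs_height[of z] by (auto simp: lmin_def)
  with l show "height 0 = 0" "height (1 / 2) = 0" "height ((1 + \<i>) / 2) = 0" by blast+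
qed

section \<open>From the bipyramid to the round sphere\<close>

text \<open>A line meets the sphere at most twice: the squared norm of
  \<open>y1 + t *\<^sub>R (y2 - y1)\<close> is quadratic in \<open>t\<close> and equals 1 at 0 and
  1, hence at no third parameter.\<close>

private lemma sphere_triple_independent:
  fixes y1 y2 y3 :: "real^3"
  assumes y: "norm y1 = 1" "norm y2 = 1" "norm y3 = 1" and d: "y1 \<noteq> y2" "y1 \<noteq> y3" "y2 \<noteq> y3"
  shows "cross3 (y2 - y1) (y3 - y1) \<noteq> 0"
proof
  assume "cross3 (y2 - y1) (y3 - y1) = 0"
  then have "collinear {0, y2 - y1, y3 - y1}" by (simp add: cross_eq_0)
  then obtain t where t: "y3 - y1 = t *\<^sub>R (y2 - y1)"
    using d by (auto simp: collinear_lemma)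
  let ?b = "y2 - y1"
  have sq: "(norm (y1 + v))\<^sup>2 = 1 + 2 * (y1 \<bullet> v) + v \<bullet> v" for v
    using y(1) by (simp add: power2_norm_eq_inner inner_add_left inner_add_right inner_commute norm_eq_1)
  have "(norm (y1 + ?b))\<^sup>2 = 1" "(norm (y1 + t *\<^sub>R ?b))\<^sup>2 = 1"
    using y by (simp_all flip: t)
  then have 1: "2 * (y1 \<bullet> ?b) + ?b \<bullet> ?b = 0" and 2: "2 * t * (y1 \<bullet> ?b) + t * t * (?b \<bullet> ?b) = 0"
    unfolding sq by simp_all
  have "t * (t - 1) * (?b \<bullet> ?b) = (2 * t * (y1 \<bullet> ?b) + t * t * (?b \<bullet> ?b)) - t * (2 * (y1 \<bullet> ?b) + ?b \<bullet> ?b)"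
    by (simp add: algebra_simps)
  also have "\<dots> = 0" unfolding 1 2 by simp
  finally have "t = 0 \<or> t = 1" using d by auto
  then show False using t d by auto
qed

text \<open>The third column is orthogonal to the other two: the inner product with it recovers the
  third coordinate, and cross products with \<open>b1\<close> and \<open>b2\<close> recover the
  others.\<close>

private lemma linear_of_triple:
  fixes b1 b2 :: "real^3"
  assumes n: "cross3 b1 b2 \<noteq> 0"
  defines "T \<equiv> \<lambda>x :: real^3. x$1 *\<^sub>R b1 + x$2 *\<^sub>R b2 + x$3 *\<^sub>R cross3 b1 b2"
  shows "bij T"
proof -
  have lin: "linear T"
    unfolding T_def by (rule linearI) (auto simp: algebra_simps)
  have "x = 0" if "T x = 0" for x
  proof -
    let ?n = "cross3 b1 b2"
    have "T x \<bullet> ?n = x$3 * (?n \<bullet> ?n)" by (simp add: T_def inner_add_left dot_cross_self)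
    then have x3: "x$3 = 0" using that n by simp
    have "cross3 (T x) b2 = x$1 *\<^sub>R ?n" "cross3 b1 (T x) = x$2 *\<^sub>R ?n"
      by (simp_all add: T_def x3 cross_add_left cross_add_right cross_mult_left cross_mult_right)
    then have "x$1 = 0" "x$2 = 0" using that n by auto
    with x3 show ?thesis by (simp add: vec_eq_iff forall_3)
  qed
  then have "inj T" using linear_injective_0[OF lin] by blast
  then show ?thesis using linear_injective_imp_surjective[OF lin] by (simp add: bij_def)
qed

text \<open>A ray from the interior point \<open>c\<close> leaves the ball once. Its parameter is a
  root of \<open>(v \<bullet> v) * t\<^sup>2 + 2 * (c \<bullet> v) * t - q\<close>; since
  \<open>q > 0\<close>, the roots have opposite signs and \<open>\<tau> v\<close> is the positive
  one.\<close>

private lemma radial_projection: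
  fixes c :: "'a :: real_inner"
  assumes c: "norm c < 1"
  shows "\<exists>\<tau>. continuous_on (- {0}) \<tau> \<and> (\<forall>v. v \<noteq> 0 \<longrightarrow> \<tau> v > 0 \<and> norm (c + \<tau> v *\<^sub>R v) = 1) \<and>
    (\<forall>v t. t > 0 \<longrightarrow> norm (c + t *\<^sub>R v) = 1 \<longrightarrow> t = \<tau> v)"
proof -
  define q where "q = 1 - c \<bullet> c"
  have "(norm c)\<^sup>2 < 1" using c by (simp add: power_less_one_iff)
  then have q: "q > 0" by (simp add: q_def power2_norm_eq_inner)
  define D where "D = (\<lambda>v. (c \<bullet> v)\<^sup>2 + (v \<bullet> v) * q)"
  define \<tau> where "\<tau> = (\<lambda>v. (- (c \<bullet> v) + sqrt (D v)) / (v \<bullet> v))"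
  have norm1: "norm (c + t *\<^sub>R v) = 1 \<longleftrightarrow> (v \<bullet> v) * t\<^sup>2 + 2 * (c \<bullet> v) * t - q = 0" for t v
    by (auto simp: norm_eq_1 q_def inner_add_left inner_add_right inner_commute power2_eq_square algebra_simps)
  have pos: "\<tau> v > 0" if "v \<noteq> 0" for v
  proof -
    have "(c \<bullet> v)\<^sup>2 < D v" using that q by (simp add: D_def)
    then have "\<bar>c \<bullet> v\<bar> < sqrt (D v)" by (simp add: real_less_rsqrt)
    then show ?thesis using that by (simp add: \<tau>_def)
  qed
  have one: "norm (c + \<tau> v *\<^sub>R v) = 1" if "v \<noteq> 0" for v
  proof -
    have "D v \<ge> 0" using q by (simp add: D_def)
    then have "(sqrt (D v))\<^sup>2 = D v" by simp
    moreover have "(v \<bullet> v) * \<tau> v + c \<bullet> v = sqrt (D v)" using that by (simp add: \<tau>_def)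
    ultimately have "((v \<bullet> v) * \<tau> v + c \<bullet> v)\<^sup>2 = D v" by simp
    then have "(v \<bullet> v) * ((v \<bullet> v) * (\<tau> v)\<^sup>2 + 2 * (c \<bullet> v) * \<tau> v - q) = 0"
      by (simp add: D_def power2_eq_square algebra_simps)
    then show ?thesis using that norm1 by simp
  qed
  have uniq: "t = \<tau> v" if t: "t > 0" "norm (c + t *\<^sub>R v) = 1" for t v
  proof (rule ccontr)
    assume ne: "t \<noteq> \<tau> v"
    have v: "v \<noteq> 0" using that c by auto
    let ?s = "\<tau> v"
    have e: "(v \<bullet> v) * t\<^sup>2 + 2 * (c \<bullet> v) * t - q = 0" "(v \<bullet> v) * ?s\<^sup>2 + 2 * (c \<bullet> v) * ?s - q = 0"
      using that one[OF v] norm1 by blast+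
    have "(t - ?s) * ((v \<bullet> v) * t * ?s + q)
        = t * ((v \<bullet> v) * ?s\<^sup>2 + 2 * (c \<bullet> v) * ?s - q) * -1 + ?s * ((v \<bullet> v) * t\<^sup>2 + 2 * (c \<bullet> v) * t - q)"
      by (simp add: power2_eq_square algebra_simps)
    also have "\<dots> = 0" unfolding e by simp
    finally have "(v \<bullet> v) * t * ?s + q = 0" using ne by simp
    moreover have "(v \<bullet> v) * t * ?s > 0" using v t pos[OF v] by simp
    ultimately show False using q by simp
  qed
  have "continuous_on (- {0}) \<tau>"
    unfolding \<tau>_def D_def by (intro continuous_intros) auto
  then show ?thesis using pos one uniq by (intro exI[of _ \<tau>] conjI allI impI)
qed

text \<open>The double of the triangle with vertices \<open>y1\<close>, \<open>y2\<close>, \<open>y3\<close> is realised as the bipyramid over it, which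
  is projected to the sphere from the centroid \<open>c\<close>; this fixes the vertices.\<close>

lemma square_orbifold_map:
  fixes y1 y2 y3 :: "real^3"
  assumes y: "norm y1 = 1" "norm y2 = 1" "norm y3 = 1" and d: "y1 \<noteq> y2" "y1 \<noteq> y3" "y2 \<noteq> y3"
  obtains p :: "complex \<Rightarrow> real^3" where "continuous_on UNIV p" "range p = sphere 0 1"
    "\<And>z w. p z = p w \<longleftrightarrow> gauss_rel z w"
    "p (1 / 2) = y1" "p ((1 + \<i>) / 2) = y2" "p 0 = y3"
proof -
  define c where "c = (1 / 3) *\<^sub>R (y1 + y2 + y3)"
  define b1 b2 where "b1 = y2 - y1" and "b2 = y3 - y1"
  define T where "T = (\<lambda>x :: real^3. x$1 *\<^sub>R b1 + x$2 *\<^sub>R b2 + x$3 *\<^sub>R cross3 b1 b2)"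
  have bij: "bij T" unfolding T_def b1_def b2_def
    using linear_of_triple[OF sphere_triple_independent[OF y d]] by simp
  have T0: "T x = 0 \<longleftrightarrow> x = 0" for x
    using bij_is_inj[OF bij] by (metis (mono_tags, lifting) T_def add.right_neutral injD scaleR_zero_left zero_index)
  have T_scale: "T (s *\<^sub>R x) = s *\<^sub>R T x" for s x by (simp add: T_def scaleR_add_right)
  \<comment> \<open>By the parallelogram law two distinct unit vectors have a sum of norm below 2,
    which puts the centroid inside the ball.\<close>
  have "(norm (y1 + y2))\<^sup>2 + (norm (y1 - y2))\<^sup>2 = 4"
    using y by (simp add: norm_eq_1 power2_norm_eq_inner inner_add_left inner_add_right inner_diff_left inner_diff_right algebra_simps)
  moreover have "(norm (y1 - y2))\<^sup>2 > 0" using d by simp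
  ultimately have "(norm (y1 + y2))\<^sup>2 < 4" by linarith
  then have "(norm (y1 + y2))\<^sup>2 < 2\<^sup>2" by simp
  then have "norm (y1 + y2) < 2" by (rule power2_less_imp_less) simp
  then have "norm (y1 + y2 + y3) < 3" using norm_triangle_ineq[of "y1 + y2" y3] y by simp
  then have "norm c < 1" by (simp add: c_def)
  then obtain \<tau> where \<tau>: "continuous_on (- {0}) \<tau>" "\<And>v. v \<noteq> 0 \<Longrightarrow> \<tau> v > 0"
    "\<And>v. v \<noteq> 0 \<Longrightarrow> norm (c + \<tau> v *\<^sub>R v) = 1"
    "\<And>v t. t > 0 \<Longrightarrow> norm (c + t *\<^sub>R v) = 1 \<Longrightarrow> t = \<tau> v"
    using radial_projection by metis
  \<comment> \<open>The origin is moved to the centroid. It is not on the bipyramid: where all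
    barycentric coordinates are 1/3, the height has modulus 1/3.\<close>
  define K where "K = (\<lambda>z. vector [l1 z - 1 / 3, l3 z - 1 / 3, height z] :: real^3)"
  have K: "K z $ 1 = l1 z - 1 / 3" "K z $ 2 = l3 z - 1 / 3" "K z $ 3 = height z" for z
    by (simp_all add: K_def)
  have K_nz: "K z \<noteq> 0" for z
  proof
    assume "K z = 0"
    then have "l1 z = 1 / 3" "l3 z = 1 / 3" "height z = 0" using K[of z] by auto
    then show False using l_sum[of z] abs_height[of z] by (auto simp: lmin_def)
  qed
  define V where "V = (\<lambda>z. T (K z))"
  have V_nz: "V z \<noteq> 0" for z using K_nz T0 by (simp add: V_def)
  have V_cont: "continuous_on UNIV V"
    unfolding V_def T_def K by (intro continuous_intros continuous_l1 continuous_l3 continuous_height)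
  define p where "p = (\<lambda>z. c + \<tau> (V z) *\<^sub>R V z)"
  have p_norm: "norm (p z) = 1" for z using \<tau>(3) V_nz by (simp add: p_def)
  have p_eq: "p z = c + V z" if "norm (c + V z) = 1" for z
    using \<tau>(4)[of 1 "V z"] that by (simp add: p_def)
  have "continuous_on UNIV (\<lambda>z. \<tau> (V z))"
    by (rule continuous_on_compose2[OF \<tau>(1) V_cont]) (use V_nz in auto)
  then have cont: "continuous_on UNIV p" unfolding p_def by (intro continuous_intros V_cont)
  have rel: "p z = p w \<longleftrightarrow> gauss_rel z w" for z w
  proof
    assume "gauss_rel z w"
    then have "K z = K w" using coords_gauss_rel by (simp add: K_def)
    then show "p z = p w" by (simp add: p_def V_def)
  next
    assume "p z = p w"
    then have "\<tau> (V z) *\<^sub>R V z = \<tau> (V w) *\<^sub>R V w" by (simp add: p_def)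
    then have "(1 / \<tau> (V w)) *\<^sub>R (\<tau> (V w) *\<^sub>R V w) = (1 / \<tau> (V w)) *\<^sub>R (\<tau> (V z) *\<^sub>R V z)" by simp
    moreover have "\<tau> (V w) > 0" using \<tau>(2) V_nz by blast
    ultimately have Vw: "V w = (\<tau> (V z) / \<tau> (V w)) *\<^sub>R V z" by simp
    define s where "s = \<tau> (V z) / \<tau> (V w)"
    have s: "s > 0" using \<tau>(2) V_nz by (simp add: s_def)
    have "T (K w) = T (s *\<^sub>R K z)" using Vw by (simp add: V_def T_scale s_def)
    then have "K w = s *\<^sub>R K z" using bij_is_inj[OF bij] by (simp add: inj_eq)
    then have "K w $ i = s * K z $ i" for i by simp
    from this[of 1] this[of 2] this[of 3]
    have e: "l1 w - 1 / 3 = s * (l1 z - 1 / 3)" "l3 w - 1 / 3 = s * (l3 z - 1 / 3)" "height w = s * height z"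
      by (simp_all add: K)
    have "l2 w - 1 / 3 = - (l1 w - 1 / 3) - (l3 w - 1 / 3)" using l_sum[of w] by linarith
    also have "\<dots> = s * (- (l1 z - 1 / 3) - (l3 z - 1 / 3))"
      unfolding e by (simp only: right_diff_distrib mult_minus_right)
    also have "- (l1 z - 1 / 3) - (l3 z - 1 / 3) = l2 z - 1 / 3" using l_sum[of z] by linarith
    finally have e2: "l2 w - 1 / 3 = s * (l2 z - 1 / 3)" .
    \<comment> \<open>A ray from the centroid meets the bipyramid once. Along it both
      \<open>lmin - 1 / 3\<close> and \<open>lmin\<close>, the modulus of the height, are multiplied
      by \<open>s\<close>, which is only possible for \<open>s = 1\<close>.\<close>
    have "lmin w - 1 / 3 = min (l1 w - 1 / 3) (min (l2 w - 1 / 3) (l3 w - 1 / 3))"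
      by (auto simp: lmin_def min_def)
    also have "\<dots> = s * (lmin z - 1 / 3)"
      unfolding e e2 using s by (auto simp: lmin_def min_def mult_le_cancel_left)
    finally have "lmin w - 1 / 3 = s * (lmin z - 1 / 3)" .
    moreover have "lmin w = s * lmin z"
      using e(3) s by (simp add: abs_mult flip: abs_height)
    ultimately have "s = 1" by (simp add: algebra_simps)
    then show "gauss_rel z w" using gauss_rel_coords[of w z] e by simp
  qed
  have "x \<in> range p" if "x \<in> sphere 0 1" for x
  proof -
    have "x - c \<noteq> 0" using that \<open>norm c < 1\<close> by auto
    obtain k where k: "T k = x - c" using bij_is_surj[OF bij] by (metis surjD)
    then have "k \<noteq> 0" using T0 \<open>x - c \<noteq> 0\<close> by metis
    \<comment> \<open>The differences of the barycentric coordinates from 1/3 sum to 0;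
      \<open>k4\<close> is the one belonging to \<open>l2\<close>.\<close>
    define k4 where "k4 = - k$1 - k$2"
    define mn where "mn = min (k$1) (min k4 (k$2))"
    \<comment> \<open>The point \<open>k / t\<close> has to satisfy the equation of the bipyramid,
      \<open>1 / 3 + mn / t = \<bar>k$3\<bar> / t\<close>; this is its solution.\<close>
    define t where "t = 3 * (\<bar>k$3\<bar> - mn)"
    have "mn \<le> 0" by (auto simp: mn_def k4_def min_def)
    moreover have "mn \<noteq> 0 \<or> k$3 \<noteq> 0"
    proof (rule ccontr)
      assume "\<not> ?thesis"
      then have "k$1 = 0" "k$2 = 0" "k$3 = 0" by (auto simp: mn_def k4_def min_def split: if_splits)
      then show False using \<open>k \<noteq> 0\<close> by (simp add: vec_eq_iff forall_3)
    qed
    ultimately have t: "t > 0" by (auto simp: t_def)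
    have mnt: "1 / 3 + mn / t = \<bar>k$3\<bar> / t"
    proof -
      have "t / 3 + mn = \<bar>k$3\<bar>" by (simp add: t_def field_simps)
      then have "(t / 3 + mn) / t = \<bar>k$3\<bar> / t" by simp
      then show ?thesis using t by (simp add: add_divide_distrib)
    qed
    have mn_le: "mn / t \<le> k$1 / t" "mn / t \<le> k4 / t" "mn / t \<le> k$2 / t"
      using t by (auto simp: mn_def divide_right_mono)
    have mn_cases: "mn = k$1 \<or> mn = k4 \<or> mn = k$2" by (auto simp: mn_def min_def)
    have "\<bar>k$3\<bar> / t \<ge> 0" using t by simp
    have "\<exists>z. l1 z = 1 / 3 + k$1 / t \<and> l3 z = 1 / 3 + k$2 / t \<and> height z = k$3 / t"
    proof (rule coords_surj[where b = "1 / 3 + k4 / t"])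
      show "0 \<le> 1 / 3 + k$1 / t" "0 \<le> 1 / 3 + k4 / t" "0 \<le> 1 / 3 + k$2 / t"
        using mn_le mnt \<open>\<bar>k$3\<bar> / t \<ge> 0\<close> by linarith+
      show "1 / 3 + k$1 / t + (1 / 3 + k4 / t) + (1 / 3 + k$2 / t) = 1"
        by (simp add: k4_def diff_divide_distrib)
      have "\<bar>k$3 / t\<bar> = 1 / 3 + mn / t" using mnt t by simp
      also have "\<dots> = min (1 / 3 + k$1 / t) (min (1 / 3 + k4 / t) (1 / 3 + k$2 / t))"
      proof -
        have "1 / 3 + m = min (1 / 3 + x) (min (1 / 3 + y) (1 / 3 + z))"
          if "m \<le> x" "m \<le> y" "m \<le> z" "m = x \<or> m = y \<or> m = z" for m x y z :: real
          using that by linarith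
        moreover have "mn / t = k$1 / t \<or> mn / t = k4 / t \<or> mn / t = k$2 / t" using mn_cases by blast
        ultimately show ?thesis using mn_le by blast
      qed
      finally show "\<bar>k$3 / t\<bar> = min (1 / 3 + k$1 / t) (min (1 / 3 + k4 / t) (1 / 3 + k$2 / t))" .
    qed
    then obtain z where "l1 z = 1 / 3 + k$1 / t" "l3 z = 1 / 3 + k$2 / t" "height z = k$3 / t" by blast
    then have "K z = (1 / t) *\<^sub>R k" by (simp add: vec_eq_iff forall_3 K)
    then have Vz: "V z = (1 / t) *\<^sub>R (x - c)" by (simp add: V_def T_scale k)
    then have tV: "t *\<^sub>R V z = x - c" using t by simp
    then have "norm (c + t *\<^sub>R V z) = 1" using that by simp
    then have "t = \<tau> (V z)" using \<tau>(4) t by blast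
    then have "p z = x" using tV by (simp add: p_def)
    then show ?thesis by blast
  qed
  then have ran: "range p = sphere 0 1" using p_norm by auto
  have third: "c = (1 / 3) *\<^sub>R y1 + (1 / 3) *\<^sub>R y2 + (1 / 3) *\<^sub>R y3"
    by (simp add: c_def scaleR_add_right)
  have comb: "c + (\<alpha> *\<^sub>R b1 + \<beta> *\<^sub>R b2) = (1 / 3 - \<alpha> - \<beta>) *\<^sub>R y1 + (1 / 3 + \<alpha>) *\<^sub>R y2 + (1 / 3 + \<beta>) *\<^sub>R y3" for \<alpha> \<beta>
    by (simp add: third b1_def b2_def scaleR_diff_right scaleR_diff_left scaleR_add_left)
  have VV: "V z = (l1 z - 1 / 3) *\<^sub>R b1 + (l3 z - 1 / 3) *\<^sub>R b2 + height z *\<^sub>R cross3 b1 b2" for z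
    by (simp add: V_def T_def K)
  have "c + V (1 / 2) = y1" "c + V ((1 + \<i>) / 2) = y2" "c + V 0 = y3"
    by (simp_all only: VV coords_special scaleR_zero_left add_0_right comb) simp_all
  then have "p (1 / 2) = y1" "p ((1 + \<i>) / 2) = y2" "p 0 = y3"
    using p_eq y by simp_all
  with cont ran rel show thesis by (rule that)
qed

end

section \<open>Local degrees and charts\<close>

text \<open>In the first chart a nonzero value close to 0 has \<open>k\<close> preimages close to
  \<open>x\<close>. The second chart sends them to distinct roots of order \<open>k'\<close> of one
  nonzero number, of which there are \<open>k'\<close>. By symmetry the inequality yields uniqueness
  of the local degree.\<close>

lemma has_local_degree_le:
  assumes "has_local_degree X Y f x k" "has_local_degree X Y f x k'"
  shows "k \<le> k'"
proof -
  obtain U V \<phi> \<psi> where k: "k \<ge> 1" and U: "openin X U" "x \<in> U" and V: "openin Y V" "f ` U \<subseteq> V"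
    and \<phi>: "homeomorphic_map (subtopology X U) (euclidean :: complex topology) \<phi>" "\<phi> x = 0"
    and \<psi>: "homeomorphic_map (subtopology Y V) (euclidean :: complex topology) \<psi>" "\<psi> (f x) = 0"
    and eq: "\<And>u. u \<in> U \<Longrightarrow> \<psi> (f u) = \<phi> u ^ k"
    using assms(1) unfolding has_local_degree_def by blast
  obtain U' V' \<phi>' \<psi>' where k': "k' \<ge> 1" and U': "openin X U'" "x \<in> U'" and V': "openin Y V'" "f ` U' \<subseteq> V'"
    and \<phi>': "homeomorphic_map (subtopology X U') (euclidean :: complex topology) \<phi>'" "\<phi>' x = 0"
    and \<psi>': "homeomorphic_map (subtopology Y V') (euclidean :: complex topology) \<psi>'" "\<psi>' (f x) = 0"
    and eq': "\<And>u. u \<in> U' \<Longrightarrow> \<psi>' (f u) = \<phi>' u ^ k'"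
    using assms(2) unfolding has_local_degree_def by blast
  have top: "topspace (subtopology X U) = U" "topspace (subtopology Y V) = V"
    "topspace (subtopology X U') = U'" "topspace (subtopology Y V') = V'"
    using openin_subset[OF U(1)] openin_subset[OF V(1)] openin_subset[OF U'(1)] openin_subset[OF V'(1)]
    by (simp_all add: Int_absorb1)
  have inj: "inj_on \<phi> U" "inj_on \<psi> V" "inj_on \<phi>' U'" "inj_on \<psi>' V'"
    using homeomorphic_imp_injective_map[OF \<phi>(1)] homeomorphic_imp_injective_map[OF \<psi>(1)]
      homeomorphic_imp_injective_map[OF \<phi>'(1)] homeomorphic_imp_injective_map[OF \<psi>'(1)]
    by (simp_all only: top)
  have "openin (subtopology X U) (U \<inter> U')"
    using U U' by (simp add: openin_open_subtopology openin_Int)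
  then have "open (\<phi> ` (U \<inter> U'))"
    using homeomorphic_map_openness[OF \<phi>(1), of "U \<inter> U'", unfolded top] by simp
  moreover have "0 \<in> \<phi> ` (U \<inter> U')" using U U' \<phi>(2) by (auto intro!: image_eqI[of _ _ x])
  ultimately obtain \<epsilon> where \<epsilon>: "\<epsilon> > 0" "ball 0 \<epsilon> \<subseteq> \<phi> ` (U \<inter> U')"
    using open_contains_ball by blast
  have fx: "f x \<in> V" "f x \<in> V'" using U V U' V' by auto
  define t where "t = \<epsilon> / 2"
  have t: "t > 0" "t < \<epsilon>" using \<epsilon> by (auto simp: t_def)
  \<comment> \<open>The fibre of the first power map through a point at distance \<open>t\<close>
    from 0; the choice \<open>t < \<epsilon>\<close> keeps it within both neighbourhoods.\<close>
  define \<omega> where "\<omega> = {w :: complex. w ^ k = of_real t ^ k}"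
  have "norm w = t" if "w \<in> \<omega>" for w
  proof -
    have "norm w ^ k = norm (of_real t :: complex) ^ k"
      using that unfolding \<omega>_def norm_power[symmetric] by simp
    then have "norm w ^ k = t ^ k" using t by simp
    then show ?thesis using power_eq_iff_eq_base[of k "norm w" t] t k by simp
  qed
  then have "\<omega> \<subseteq> \<phi> ` (U \<inter> U')" using \<epsilon> t by fastforce
  then have "\<forall>w\<in>\<omega>. \<exists>u. u \<in> U \<inter> U' \<and> \<phi> u = w" by blast
  from bchoice[OF this] obtain u where u: "\<And>w. w \<in> \<omega> \<Longrightarrow> u w \<in> U \<inter> U' \<and> \<phi> (u w) = w" by blast
  have t\<omega>: "of_real t \<in> \<omega>" by (simp add: \<omega>_def)
  define y where "y = f (u (of_real t))"
  have \<psi>y: "\<psi> (f (u w)) = of_real t ^ k" if "w \<in> \<omega>" for w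
    using u[OF that] that by (simp add: eq \<omega>_def)
  have fu: "f (u w) = y" if "w \<in> \<omega>" for w
  proof -
    have "f (u w) \<in> V" "y \<in> V" using u[OF that] u[OF t\<omega>] V(2) by (auto simp: y_def)
    moreover have "\<psi> (f (u w)) = \<psi> y" using \<psi>y[OF that] \<psi>y[OF t\<omega>] by (simp add: y_def)
    ultimately show ?thesis using inj by (auto dest: inj_onD)
  qed
  have yV: "y \<in> V'" using u[OF t\<omega>] V'(2) by (auto simp: y_def)
  have "y \<noteq> f x" using \<psi>y[OF t\<omega>] \<psi>(2) t k by (auto simp: y_def)
  then have \<psi>'y: "\<psi>' y \<noteq> 0" using inj fx yV \<psi>'(2) by (metis inj_onD)
  have "card ((\<lambda>w. \<phi>' (u w)) ` \<omega>) \<le> card {v. v ^ k' = \<psi>' y}"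
  proof (rule card_mono)
    show "finite {v. v ^ k' = \<psi>' y}" using k' by (intro finite_nth_roots) auto
    show "(\<lambda>w. \<phi>' (u w)) ` \<omega> \<subseteq> {v. v ^ k' = \<psi>' y}"
    proof clarify
      fix w assume w: "w \<in> \<omega>"
      then show "\<phi>' (u w) ^ k' = \<psi>' y" using u[OF w] fu[OF w] eq'[of "u w"] by simp
    qed
  qed
  moreover have "card {v. v ^ k' = \<psi>' y} = k'" using \<psi>'y k' by (intro card_nth_roots) auto
  moreover have "inj_on (\<lambda>w. \<phi>' (u w)) \<omega>"
  proof (rule inj_onI)
    fix w w' assume w: "w \<in> \<omega>" "w' \<in> \<omega>" "\<phi>' (u w) = \<phi>' (u w')"
    have "u w = u w'" by (rule inj_onD[OF inj(3) w(3)]) (use u w in auto)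
    moreover have "w = \<phi> (u w)" "\<phi> (u w') = w'" using u[OF w(1)] u[OF w(2)] by simp_all
    ultimately show "w = w'" by (simp only:)
  qed
  then have "card ((\<lambda>w. \<phi>' (u w)) ` \<omega>) = card \<omega>" by (rule card_image)
  moreover have "card \<omega> = k" unfolding \<omega>_def using t k by (intro card_nth_roots) auto
  ultimately show ?thesis by simp
qed

lemma local_degree_eq:
  assumes "has_local_degree X Y f x k"
  shows "local_degree X Y f x = k"
  unfolding local_degree_def
proof (rule the_equality)
  show "k' = k" if "has_local_degree X Y f x k'" for k'
    by (rule antisym[OF has_local_degree_le[OF that assms] has_local_degree_le[OF assms that]])
qed (fact assms)

lemma open_image_power:
  fixes W :: "complex set"
  assumes "n > 0" "open W"
  shows "open ((\<lambda>z. z ^ n) ` W)"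
proof (rule open_mapping_thm[of _ UNIV])
  show "\<not> (\<lambda>z :: complex. z ^ n) constant_on UNIV"
  proof
    assume "(\<lambda>z :: complex. z ^ n) constant_on UNIV"
    then obtain c where "z ^ n = c" for z :: complex by (auto simp: constant_on_def)
    then have "0 ^ n = (1 :: complex) ^ n" by metis
    then show False using assms(1) by (simp add: zero_power)
  qed
qed (use assms in \<open>auto intro!: holomorphic_intros\<close>)

section \<open>The quotient sphere and its charts\<close>

text \<open>The positions of the cone points are left open, because the converse direction
  prescribes them.\<close>

locale square_orbifold =
  fixes p :: "complex \<Rightarrow> real^3"
  assumes p_cont: "continuous_on UNIV p"
    and p_range: "range p = sphere 0 1"
    and p_eq: "p z = p w \<longleftrightarrow> gauss_rel z w"
begin

lemma p_in [simp]: "norm (p z) = 1"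
  using p_range by (metis mem_sphere_0 rangeI)

lemma p_surj: "y \<in> sphere 0 1 \<Longrightarrow> \<exists>z. y = p z"
  using p_range by blast

lemma p_add: "\<gamma> \<in> gauss_ints \<Longrightarrow> p (z + \<gamma>) = p z"
  using gauss_relI[of 1 \<gamma> z] p_eq[of z "z + \<gamma>"] by simp

lemma p_mult: "u ^ 4 = 1 \<Longrightarrow> p (u * z) = p z"
  using gauss_relI[of u 0 z] p_eq[of z "u * z"] by simp

lemma rot_ord_p: "p z = p w \<Longrightarrow> rot_ord z = rot_ord w"
  using rot_ord_gauss_rel p_eq by metis

lemma p_open:
  assumes "open W"
  shows "openin S2 (p ` W)"
proof -
  let ?K = "cbox 0 (Complex 1 1)"
  define C where "C = - (\<Union>u\<in>{u. u ^ 4 = 1}. \<Union>\<gamma>\<in>gauss_ints. (\<lambda>z. u * z + \<gamma>) -` W)"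
  have C: "z \<in> C \<longleftrightarrow> p z \<notin> p ` W" for z
    by (auto simp: C_def p_eq gauss_rel_def image_iff)
  have "closed C"
    unfolding C_def using assms
    by (intro closed_Compl open_UN ballI open_vimage continuous_intros) auto
  then have "compact (p ` (C \<inter> ?K))"
    using p_cont by (intro compact_continuous_image) (auto intro: continuous_on_subset closed_Int_compact)
  moreover have "sphere 0 1 - p ` W = p ` (C \<inter> ?K)"
  proof (intro equalityI subsetI)
    fix y assume y: "y \<in> sphere 0 1 - p ` W"
    then obtain z where z: "y = p z" using p_surj by blast
    define \<gamma> where "\<gamma> = Complex (of_int \<lfloor>Re z\<rfloor>) (of_int \<lfloor>Im z\<rfloor>)"
    have "\<gamma> \<in> gauss_ints" by (simp add: \<gamma>_def gauss_ints_def)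
    then have "p (z + - \<gamma>) = y" using p_add[of "- \<gamma>" z] z by simp
    moreover have "z + - \<gamma> \<in> ?K"
      by (auto simp: \<gamma>_def in_cbox_complex_iff) linarith+
    ultimately show "y \<in> p ` (C \<inter> ?K)" using y C by (intro image_eqI[of _ _ "z + - \<gamma>"]) auto
  qed (use C in auto)
  ultimately have "closedin S2 (sphere 0 1 - p ` W)"
    by (auto intro!: closed_subset compact_imp_closed)
  moreover have "p ` W \<subseteq> sphere 0 1" by auto
  ultimately show ?thesis by (simp add: openin_closedin_eq)
qed

lemma p_local:
  obtains r where "r > 0"
    "\<And>h h'. norm h < r \<Longrightarrow> norm h' < r \<Longrightarrow> p (z + h) = p (z + h') \<longleftrightarrow> h ^ rot_ord z = h' ^ rot_ord z"
proof -
  obtain r where "r > 0" "\<forall>h h'. norm h < r \<longrightarrow> norm h' < r \<longrightarrow>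
      (gauss_rel (z + h) (z + h') \<longleftrightarrow> h ^ rot_ord z = h' ^ rot_ord z)"
    using gauss_rel_local by blast
  then show thesis by (intro that[of r]) (simp_all only: p_eq)
qed

text \<open>The chart is the power \<open>h \<mapsto> h ^ rot_ord z\<close> in the coordinate \<open>h / (r - norm h)\<close>, which
  identifies the disc of radius \<open>r\<close> with the plane.\<close>

lemma p_chart:
  fixes z c :: complex and r :: real
  assumes c: "c \<noteq> 0" and r: "r > 0" and e: "e > 0"
    and loc: "\<And>h h'. norm h < r \<Longrightarrow> norm h' < r \<Longrightarrow> p (z + c * h) = p (z + c * h') \<longleftrightarrow> h ^ e = h' ^ e"
  obtains \<phi> where
    "openin S2 (p ` (\<lambda>h. z + c * h) ` ball 0 r)"
    "homeomorphic_map (subtopology S2 (p ` (\<lambda>h. z + c * h) ` ball 0 r)) (euclidean :: complex topology) \<phi>"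
    "\<And>h. norm h < r \<Longrightarrow> \<phi> (p (z + c * h)) = (h / of_real (r - norm h)) ^ e"
proof -
  define q where "q = (\<lambda>h. p (z + c * h))"
  have q_norm: "norm (q h) = 1" for h by (simp add: q_def)
  define U where "U = p ` (\<lambda>h. z + c * h) ` ball 0 r"
  have U: "U = q ` ball 0 r" by (simp add: U_def q_def image_image)
  have q_open: "openin S2 (q ` W)" if "open W" for W
  proof -
    have "(\<lambda>h. z + c * h) ` W = (\<lambda>w. (w - z) / c) -` W"
    proof (intro equalityI subsetI)
      fix w assume "w \<in> (\<lambda>w. (w - z) / c) -` W"
      then show "w \<in> (\<lambda>h. z + c * h) ` W" using c by (intro image_eqI[of _ _ "(w - z) / c"]) auto
    qed (use c in auto)
    moreover have "open ((\<lambda>w. (w - z) / c) -` W)"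
      using c that by (intro open_vimage continuous_intros) auto
    ultimately have "openin S2 (p ` (\<lambda>h. z + c * h) ` W)" by (metis p_open)
    then show ?thesis by (simp add: q_def image_image)
  qed
  have Uo: "openin S2 U" unfolding U by (rule q_open) simp
  define \<tau> where "\<tau> = (\<lambda>h :: complex. h / of_real (r - norm h))"
  define \<sigma> where "\<sigma> = (\<lambda>k :: complex. of_real r * k / of_real (1 + norm k))"
  have \<sigma>_ball: "norm (\<sigma> k) < r" for k
  proof -
    have "norm (\<sigma> k) = r * (norm k / (1 + norm k))"
      using r by (simp add: \<sigma>_def norm_mult norm_divide abs_of_nonneg del: of_real_add)
    also have "\<dots> < r * 1" using r by (intro mult_strict_left_mono) (auto simp: add_pos_nonneg)
    finally show ?thesis by simp
  qed
  have \<sigma>\<tau>: "\<sigma> (\<tau> h) = h" if "norm h < r" for h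
  proof -
    have n: "norm (\<tau> h) = norm h / (r - norm h)"
      using that by (simp add: \<tau>_def norm_divide del: of_real_diff)
    have "1 + norm (\<tau> h) = r / (r - norm h)" unfolding n using that by (simp add: field_simps)
    then show ?thesis unfolding \<sigma>_def using that r by (simp add: \<tau>_def del: of_real_diff)
  qed
  have \<tau>\<sigma>: "\<tau> (\<sigma> k) = k" for k
  proof -
    have n: "norm (\<sigma> k) = r * norm k / (1 + norm k)"
      using r by (simp add: \<sigma>_def norm_mult norm_divide abs_of_nonneg del: of_real_add)
    have k: "1 + norm k > 0" by (simp add: add_pos_nonneg)
    have "r - norm (\<sigma> k) = r / (1 + norm k)" unfolding n using k by (simp add: field_simps)
    then show ?thesis unfolding \<tau>_def using k r by (simp add: \<sigma>_def del: of_real_add)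
  qed
  have \<sigma>_cont: "continuous_on UNIV \<sigma>"
    unfolding \<sigma>_def
    by (intro continuous_intros) (metis norm_ge_zero not_one_le_zero add.commute le_add_same_cancel1 of_real_eq_0_iff)
  have \<tau>_cont: "continuous_on (ball 0 r) \<tau>"
    unfolding \<tau>_def by (intro continuous_intros) auto
  have \<sigma>_open: "open (\<sigma> ` W)" if "open W" for W
  proof -
    have "\<sigma> ` W = ball 0 r \<inter> \<tau> -` W"
    proof (intro equalityI subsetI)
      fix h assume h: "h \<in> ball 0 r \<inter> \<tau> -` W"
      then have "h = \<sigma> (\<tau> h)" using \<sigma>\<tau> by simp
      then show "h \<in> \<sigma> ` W" using h by blast
    qed (use \<sigma>_ball \<tau>\<sigma> in auto)
    also have "open \<dots>" using continuous_open_preimage[OF \<tau>_cont _ that] by simp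
    finally show ?thesis .
  qed
  \<comment> \<open>The choice is immaterial: points of the disc with the same image have equal
    powers of exponent \<open>e\<close>, hence equal norms, so \<open>\<tau>\<close> rescales them
    by the same factor.\<close>
  define \<phi> where "\<phi> = (\<lambda>y. \<tau> (SOME h. norm h < r \<and> q h = y) ^ e)"
  have norm_inj: "norm h = norm h'" if "norm h < r" "norm h' < r" "norm (\<tau> h) = norm (\<tau> h')" for h h'
  proof -
    have "norm h / (r - norm h) = norm h' / (r - norm h')"
      using that by (simp add: \<tau>_def norm_divide del: of_real_diff)
    then show ?thesis using that r by (simp add: field_simps)
  qed
  have \<tau>_pow: "\<tau> h ^ e = \<tau> h' ^ e \<longleftrightarrow> h ^ e = h' ^ e" if "norm h < r" "norm h' < r" for h h'
  proof -
    have nr: "norm a = norm b" if "a ^ e = b ^ e" for a b :: complex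
      using that e by (metis norm_power power_eq_iff_eq_base norm_ge_zero)
    show ?thesis
    proof (cases "norm h = norm h'")
      case True
      then show ?thesis using that by (simp add: \<tau>_def power_divide del: of_real_diff)
    next
      case False
      then show ?thesis using norm_inj[OF that] nr by metis
    qed
  qed
  have \<phi>q: "\<phi> (q h) = \<tau> h ^ e" if "norm h < r" for h
  proof -
    let ?h = "SOME h'. norm h' < r \<and> q h' = q h"
    have "norm ?h < r \<and> q ?h = q h" using that by (intro someI_ex[of "\<lambda>h'. norm h' < r \<and> q h' = q h"]) auto
    then have "\<tau> ?h ^ e = \<tau> h ^ e" using loc[of ?h h] \<tau>_pow[of ?h h] that by (simp add: q_def)
    then show ?thesis by (simp add: \<phi>_def)
  qed
  have \<phi>\<sigma>: "\<phi> (q (\<sigma> k)) = k ^ e" for k using \<phi>q[OF \<sigma>_ball] \<tau>\<sigma> by simp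
  have U\<sigma>: "U = range (\<lambda>k. q (\<sigma> k))"
  proof (intro equalityI subsetI)
    fix y assume "y \<in> U"
    then obtain h where "norm h < r" "y = q h" by (auto simp: U)
    then show "y \<in> range (\<lambda>k. q (\<sigma> k))" using \<sigma>\<tau> by (intro image_eqI[of _ _ "\<tau> h"]) auto
  next
    fix y assume "y \<in> range (\<lambda>k. q (\<sigma> k))"
    then show "y \<in> U" using \<sigma>_ball by (auto simp: U)
  qed
  have q\<sigma>_open: "openin S2 ((\<lambda>k. q (\<sigma> k)) ` W)" if "open W" for W
    using q_open[OF \<sigma>_open[OF that]] by (simp add: image_image)
  have q_cont: "continuous_on UNIV (\<lambda>k. q (\<sigma> k))"
  proof -
    have "continuous_on UNIV q"
      unfolding q_def by (rule continuous_on_compose2[OF p_cont]) (auto intro!: continuous_intros)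
    then show ?thesis by (rule continuous_on_compose2[OF _ \<sigma>_cont]) auto
  qed
  have sub: "subtopology S2 U = top_of_set U"
    using Uo openin_imp_subset by (metis inf.absorb_iff2 subtopology_subtopology)
  have "homeomorphic_map (subtopology S2 U) euclidean \<phi>"
  proof (rule bijective_open_imp_homeomorphic_map)
    show "\<phi> ` topspace (subtopology S2 U) = topspace euclidean"
    proof -
      have root: "\<exists>k. k ^ e = w" for w :: complex
      proof (cases "w = 0")
        case True
        then show ?thesis using e by (intro exI[of _ 0]) (simp add: zero_power)
      next
        case False
        then have c: "card {k. k ^ e = w} > 0" using card_nth_roots[of w e] e by simp
        show ?thesis
        proof (rule ccontr)
          assume "\<not> (\<exists>k. k ^ e = w)"
          then have "{k. k ^ e = w} = {}" by simp
          with c show False by simp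
        qed
      qed
      have "range (\<lambda>k :: complex. k ^ e) = UNIV"
      proof (intro equalityI subsetI)
        fix w :: complex
        from root[of w] obtain k where k: "k ^ e = w" ..
        have "k ^ e \<in> range (\<lambda>k. k ^ e)" by (rule rangeI)
        then show "w \<in> range (\<lambda>k. k ^ e)" by (simp only: k)
      qed simp
      then have "\<phi> ` U = UNIV" unfolding U\<sigma> image_image \<phi>\<sigma> .
      then show ?thesis by (simp add: sub)
    qed
    show "inj_on \<phi> (topspace (subtopology S2 U))"
    proof -
      have "inj_on \<phi> U"
      proof (rule inj_onI)
        fix y y' assume "y \<in> U" "y' \<in> U" and eq: "\<phi> y = \<phi> y'"
        then obtain h h' where h: "norm h < r" "y = q h" "norm h' < r" "y' = q h'" by (auto simp: U)
        then have "\<tau> h ^ e = \<tau> h' ^ e" using eq \<phi>q by simp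
        then show "y = y'" using \<tau>_pow loc h by (simp add: q_def)
      qed
      then show ?thesis by (simp add: sub)
    qed
    show "continuous_map (subtopology S2 U) euclidean \<phi>"
      unfolding continuous_map
    proof (intro conjI allI impI)
      fix W :: "complex set" assume "openin euclidean W"
      then have "open ((\<lambda>k. k ^ e) -` W)" by (intro open_vimage) (auto intro!: continuous_intros)
      then have "openin S2 ((\<lambda>k. q (\<sigma> k)) ` ((\<lambda>k. k ^ e) -` W))" by (rule q\<sigma>_open)
      moreover have "{y \<in> topspace (subtopology S2 U). \<phi> y \<in> W} = (\<lambda>k. q (\<sigma> k)) ` ((\<lambda>k. k ^ e) -` W)"
        using \<phi>\<sigma> by (auto simp: U\<sigma> q_norm)
      ultimately show "openin (subtopology S2 U) {y \<in> topspace (subtopology S2 U). \<phi> y \<in> W}"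
        unfolding openin_open_subtopology[OF Uo] by auto
    qed simp
    show "open_map (subtopology S2 U) euclidean \<phi>"
      unfolding open_map_def
    proof (intro allI impI)
      fix W assume "openin (subtopology S2 U) W"
      then obtain G where G: "open G" "W = U \<inter> G" unfolding sub openin_open by blast
      have "\<phi> ` W = (\<lambda>k. k ^ e) ` ((\<lambda>k. q (\<sigma> k)) -` G)"
      proof -
        have "W = (\<lambda>k. q (\<sigma> k)) ` ((\<lambda>k. q (\<sigma> k)) -` G)" unfolding G U\<sigma> by auto
        then have "\<phi> ` W = (\<lambda>k. \<phi> (q (\<sigma> k))) ` ((\<lambda>k. q (\<sigma> k)) -` G)" by (metis image_image)
        then show ?thesis unfolding \<phi>\<sigma> .
      qed
      moreover have "open ((\<lambda>k. q (\<sigma> k)) -` G)" using G q_cont by (intro open_vimage) auto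
      ultimately show "openin euclidean (\<phi> ` W)" using open_image_power e by simp
    qed
  qed
  with Uo \<phi>q show thesis
    by (intro that[of \<phi>]) (auto simp: U_def q_def \<tau>_def)
qed

text \<open>With a common parameter \<open>h\<close>, the charts at \<open>p z\<close> and at its
  image are powers of one coordinate with exponents \<open>rot_ord z\<close> and
  \<open>rot_ord (\<mu> * z)\<close>; in them \<open>f\<close> is the power map whose exponent is
  the quotient \<open>k\<close>.\<close>

lemma p_local_degree:
  assumes f: "\<And>z. f (p z) = p (\<mu> * z)" and \<mu>: "\<mu> \<noteq> 0" and k: "rot_ord (\<mu> * z) = rot_ord z * k"
  shows "has_local_degree S2 S2 f (p z) k"
proof -
  obtain r1 where r1: "r1 > 0" "\<And>h h'. norm h < r1 \<Longrightarrow> norm h' < r1 \<Longrightarrow>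
      p (z + h) = p (z + h') \<longleftrightarrow> h ^ rot_ord z = h' ^ rot_ord z"
    using p_local[of z] by blast
  obtain r2 where r2: "r2 > 0" "\<And>h h'. norm h < r2 \<Longrightarrow> norm h' < r2 \<Longrightarrow>
      p (\<mu> * z + h) = p (\<mu> * z + h') \<longleftrightarrow> h ^ rot_ord (\<mu> * z) = h' ^ rot_ord (\<mu> * z)"
    using p_local[of "\<mu> * z"] by blast
  define r where "r = min r1 (r2 / norm \<mu>)"
  have r: "r > 0" "r \<le> r1" using r1 r2 \<mu> by (auto simp: r_def)
  have r': "norm (\<mu> * h) < r2" if "norm h < r" for h
  proof -
    have "norm h < r2 / norm \<mu>" using that by (simp add: r_def)
    then show ?thesis using \<mu> by (simp add: norm_mult field_simps)
  qed
  obtain \<phi> where \<phi>: "openin S2 (p ` (\<lambda>h. z + 1 * h) ` ball 0 r)"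
    "homeomorphic_map (subtopology S2 (p ` (\<lambda>h. z + 1 * h) ` ball 0 r)) (euclidean :: complex topology) \<phi>"
    "\<And>h. norm h < r \<Longrightarrow> \<phi> (p (z + 1 * h)) = (h / of_real (r - norm h)) ^ rot_ord z"
    by (rule p_chart[of 1 r "rot_ord z" z]) (use r r1 in auto)
  \<comment> \<open>The scaling \<open>c = \<mu>\<close> absorbs the multiplication, so that both
    charts are written in the same \<open>h\<close>.\<close>
  obtain \<psi> where \<psi>: "openin S2 (p ` (\<lambda>h. \<mu> * z + \<mu> * h) ` ball 0 r)"
    "homeomorphic_map (subtopology S2 (p ` (\<lambda>h. \<mu> * z + \<mu> * h) ` ball 0 r)) (euclidean :: complex topology) \<psi>"
    "\<And>h. norm h < r \<Longrightarrow> \<psi> (p (\<mu> * z + \<mu> * h)) = (h / of_real (r - norm h)) ^ rot_ord (\<mu> * z)"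
    by (rule p_chart[of \<mu> r "rot_ord (\<mu> * z)" "\<mu> * z"])
       (use r r' r2 \<mu> in \<open>auto simp: power_mult_distrib\<close>)
  show ?thesis
    unfolding has_local_degree_def
  proof (intro conjI exI ballI)
    show "1 \<le> k" using k rot_ord_pos[of "\<mu> * z"] by (cases k) auto
    show "p z \<in> p ` (\<lambda>h. z + 1 * h) ` ball 0 r" using r by (intro imageI image_eqI[of _ _ 0]) auto
    show "f ` p ` (\<lambda>h. z + 1 * h) ` ball 0 r \<subseteq> p ` (\<lambda>h. \<mu> * z + \<mu> * h) ` ball 0 r"
    proof
      fix y assume "y \<in> f ` p ` (\<lambda>h. z + 1 * h) ` ball 0 r"
      then obtain h where h: "h \<in> ball 0 r" "y = f (p (z + 1 * h))" by blast
      then have "y = p (\<mu> * z + \<mu> * h)" by (simp add: f distrib_left)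
      then show "y \<in> p ` (\<lambda>h. \<mu> * z + \<mu> * h) ` ball 0 r" using h(1) by blast
    qed
    show "\<phi> (p z) = 0" using \<phi>(3)[of 0] r by simp
    show "\<psi> (f (p z)) = 0" using \<psi>(3)[of 0] r by (simp add: f)
    show "\<psi> (f y) = \<phi> y ^ k" if y: "y \<in> p ` (\<lambda>h. z + 1 * h) ` ball 0 r" for y
    proof -
      obtain h where "h \<in> ball 0 r" and h2: "y = p (z + 1 * h)" using y by blast
      then have h: "norm h < r" by simp
      show ?thesis using \<phi>(3)[OF h] \<psi>(3)[OF h] by (simp add: h2 f distrib_left k power_mult)
    qed
  qed (use \<phi> \<psi> in auto)
qed

end

section \<open>Realization by multiplication\<close>

lemma image_mset_special:
  assumes "finite F" "a \<in> F" "g a = (1 :: nat)" "\<And>y. y \<in> F \<Longrightarrow> y \<noteq> a \<Longrightarrow> g y = e" "card F = Suc m"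
  shows "image_mset g (mset_set F) = replicate_mset m e + {#1#}"
proof -
  have "mset_set F = add_mset a (mset_set (F - {a}))"
    using assms(1,2) by (metis Diff_iff finite_Diff insertI1 insert_Diff mset_set.insert)
  moreover have "image_mset g (mset_set (F - {a})) = image_mset (\<lambda>_. e) (mset_set (F - {a}))"
    using assms by (intro image_mset_cong) auto
  ultimately show ?thesis using assms by (simp add: image_mset_const_eq)
qed

context square_orbifold
begin

text \<open>A point over \<open>p w\<close> solves \<open>\<mu> * z = u * w + l\<close>; rotating
  \<open>z\<close> by \<open>u ^ 3\<close>, which does not change \<open>p z\<close>, removes the
  unit \<open>u\<close>.\<close>

lemma fibre_p:
  assumes f: "\<And>z. f (p z) = p (\<mu> * z)" and \<mu>: "\<mu> \<noteq> 0"
  shows "y \<in> fibre S2 f (p w) \<longleftrightarrow> (\<exists>l\<in>gauss_ints. y = p ((w + l) / \<mu>))"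
proof
  assume "y \<in> fibre S2 f (p w)"
  then have y: "y \<in> sphere 0 1" "f y = p w" by (auto simp: fibre_def)
  from p_surj[OF y(1)] obtain z where "y = p z" ..
  then have z: "y = p z" "p w = p (\<mu> * z)" using y(2) f by simp_all
  then obtain u l where u: "u ^ 4 = 1" "l \<in> gauss_ints" "\<mu> * z = u * w + l"
    by (auto simp: p_eq gauss_rel_def)
  have u3: "(u ^ 3) ^ 4 = 1" using u(1) by (metis mult.commute power_mult power_one)
  have "(w + u ^ 3 * l) / \<mu> = u ^ 3 * z"
  proof -
    have "u ^ 3 * (\<mu> * z) = u ^ 4 * w + u ^ 3 * l"
      unfolding u(3) by (simp add: algebra_simps power3_eq_cube power4_eq_xxxx)
    then show ?thesis using \<mu> u(1) by (simp add: field_simps)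
  qed
  then have "y = p ((w + u ^ 3 * l) / \<mu>)" using p_mult[OF u3] z by simp
  moreover have "u ^ 3 * l \<in> gauss_ints" using u by blast
  ultimately show "\<exists>l\<in>gauss_ints. y = p ((w + l) / \<mu>)" by blast
next
  assume "\<exists>l\<in>gauss_ints. y = p ((w + l) / \<mu>)"
  then obtain l where g: "l \<in> gauss_ints" "y = p ((w + l) / \<mu>)" by blast
  then have "f y = p (w + l)" using f \<mu> by simp
  then show "y \<in> fibre S2 f (p w)" using g p_add by (simp add: fibre_def)
qed

text \<open>An odd norm makes multiplication by \<open>\<mu>\<close> fix each cone point. The orders
  of the multiples of the centre and of the midpoint follow from \<open>half\<close>: a number of
  squared norm \<open>d / 2\<close> cannot be a Gaussian integer when \<open>d\<close> is odd. This
  keeps the two points of order 4 apart and prevents the midpoint from reaching order 4.\<close>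

lemma rot_ord_mult_eq:
  assumes \<mu>: "\<mu> \<in> gauss_ints" and d: "(norm \<mu>)\<^sup>2 = real d" "odd d" and z: "rot_ord z \<noteq> 1"
  shows "p (\<mu> * z) = p z"
proof -
  have half: "\<mu> * w \<notin> gauss_ints" if "(norm w)\<^sup>2 = 1 / 2" for w
  proof
    assume "\<mu> * w \<in> gauss_ints"
    then obtain n :: nat where n: "(norm (\<mu> * w))\<^sup>2 = real n" using norm_gauss_ints_sq by blast
    have "(norm (\<mu> * w))\<^sup>2 = real d / 2" using d that by (simp add: norm_mult power_mult_distrib)
    then have "real d = real (2 * n)" using n by simp
    then have "d = 2 * n" by (simp only: of_nat_eq_iff)
    then show False using d by simp
  qed
  have sub: "gauss_rel w z \<Longrightarrow> p (\<mu> * w) = p w \<Longrightarrow> p (\<mu> * z) = p z" for w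
  proof -
    assume a: "gauss_rel w z" "p (\<mu> * w) = p w"
    obtain u l where u: "u ^ 4 = 1" "l \<in> gauss_ints" "z = u * w + l"
      using a by (auto simp: gauss_rel_def)
    have "\<mu> * z = u * (\<mu> * w) + \<mu> * l" by (simp add: u algebra_simps)
    then have "gauss_rel (\<mu> * w) (\<mu> * z)" using gauss_relI[OF u(1), of "\<mu> * l"] u \<mu> by simp
    then show ?thesis using a p_eq by metis
  qed
  have c: "p (\<mu> * ((1 + \<i>) / 2)) = p ((1 + \<i>) / 2)"
  proof -
    let ?c = "(1 + \<i>) / 2"
    have "(1 - \<i>) * ?c = 1" by (simp add: complex_eq_iff)
    then have "(1 - \<i>) * (\<mu> * ?c) = \<mu>" by (metis mult.left_commute mult.right_neutral)
    then have "(1 - \<i>) * (\<mu> * ?c) \<in> gauss_ints" using \<mu> by (simp only:)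
    then have "rot_ord (\<mu> * ?c) = 4" unfolding rot_ord_def by (rule if_P)
    then have "gauss_rel 0 (\<mu> * ?c) \<or> gauss_rel ?c (\<mu> * ?c)" by (rule rot_ord_4)
    moreover have "\<not> gauss_rel 0 (\<mu> * ?c)"
      using half[of ?c] by (auto simp: gauss_rel_def cmod_power2 power_divide)
    ultimately show ?thesis using p_eq by metis
  qed
  have h: "p (\<mu> * (1 / 2)) = p (1 / 2)"
  proof -
    have "2 * (\<mu> * (1 / 2)) = \<mu>" by simp
    then have 2: "2 * (\<mu> * (1 / 2)) \<in> gauss_ints" using \<mu> by (simp only:)
    have 4: "(1 - \<i>) * (\<mu> * (1 / 2)) \<notin> gauss_ints"
    proof -
      have "\<mu> * ((1 - \<i>) / 2) \<notin> gauss_ints" by (rule half) (simp add: cmod_power2 power_divide)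
      moreover have "(1 - \<i>) * (\<mu> * (1 / 2)) = \<mu> * ((1 - \<i>) / 2)" by simp
      ultimately show ?thesis by (simp only: not_False_eq_True)
    qed
    have "rot_ord (\<mu> * (1 / 2)) = 2" unfolding rot_ord_def if_not_P[OF 4] if_P[OF 2] ..
    then show ?thesis using rot_ord_2 p_eq by metis
  qed
  have "rot_ord z = 2 \<or> rot_ord z = 4" using z rot_ord_cases[of z] by blast
  then show ?thesis
  proof
    assume "rot_ord z = 2"
    then show ?thesis using rot_ord_2 sub h by blast
  next
    assume "rot_ord z = 4"
    then have "gauss_rel 0 z \<or> gauss_rel ((1 + \<i>) / 2) z" by (rule rot_ord_4)
    moreover have "p (\<mu> * 0) = p 0" by simp
    ultimately show ?thesis using sub c by blast
  qed
qed

text \<open>The points over \<open>p w\<close> are parametrised by the residues modulo \<open>\<mu>\<close>; the rotations fixing \<open>w\<close>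
  permute these, freely except at the residue of a point with \<open>rot_ord z = rot_ord w\<close>.\<close>

lemma card_residues_over:
  assumes \<mu>: "\<mu> \<in> gauss_ints" "\<mu> \<noteq> 0"
    and D: "D \<subseteq> gauss_ints" "\<And>l. l \<in> gauss_ints \<Longrightarrow> \<exists>r\<in>D. \<exists>q\<in>gauss_ints. l = r + \<mu> * q"
    "\<And>r r' q. r \<in> D \<Longrightarrow> r' \<in> D \<Longrightarrow> q \<in> gauss_ints \<Longrightarrow> r = r' + \<mu> * q \<Longrightarrow> r = r'"
    and r0: "r0 \<in> D" and z: "z = (w + r0) / \<mu>"
  defines "S \<equiv> {r \<in> D. p ((w + r) / \<mu>) = p z}"
  shows "rot_ord z = 1 \<Longrightarrow> card S = rot_ord w" "rot_ord z = rot_ord w \<Longrightarrow> card S = 1"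
proof -
  have \<mu>z: "\<mu> * z = w + r0" using \<mu> by (simp add: z)
  have S: "r \<in> S \<longleftrightarrow> r \<in> D \<and> (\<exists>u. u ^ rot_ord w = 1 \<and> (\<exists>q\<in>gauss_ints. (w + r) / \<mu> = u * z + q))" for r
  proof
    assume "r \<in> S"
    then have r: "r \<in> D" and "p z = p ((w + r) / \<mu>)" by (auto simp: S_def)
    then obtain u q where u: "u ^ 4 = 1" "q \<in> gauss_ints" "(w + r) / \<mu> = u * z + q"
      by (auto simp: p_eq gauss_rel_def)
    have "w + r = \<mu> * (u * z + q)" unfolding u(3)[symmetric] using \<mu> by simp
    also have "\<dots> = u * (\<mu> * z) + \<mu> * q" by (simp add: algebra_simps)
    finally have "w + r = u * (w + r0) + \<mu> * q" unfolding \<mu>z .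
    then have "u * w - w = r - u * r0 - \<mu> * q" by (simp add: algebra_simps)
    also have "\<dots> \<in> gauss_ints"
      using r r0 u D(1) \<mu> by (intro gauss_ints_intros) auto
    finally have "u ^ rot_ord w = 1" using unit_rot_ord_iff[OF u(1)] by blast
    then show "r \<in> D \<and> (\<exists>u. u ^ rot_ord w = 1 \<and> (\<exists>q\<in>gauss_ints. (w + r) / \<mu> = u * z + q))"
      using r u by blast
  next
    assume "r \<in> D \<and> (\<exists>u. u ^ rot_ord w = 1 \<and> (\<exists>q\<in>gauss_ints. (w + r) / \<mu> = u * z + q))"
    then obtain u q where u: "r \<in> D" "u ^ rot_ord w = 1" "q \<in> gauss_ints" "(w + r) / \<mu> = u * z + q"
      by blast
    have "u ^ 4 = 1" by (rule unit_of_rot_ord[OF u(2)])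
    then have "p ((w + r) / \<mu>) = p z" using u p_add p_mult by simp
    then show "r \<in> S" using u by (simp add: S_def)
  qed
  have ex: "\<exists>r. r \<in> D \<and> (\<exists>q\<in>gauss_ints. (w + r) / \<mu> = u * z + q)" if u: "u ^ rot_ord w = 1" for u
  proof -
    have u4: "u ^ 4 = 1" by (rule unit_of_rot_ord[OF u])
    then have "u * w - w \<in> gauss_ints" using unit_rot_ord_iff u by blast
    then have "(u * w - w) + u * r0 \<in> gauss_ints" using u4 r0 D(1) by blast
    then obtain r q where r: "r \<in> D" "q \<in> gauss_ints" "(u * w - w) + u * r0 = r + \<mu> * q"
      using D(2) by blast
    have "u * (\<mu> * z) = w + ((u * w - w) + u * r0)" unfolding \<mu>z by (simp add: algebra_simps)
    then have "w + r = \<mu> * (u * z + - q)" unfolding r(3) by (simp add: algebra_simps)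
    then have "(w + r) / \<mu> = u * z + - q" using \<mu> by simp
    then show ?thesis using r by blast
  qed
  have uniq: "r = r'" if "r \<in> D" "r' \<in> D" "q \<in> gauss_ints" "(w + r) / \<mu> = (w + r') / \<mu> + q" for r r' q
  proof -
    have "w + r = \<mu> * ((w + r') / \<mu> + q)" unfolding that(4)[symmetric] using \<mu> by simp
    also have "\<dots> = (w + r') + \<mu> * q" using \<mu> by (subst distrib_left) simp
    finally have "r = r' + \<mu> * q" by (simp add: add.assoc)
    then show ?thesis using D(3) that by blast
  qed
  {
    assume 1: "rot_ord z = 1"
    have "\<forall>u\<in>{u. u ^ rot_ord w = 1}. \<exists>r. r \<in> D \<and> (\<exists>q\<in>gauss_ints. (w + r) / \<mu> = u * z + q)"
      using ex by simp
    from bchoice[OF this] obtain \<Delta> where \<Delta>: "\<And>u. u ^ rot_ord w = 1 \<Longrightarrow> \<Delta> u \<in> D"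
      "\<And>u. u ^ rot_ord w = 1 \<Longrightarrow> \<exists>q\<in>gauss_ints. (w + \<Delta> u) / \<mu> = u * z + q" by auto
    have "bij_betw \<Delta> {u. u ^ rot_ord w = 1} S"
    proof (rule bij_betw_imageI)
      show "inj_on \<Delta> {u. u ^ rot_ord w = 1}"
      proof (rule inj_onI)
        fix u v assume "u \<in> {u. u ^ rot_ord w = 1}" "v \<in> {u. u ^ rot_ord w = 1}" and eq: "\<Delta> u = \<Delta> v"
        then have uv: "u ^ rot_ord w = 1" "v ^ rot_ord w = 1" by auto
        obtain q q' where k: "q \<in> gauss_ints" "q' \<in> gauss_ints" "u * z + q = v * z + q'"
          using \<Delta>(2)[OF uv(1)] \<Delta>(2)[OF uv(2)] eq by auto
        have uv4: "u ^ 4 = 1" "v ^ 4 = 1"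
          using uv unit_of_rot_ord by blast+
        \<comment> \<open>This is the quotient of \<open>u\<close> by \<open>v\<close>. It comes
          from the stabiliser of \<open>z\<close>, which is trivial here.\<close>
        define t where "t = v ^ 3 * u"
        have "t ^ 4 = (v ^ 4) ^ 3 * u ^ 4"
          by (simp add: t_def power_mult_distrib flip: power_mult)
        then have t4: "t ^ 4 = 1" using uv4 by simp
        have "v ^ 3 * (u * z - v * z) = t * z - v ^ 4 * z"
          by (simp add: t_def algebra_simps power3_eq_cube power4_eq_xxxx)
        moreover have "u * z - v * z = q' - q" using k(3) by (simp add: algebra_simps)
        moreover have "v ^ 3 * (q' - q) \<in> gauss_ints" using k uv4 by blast
        ultimately have "t * z - z \<in> gauss_ints" using uv4 by simp
        then have "t = 1" using unit_rot_ord_iff[OF t4] 1 by simp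
        then have "v * t = v" by simp
        moreover have "v * t = v ^ 4 * u" by (simp add: t_def power3_eq_cube power4_eq_xxxx)
        ultimately show "u = v" using uv4 by simp
      qed
      show "\<Delta> ` {u. u ^ rot_ord w = 1} = S"
      proof (intro equalityI subsetI)
        fix r assume "r \<in> S"
        then obtain u q where u: "r \<in> D" "u ^ rot_ord w = 1" "q \<in> gauss_ints" "(w + r) / \<mu> = u * z + q"
          unfolding S by blast
        obtain q' where k': "q' \<in> gauss_ints" "(w + \<Delta> u) / \<mu> = u * z + q'" using \<Delta>(2)[OF u(2)] by blast
        then have "(w + r) / \<mu> = (w + \<Delta> u) / \<mu> + (q - q')" using u by simp
        then have "r = \<Delta> u" using uniq u(1,3) \<Delta>(1)[OF u(2)] k' by (meson gauss_ints_intros(7))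
        then show "r \<in> \<Delta> ` {u. u ^ rot_ord w = 1}" using u by blast
      next
        fix r assume "r \<in> \<Delta> ` {u. u ^ rot_ord w = 1}"
        then show "r \<in> S" unfolding S using \<Delta> by blast
      qed
    qed
    then have "card {u :: complex. u ^ rot_ord w = 1} = card S" by (rule bij_betw_same_card)
    then show "card S = rot_ord w" using card_roots_unity_eq[OF rot_ord_pos[of w]] by simp
  next
    assume 2: "rot_ord z = rot_ord w"
    have "S = {r0}"
    proof (intro equalityI subsetI)
      fix r assume "r \<in> S"
      then obtain u q where u: "r \<in> D" "u ^ rot_ord w = 1" "q \<in> gauss_ints" "(w + r) / \<mu> = u * z + q"
        unfolding S by blast
      have u4: "u ^ 4 = 1" by (rule unit_of_rot_ord[OF u(2)])
      then have "u * z - z \<in> gauss_ints" using unit_rot_ord_iff u(2) 2 by simp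
      then have k: "u * z - z + q \<in> gauss_ints" using u(3) by blast
      have "(w + r) / \<mu> = (w + r0) / \<mu> + (u * z - z + q)" unfolding u(4) z[symmetric] by simp
      then show "r \<in> {r0}" using uniq[OF u(1) r0 k] by simp
    qed (use r0 in \<open>auto simp: S_def z\<close>)
    then show "card S = 1" by simp
  }
qed

text \<open>Over a cone point of order \<open>e\<close>, the cone point itself is an unramified
  preimage. All other preimages have trivial stabiliser, since cone points are fixed; each has local
  degree \<open>e\<close> and accounts for \<open>e\<close> of the \<open>d\<close> residues modulo
  \<open>\<mu>\<close>. Thus \<open>d = 1 + e * m\<close> with \<open>m\<close> ramified
  points.\<close>

theorem realizable_gauss_norm:
  assumes \<mu>: "\<mu> \<in> gauss_ints" and d: "(norm \<mu>)\<^sup>2 = real d" "d = 4 * k + 1" "k \<ge> 1"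
  shows "realizable S2 S2 d {# replicate_mset (2 * k) 2 + {#1#}, replicate_mset k 4 + {#1#},
                 replicate_mset k 4 + {#1#} #}"
proof -
  have odd: "odd d" using d by simp
  have \<mu>0: "\<mu> \<noteq> 0" using d by auto
  \<comment> \<open>Independent of the choice, because multiplication by a Gaussian integer maps
    orbits into orbits.\<close>
  define f where "f = (\<lambda>y. p (\<mu> * (SOME z. p z = y)))"
  have f: "f (p z) = p (\<mu> * z)" for z
  proof -
    have "p (SOME z'. p z' = p z) = p z" by (rule someI[of _ z]) simp
    then obtain u l where u: "u ^ 4 = 1" "l \<in> gauss_ints" "z = u * (SOME z'. p z' = p z) + l"
      unfolding p_eq gauss_rel_def by blast
    let ?z = "SOME z'. p z' = p z"
    have "\<mu> * z = u * (\<mu> * ?z) + \<mu> * l" by (subst u(3)) (simp add: algebra_simps)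
    then have "gauss_rel (\<mu> * ?z) (\<mu> * z)" using gauss_relI[OF u(1), of "\<mu> * l"] u(2) \<mu> by simp
    then show ?thesis using p_eq by (simp add: f_def)
  qed
  have rot: "rot_ord z \<noteq> 1 \<Longrightarrow> rot_ord (\<mu> * z) = rot_ord z" for z
    using rot_ord_mult_eq[OF \<mu> d(1) odd] rot_ord_p by blast
  have ld: "has_local_degree S2 S2 f (p z) (if rot_ord z = 1 then rot_ord (\<mu> * z) else 1)" for z
    using rot[of z] by (intro p_local_degree[OF f \<mu>0]) auto
  then have ld_eq: "local_degree S2 S2 f (p z) = (if rot_ord z = 1 then rot_ord (\<mu> * z) else 1)" for z
    by (rule local_degree_eq)
  obtain D where D: "finite D" "card D = d" "D \<subseteq> gauss_ints"
    "\<And>l. l \<in> gauss_ints \<Longrightarrow> \<exists>r\<in>D. \<exists>q\<in>gauss_ints. l = r + \<mu> * q"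
    "\<And>r r' q. r \<in> D \<Longrightarrow> r' \<in> D \<Longrightarrow> q \<in> gauss_ints \<Longrightarrow> r = r' + \<mu> * q \<Longrightarrow> r = r'"
    by (rule gauss_residues[OF \<mu> \<mu>0 d(1)]) (rule that)
  define g where "g = (\<lambda>w r. p ((w + r) / \<mu>))"
  have fib: "fibre S2 f (p w) = g w ` D" for w
  proof (intro equalityI subsetI)
    fix y assume "y \<in> fibre S2 f (p w)"
    then obtain l where g: "l \<in> gauss_ints" "y = p ((w + l) / \<mu>)" using fibre_p[OF f \<mu>0] by blast
    obtain r q where "r \<in> D" "q \<in> gauss_ints" "l = r + \<mu> * q" using D(4)[OF g(1)] by blast
    moreover have "(w + (r + \<mu> * q)) / \<mu> = (w + r) / \<mu> + q" using \<mu>0 by (simp add: field_simps)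
    ultimately have "y = g w r" using g p_add by (simp add: g_def)
    then show "y \<in> g w ` D" using \<open>r \<in> D\<close> by blast
  next
    fix y assume "y \<in> g w ` D"
    then show "y \<in> fibre S2 f (p w)" using fibre_p[OF f \<mu>0] D(3) by (auto simp: g_def)
  qed
  have fin: "finite (fibre S2 f (p w))" for w using D(1) by (simp add: fib)
  \<comment> \<open>The \<open>d\<close> residues are sorted by the point of the fibre they give;
    \<open>cards\<close> evaluates the summands.\<close>
  have sum: "d = (\<Sum>y\<in>fibre S2 f (p w). card {r \<in> D. g w r = y})" for w
    using sum.image_gen[OF D(1), of "\<lambda>_. 1 :: nat" "g w"] D(2) by (simp add: fib)
  have rep: "\<exists>z r. r \<in> D \<and> z = (w + r) / \<mu> \<and> y = p z \<and> rot_ord (\<mu> * z) = rot_ord w"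
    if "y \<in> fibre S2 f (p w)" for y w
  proof -
    from that have "y \<in> g w ` D" by (simp only: fib)
    then obtain r where r: "y = g w r" "r \<in> D" by (rule imageE)
    have "\<mu> * ((w + r) / \<mu>) = w + r" using \<mu>0 by simp
    then have "p (\<mu> * ((w + r) / \<mu>)) = p w" using p_add D(3) r by auto
    then have "rot_ord (\<mu> * ((w + r) / \<mu>)) = rot_ord w" by (rule rot_ord_p)
    then show ?thesis using r unfolding g_def by blast
  qed
  have cards: "rot_ord z = 1 \<Longrightarrow> card {r \<in> D. g w r = p z} = rot_ord w"
    "rot_ord z = rot_ord w \<Longrightarrow> card {r \<in> D. g w r = p z} = 1" if "r0 \<in> D" "z = (w + r0) / \<mu>" for z w r0
    using card_residues_over[OF \<mu> \<mu>0 D(3,4,5) that] by (auto simp: g_def)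
  have generic: "card (fibre S2 f (p w)) = d" "y \<in> fibre S2 f (p w) \<Longrightarrow> local_degree S2 S2 f y = 1"
    if w: "rot_ord w = 1" for w y
  proof -
    have z1: "rot_ord z = 1" if "rot_ord (\<mu> * z) = rot_ord w" for z
      using rot[of z] that w by auto
    have "card {r \<in> D. g w r = y} = 1" if yw: "y \<in> fibre S2 f (p w)" for y
    proof -
      obtain z r where z: "r \<in> D" "z = (w + r) / \<mu>" "y = p z" "rot_ord (\<mu> * z) = rot_ord w"
        using rep[OF yw] by blast
      then show ?thesis using cards(2)[OF z(1,2)] z1[OF z(4)] w by simp
    qed
    then show "card (fibre S2 f (p w)) = d" using sum[of w] by simp
    show "local_degree S2 S2 f y = 1" if yw: "y \<in> fibre S2 f (p w)"
    proof -
      obtain z where z: "y = p z" "rot_ord (\<mu> * z) = rot_ord w" using rep[OF yw] by blast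
      then show ?thesis using z1[OF z(2)] ld_eq[of z] w by simp
    qed
  qed
  have special: "local_degrees_over S2 S2 f (p w) = replicate_mset m e + {#1#}"
    "m \<ge> 1 \<Longrightarrow> p w \<in> branching_points S2 S2 f"
    if w: "rot_ord w = e" "e \<noteq> 1" "d = 1 + e * m" for w e m
  proof -
    let ?F = "fibre S2 f (p w)"
    have pw: "p w \<in> ?F" using rot_ord_mult_eq[OF \<mu> d(1) odd, of w] w by (simp add: fibre_def f)
    have ldw: "local_degree S2 S2 f (p w) = 1" using ld_eq[of w] w by simp
    have other: "local_degree S2 S2 f y = e \<and> card {r \<in> D. g w r = y} = e" if y: "y \<in> ?F" "y \<noteq> p w" for y
    proof -
      obtain z r where z: "r \<in> D" "z = (w + r) / \<mu>" "y = p z" "rot_ord (\<mu> * z) = rot_ord w"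
        using rep[OF y(1)] by blast
      have "rot_ord z = 1"
      proof (rule ccontr)
        assume "rot_ord z \<noteq> 1"
        then have "p (\<mu> * z) = p z" using rot_ord_mult_eq[OF \<mu> d(1) odd] by blast
        then show False using y z by (auto simp: fibre_def f)
      qed
      then show ?thesis using cards(1)[OF z(1,2)] ld_eq[of z] z w by simp
    qed
    have "card {r \<in> D. g w r = p w} = 1"
    proof -
      obtain z r where z: "r \<in> D" "z = (w + r) / \<mu>" "p w = p z" using rep[OF pw] by blast
      then show ?thesis using cards(2)[OF z(1,2)] rot_ord_p[OF z(3)] by simp
    qed
    moreover have "d = card {r \<in> D. g w r = p w} + (\<Sum>y\<in>?F - {p w}. card {r \<in> D. g w r = y})"
      by (subst sum[of w]) (rule sum.remove[OF fin pw])
    moreover have "(\<Sum>y\<in>?F - {p w}. card {r \<in> D. g w r = y}) = (\<Sum>y\<in>?F - {p w}. e)"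
      using other by (intro sum.cong) auto
    ultimately have "d = 1 + card (?F - {p w}) * e" by simp
    then have "card (?F - {p w}) = m" using w rot_ord_pos[of w] by simp
    then have cF: "card ?F = Suc m" using card.remove[OF fin pw] by simp
    show "local_degrees_over S2 S2 f (p w) = replicate_mset m e + {#1#}"
      unfolding local_degrees_over_def
      by (rule image_mset_special[of _ "p w"]) (use fin pw ldw cF other in auto)
    show "p w \<in> branching_points S2 S2 f" if "m \<ge> 1"
    proof -
      have "card (?F - {p w}) \<noteq> 0" using \<open>card (?F - {p w}) = m\<close> that by simp
      then have "?F - {p w} \<noteq> {}" by (metis card.empty)
      then obtain y where "y \<in> ?F" "y \<noteq> p w" by blast
      then have "local_degree S2 S2 f y = e" using other by blast
      then have "local_degree S2 S2 f y > 1" using w rot_ord_pos[of w] by simp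
      then show ?thesis using \<open>y \<in> ?F\<close> unfolding branching_points_def by auto
    qed
  qed
  let ?c = "(1 + \<i>) / 2 :: complex" and ?h = "1 / 2 :: complex"
  have d2: "d = 1 + 2 * (2 * k)" "d = 1 + 4 * k" using d by auto
  \<comment> \<open>The condition \<open>k \<ge> 1\<close> provides a ramified point over each of
    the three.\<close>
  have sp: "p 0 \<in> branching_points S2 S2 f" "p ?c \<in> branching_points S2 S2 f" "p ?h \<in> branching_points S2 S2 f"
    using special(2)[of 0 4 k] special(2)[of ?c 4 k] special(2)[of ?h 2 "2 * k"] d2 d(3) by auto
  have ngen: "rot_ord w \<noteq> 1" if "p w \<in> branching_points S2 S2 f" for w
    using that generic(2)[of w] by (auto simp: branching_points_def)
  have bp: "branching_points S2 S2 f = {p 0, p ?c, p ?h}"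
  proof (intro equalityI subsetI)
    fix y assume y: "y \<in> branching_points S2 S2 f"
    then have "y \<in> sphere 0 1" by (simp add: branching_points_def)
    then obtain w where w: "y = p w" using p_surj by blast
    then have "rot_ord w = 2 \<or> rot_ord w = 4" using ngen y rot_ord_cases[of w] by blast
    then have "gauss_rel 0 w \<or> gauss_rel ?c w \<or> gauss_rel ?h w" using rot_ord_2 rot_ord_4 by blast
    then have "p 0 = p w \<or> p ?c = p w \<or> p ?h = p w" by (simp only: p_eq)
    then show "y \<in> {p 0, p ?c, p ?h}" unfolding w by auto
  qed (use sp in auto)
  have dist: "p 0 \<noteq> p ?c" "p 0 \<noteq> p ?h" "p ?c \<noteq> p ?h"
    using not_gauss_rel_0_center p_eq rot_ord_p[of 0 ?h] rot_ord_p[of ?c ?h] by auto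
  show ?thesis
    unfolding realizable_def
  proof (intro exI[of _ f] conjI)
    show "finite (branching_points S2 S2 f)" by (simp add: bp)
    have "mset_set (branching_points S2 S2 f) = {#p ?h, p 0, p ?c#}"
      unfolding bp using dist by (simp add: add_mset_commute)
    then show "image_mset (local_degrees_over S2 S2 f) (mset_set (branching_points S2 S2 f)) =
      {# replicate_mset (2 * k) 2 + {#1#}, replicate_mset k 4 + {#1#}, replicate_mset k 4 + {#1#} #}"
      using special(1)[of 0 4 k] special(1)[of ?c 4 k] special(1)[of ?h 2 "2 * k"] d2 by simp
    show "branched_cover_of_degree S2 S2 f d"
      unfolding branched_cover_of_degree_def branched_cover_def
    proof (intro conjI ballI)
      show "\<exists>k. has_local_degree S2 S2 f x k" if "x \<in> topspace S2" for x
        using that p_surj[of x] ld by auto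
      fix y assume y: "y \<in> topspace S2 - branching_points S2 S2 f"
      then obtain w where w: "y = p w" using p_surj by auto
      have "rot_ord w = 1"
      proof (rule ccontr)
        assume "rot_ord w \<noteq> 1"
        then have "rot_ord w = 2 \<or> rot_ord w = 4" using rot_ord_cases[of w] by blast
        then show False using special(2)[of w 2 "2 * k"] special(2)[of w 4 k] d2 d(3) y w by auto
      qed
      then show "finite (fibre S2 f y)" "card (fibre S2 f y) = d" using fin generic(1) w by auto
    qed
  qed
qed

end

section \<open>Lifting through a branched cover\<close>

text \<open>The inverse \<open>\<alpha>\<close> of the source chart is defined on the whole plane,
  so a continuous root of the target coordinate, composed with \<open>\<alpha>\<close>, becomes a
  local lift.\<close>

lemma has_local_degree_S2E:
  assumes "has_local_degree S2 S2 f x k"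
  obtains U V \<alpha> \<phi> \<psi> where "k \<ge> 1" "openin S2 U" "x \<in> U" "openin S2 V" "f ` U \<subseteq> V"
    "\<phi> x = (0 :: complex)" "\<psi> (f x) = (0 :: complex)"
    "continuous_on UNIV \<alpha>" "\<And>w. \<alpha> w \<in> U" "\<And>w. \<phi> (\<alpha> w) = w" "\<And>u. u \<in> U \<Longrightarrow> \<alpha> (\<phi> u) = u"
    "continuous_on V \<psi>" "inj_on \<psi> V" "\<And>u. u \<in> U \<Longrightarrow> \<psi> (f u) = \<phi> u ^ k" "continuous_on U f"
proof -
  obtain U V \<phi> \<psi> where UV: "k \<ge> 1" "openin S2 U" "x \<in> U" "openin S2 V" "f ` U \<subseteq> V"
    and \<phi>: "homeomorphic_map (subtopology S2 U) (euclidean :: complex topology) \<phi>" "\<phi> x = 0"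
    and \<psi>: "homeomorphic_map (subtopology S2 V) (euclidean :: complex topology) \<psi>" "\<psi> (f x) = 0"
    and eq: "\<And>u. u \<in> U \<Longrightarrow> \<psi> (f u) = \<phi> u ^ k"
    using assms unfolding has_local_degree_def by blast
  have sub: "subtopology S2 U = top_of_set U" "subtopology S2 V = top_of_set V"
    using UV openin_imp_subset by (metis inf.absorb_iff2 subtopology_subtopology)+
  obtain \<alpha> where \<alpha>: "homeomorphic_maps (top_of_set U) euclidean \<phi> \<alpha>"
    using \<phi>(1) unfolding sub homeomorphic_map_maps by blast
  obtain \<beta> where \<beta>: "homeomorphic_maps (top_of_set V) euclidean \<psi> \<beta>"
    using \<psi>(1) unfolding sub homeomorphic_map_maps by blast
  have \<alpha>': "continuous_on U \<phi>" "continuous_on UNIV \<alpha>" "\<And>w. \<alpha> w \<in> U" "\<And>w. \<phi> (\<alpha> w) = w"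
    "\<And>u. u \<in> U \<Longrightarrow> \<alpha> (\<phi> u) = u"
    using \<alpha> by (auto simp: homeomorphic_maps_def continuous_map_in_subtopology)
  have \<beta>': "continuous_on V \<psi>" "continuous_on UNIV \<beta>" "\<And>v. v \<in> V \<Longrightarrow> \<beta> (\<psi> v) = v"
    using \<beta> by (auto simp: homeomorphic_maps_def continuous_map_in_subtopology)
  have inj: "inj_on \<psi> V" using \<beta>'(3) by (metis inj_on_inverseI)
  have "continuous_on U (\<lambda>u. \<beta> (\<phi> u ^ k))"
    by (rule continuous_on_compose2[OF \<beta>'(2)]) (auto intro!: continuous_intros \<alpha>')
  moreover have "\<beta> (\<phi> u ^ k) = f u" if "u \<in> U" for u
    using eq[OF that] \<beta>'(3)[of "f u"] UV(5) that by auto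
  ultimately have fc: "continuous_on U f" using continuous_on_cong by (metis (no_types, lifting))
  show thesis
    by (rule that[OF UV \<phi>(2) \<psi>(2) \<alpha>'(2-5) \<beta>'(1) inj eq fc])
qed

text \<open>A continuous logarithm \<open>Q\<close> of \<open>q (z + exp t)\<close> satisfies \<open>Q (t + 2 \<pi> i / e) = Q t + c\<close> with
  \<open>exp c = 1\<close>, so that \<open>exp (Q t / k)\<close> only depends on \<open>exp t\<close>.\<close>

lemma continuous_root_on_disc:
  fixes q :: "complex \<Rightarrow> complex"
  assumes r: "r > 0" and q: "continuous_on (ball z r) q" and e: "e = k * j" "e > 0"
    and q0: "\<And>\<zeta>. \<zeta> \<in> ball z r \<Longrightarrow> q \<zeta> = 0 \<longleftrightarrow> \<zeta> = z"
    and sym: "\<And>h u. norm h < r \<Longrightarrow> u ^ e = 1 \<Longrightarrow> q (z + u * h) = q (z + h)"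
  obtains g where "continuous_on (ball z r) g" "\<And>\<zeta>. \<zeta> \<in> ball z r \<Longrightarrow> g \<zeta> ^ k = q \<zeta>"
proof -
  have k: "k > 0" and j: "j > 0" using e by auto
  define H where "H = {t :: complex. Re t < ln r}"
  have H: "open H" "convex H" by (auto simp: H_def open_halfspace_Re_lt convex_halfspace_Re_lt)
  have H_iff: "t \<in> H \<longleftrightarrow> norm (exp t) < r" for t
    using r by (simp add: H_def) (metis exp_less_cancel_iff exp_ln)
  have in_ball: "z + exp t \<in> ball z r" if "t \<in> H" for t using that H_iff by (simp add: dist_norm)
  have cont: "continuous_on H (\<lambda>t. q (z + exp t))"
    by (rule continuous_on_compose2[OF q]) (use in_ball in \<open>auto intro!: continuous_intros\<close>)
  obtain Q where Q: "continuous_on H Q" "\<And>t. t \<in> H \<Longrightarrow> q (z + exp t) = exp (Q t)"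
  proof (rule continuous_logarithm_on_contractible[OF cont])
    show "contractible H" using H(2) by (rule convex_imp_contractible)
    show "q (z + exp t) \<noteq> 0" if "t \<in> H" for t using q0[OF in_ball[OF that]] by simp
  qed blast
  \<comment> \<open>In the logarithmic coordinate, adding \<open>a\<close> is the rotation of the
    disc of order \<open>e\<close>.\<close>
  define a where "a = 2 * of_real pi * \<i> / of_nat e"
  have expa: "exp a ^ e = 1" using e by (simp add: a_def flip: exp_of_nat_mult)
  have Ha: "t + of_nat n * a \<in> H \<longleftrightarrow> t \<in> H" for t n by (simp add: H_def a_def)
  have Ha1: "t + a \<in> H \<longleftrightarrow> t \<in> H" for t using Ha[of t 1] by simp
  have expQ: "exp (Q (t + a) - Q t) = 1" if "t \<in> H" for t
  proof -
    have "exp (Q (t + a)) = q (z + exp a * exp t)"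
      using Q(2)[of "t + a"] Ha1 that by (simp add: exp_add mult.commute)
    also have "\<dots> = exp (Q t)" using sym[of "exp t" "exp a"] expa that H_iff Q(2) by simp
    finally show ?thesis by (simp add: exp_diff)
  qed
  \<comment> \<open>The values are logarithms of 1; distinct ones are at least \<open>2 * pi\<close>
    apart.\<close>
  have "(\<lambda>t. Q (t + a) - Q t) constant_on H"
  proof (rule continuous_discrete_range_constant)
    show "connected H" using H(2) by (rule convex_connected)
    have "continuous_on H (\<lambda>t. Q (t + a))"
      by (rule continuous_on_compose2[OF Q(1)]) (use Ha1 in \<open>auto intro!: continuous_intros\<close>)
    then show "continuous_on H (\<lambda>t. Q (t + a) - Q t)" using Q(1) by (intro continuous_intros)
    fix t assume t: "t \<in> H"
    have "2 * pi \<le> norm ((Q (s + a) - Q s) - (Q (t + a) - Q t))"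
      if s: "s \<in> H" "Q (s + a) - Q s \<noteq> Q (t + a) - Q t" for s
    proof -
      let ?w = "(Q (s + a) - Q s) - (Q (t + a) - Q t)"
      have "exp ?w = 1" using expQ[OF s(1)] expQ[OF t] by (simp add: exp_diff[of "Q (s + a) - Q s"])
      then obtain n :: int where n: "Re ?w = 0" "Im ?w = of_int (2 * n) * pi" using exp_eq_1 by blast
      have "n \<noteq> 0"
      proof
        assume "n = 0"
        then have "?w = 0" using n by (simp add: complex_eq_iff)
        then show False using s(2) by simp
      qed
      then have "1 * (2 * pi) \<le> \<bar>of_int n\<bar> * (2 * pi)" by (intro mult_right_mono) auto
      also have "\<dots> = \<bar>Im ?w\<bar>" unfolding n by (simp add: abs_mult)
      also have "\<dots> \<le> norm ?w" by (rule abs_Im_le_cmod)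
      finally show ?thesis by simp
    qed
    then show "\<exists>\<epsilon>>0. \<forall>s. s \<in> H \<and> Q (s + a) - Q s \<noteq> Q (t + a) - Q t \<longrightarrow>
        \<epsilon> \<le> norm ((Q (s + a) - Q s) - (Q (t + a) - Q t))"
      by (intro exI[of _ "2 * pi"]) auto
  qed
  then obtain c where c: "\<And>t. t \<in> H \<Longrightarrow> Q (t + a) - Q t = c" by (auto simp: constant_on_def)
  have Qn: "Q (t + of_nat n * a) = Q t + of_nat n * c" if "t \<in> H" for t n
  proof (induction n)
    case (Suc n)
    have "Q (t + of_nat (Suc n) * a) = Q ((t + of_nat n * a) + a)" by (simp add: algebra_simps)
    also have "\<dots> = Q (t + of_nat n * a) + c" using c[of "t + of_nat n * a"] Ha that by (simp add: algebra_simps)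
    finally show ?case using Suc by (simp add: algebra_simps)
  qed simp
  define P where "P = (\<lambda>t. exp (Q t / of_nat k))"
  \<comment> \<open>A full turn consists of \<open>e = k * j\<close> steps of \<open>a\<close>, so
    \<open>Q / k\<close> grows by \<open>j * c\<close>, which the exponential does not see. Here the
    divisibility of \<open>e\<close> by \<open>k\<close> enters.\<close>
  have P_step: "P (t + 2 * of_real pi * \<i>) = P t" if "t \<in> H" for t
  proof -
    have "exp c = 1" using expQ[OF that] c[OF that] by simp
    have "t + 2 * of_real pi * \<i> = t + of_nat e * a" using e by (simp add: a_def)
    then have "Q (t + 2 * of_real pi * \<i>) / of_nat k = Q t / of_nat k + of_nat j * c"
      using Qn[OF that, of e] k by (simp add: e add_divide_distrib)
    then have "P (t + 2 * of_real pi * \<i>) = P t * exp c ^ j"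
      by (simp add: P_def exp_add exp_of_nat_mult)
    then show ?thesis using \<open>exp c = 1\<close> by simp
  qed
  have P_nat: "P (t + of_nat n * (2 * of_real pi * \<i>)) = P t" if "t \<in> H" for t n
  proof (induction n)
    case (Suc n)
    have "t + of_nat n * (2 * of_real pi * \<i>) \<in> H" using that by (simp add: H_def)
    then show ?case using P_step[of "t + of_nat n * (2 * of_real pi * \<i>)"] Suc by (simp add: algebra_simps)
  qed simp
  have P_eq: "P s = P t" if st: "s \<in> H" "t \<in> H" "exp s = exp t" for s t
  proof -
    obtain n :: int where "s = t + of_real (of_int (2 * n) * pi) * \<i>"
      using st(3) unfolding exp_eq by (elim exE) simp
    then have n: "s = t + of_int (2 * n) * of_real pi * \<i>" by simp
    show ?thesis
    proof (cases "n \<ge> 0")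
      case True
      then have "s = t + of_nat (nat n) * (2 * of_real pi * \<i>)" using n by simp
      then show ?thesis using P_nat[OF st(2), of "nat n"] by (simp only:)
    next
      case False
      then have "t = s + of_nat (nat (- n)) * (2 * of_real pi * \<i>)" using n by simp
      then show ?thesis using P_nat[OF st(1), of "nat (- n)"] by (simp only:)
    qed
  qed
  have P_pow: "P t ^ k = q (z + exp t)" if "t \<in> H" for t
    using Q(2)[OF that] k by (simp add: P_def flip: exp_of_nat_mult)
  have P_cont: "continuous_on H P" unfolding P_def by (intro continuous_intros Q(1)) (use k in auto)
  \<comment> \<open>By \<open>P_eq\<close> every other logarithm of \<open>\<zeta> - z\<close> gives
    the same value as \<open>Ln\<close>.\<close>
  define g where "g = (\<lambda>\<zeta>. if \<zeta> = z then 0 else P (Ln (\<zeta> - z)))"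
  have Ln_H: "Ln (\<zeta> - z) \<in> H" "exp (Ln (\<zeta> - z)) = \<zeta> - z" if "\<zeta> \<in> ball z r" "\<zeta> \<noteq> z" for \<zeta>
    using that H_iff[of "Ln (\<zeta> - z)"] by (simp_all add: dist_norm norm_minus_commute)
  have gP: "g (z + exp t) = P t" if "t \<in> H" for t
    using P_eq[of "Ln (exp t)" t] that H_iff by (simp add: g_def)
  have g_pow: "g \<zeta> ^ k = q \<zeta>" if "\<zeta> \<in> ball z r" for \<zeta>
  proof (cases "\<zeta> = z")
    case True
    then show ?thesis using q0[OF that] k by (simp add: g_def)
  next
    case False
    then show ?thesis using P_pow[OF Ln_H(1)[OF that False]] Ln_H(2)[OF that False] by (simp add: g_def)
  qed
  let ?D = "ball z r - {z}"
  have "open ?D" by (simp add: open_delete)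
  \<comment> \<open>\<open>Ln\<close> jumps along its cut, so openness of preimages is carried over
    from \<open>P\<close> by the open map \<open>t \<mapsto> z + exp t\<close>.\<close>
  have g_cont: "continuous_on ?D g"
    unfolding continuous_on_open_vimage[OF \<open>open ?D\<close>]
  proof (intro allI impI)
    fix B :: "complex set" assume B: "open B"
    have "g -` B \<inter> ?D = (\<lambda>t. z + exp t) ` (P -` B \<inter> H)"
    proof (intro equalityI subsetI)
      fix \<zeta> assume \<zeta>: "\<zeta> \<in> g -` B \<inter> ?D"
      then have "Ln (\<zeta> - z) \<in> P -` B \<inter> H" "\<zeta> = z + exp (Ln (\<zeta> - z))"
        using Ln_H[of \<zeta>] by (auto simp: g_def)
      then show "\<zeta> \<in> (\<lambda>t. z + exp t) ` (P -` B \<inter> H)" by (rule rev_image_eqI)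
    next
      fix \<zeta> assume "\<zeta> \<in> (\<lambda>t. z + exp t) ` (P -` B \<inter> H)"
      then obtain t where t: "\<zeta> = z + exp t" "t \<in> H" "P t \<in> B" by auto
      then show "\<zeta> \<in> g -` B \<inter> ?D" using gP[OF t(2)] in_ball[OF t(2)] by auto
    qed
    moreover have "open ((\<lambda>t. z + exp t) ` (P -` B \<inter> H))"
    proof (rule open_mapping_thm[of _ UNIV])
      show "open (P -` B \<inter> H)" using P_cont B continuous_on_open_vimage[OF H(1)] by blast
      show "\<not> (\<lambda>t. z + exp t) constant_on UNIV"
      proof
        assume "(\<lambda>t. z + exp t) constant_on UNIV"
        then obtain b where b: "z + exp t = b" for t by (auto simp: constant_on_def)
        then have "z + exp 0 = z + exp (of_real pi * \<i>)" by (simp only:)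
        then show False by (simp add: exp_pi_i)
      qed
    qed (auto intro!: holomorphic_intros)
    ultimately show "open (g -` B \<inter> ?D)" by simp
  qed
  have "continuous_on (ball z r) g"
  proof (rule continuous_at_imp_continuous_on, rule ballI)
    fix \<zeta> assume \<zeta>: "\<zeta> \<in> ball z r"
    show "isCont g \<zeta>"
    proof (cases "\<zeta> = z")
      case False
      then show ?thesis using g_cont \<zeta> \<open>open ?D\<close> by (simp add: continuous_on_eq_continuous_at)
    next
      case True
      have "isCont q z" using q r by (simp add: continuous_on_eq_continuous_at)
      moreover have "q z = 0" using q0[of z] r by simp
      ultimately have qz: "\<exists>\<delta>>0. \<forall>x. dist x z < \<delta> \<longrightarrow> norm (q x) < \<epsilon>" if "\<epsilon> > 0" for \<epsilon>
        using that unfolding continuous_at_eps_delta by simp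
      show ?thesis unfolding True continuous_at_eps_delta
      proof (intro allI impI)
        fix \<epsilon> :: real assume "\<epsilon> > 0"
        then obtain \<delta> where \<delta>: "\<delta> > 0" "\<And>x. dist x z < \<delta> \<Longrightarrow> norm (q x) < \<epsilon> ^ k"
          using qz[of "\<epsilon> ^ k"] by auto
        have "dist (g x) (g z) < \<epsilon>" if x: "dist x z < min \<delta> r" for x
        proof -
          have "norm (g x) ^ k = norm (q x)" using g_pow[of x] x by (simp add: dist_commute flip: norm_power)
          then have "norm (g x) ^ k < \<epsilon> ^ k" using \<delta>(2) x by simp
          then have "norm (g x) < \<epsilon>"
            by (rule power_less_imp_less_base) (rule less_imp_le[OF \<open>\<epsilon> > 0\<close>])
          then show ?thesis by (simp add: g_def)
        qed
        then show "\<exists>\<delta>>0. \<forall>x. dist x z < \<delta> \<longrightarrow> dist (g x) (g z) < \<epsilon>"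
          using \<delta>(1) r by (intro exI[of _ "min \<delta> r"]) auto
      qed
    qed
  qed
  then show thesis using g_pow by (rule that)
qed

section \<open>Local lifts of the projection through a branched cover\<close>

text \<open>The divisibility \<open>k dvd rot_ord z\<close> says that \<open>p\<close> ramifies at
  least as much as \<open>f\<close>; it is what allows \<open>p\<close> to be lifted even at cone
  points.\<close>

locale orbifold_factor = square_orbifold p for p +
  fixes f :: "real^3 \<Rightarrow> real^3"
  assumes f_deg: "\<And>z x. norm x = 1 \<Longrightarrow> f x = p z \<Longrightarrow> \<exists>k. has_local_degree S2 S2 f x k \<and> k dvd rot_ord z"
    and f_in: "\<And>x. norm x = 1 \<Longrightarrow> norm (f x) = 1"
    and f_fin: "\<And>z. finite (fibre S2 f (p z))"
begin

lemma f_cont: "continuous_on (sphere 0 1) f"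
  unfolding continuous_openin_preimage_eq
proof (intro allI impI)
  fix T :: "(real^3) set" assume T: "open T"
  show "openin S2 (sphere 0 1 \<inter> f -` T)"
  proof (subst openin_subopen, intro ballI)
    fix x assume x: "x \<in> sphere 0 1 \<inter> f -` T"
    then obtain z where "f x = p z" using f_in p_surj by fastforce
    then obtain k where "has_local_degree S2 S2 f x k" using f_deg x by auto
    then obtain U where U: "openin S2 U" "x \<in> U" "continuous_on U f"
      by (rule has_local_degree_S2E)
    have "openin (top_of_set U) (U \<inter> f -` T)"
      using U(3) T continuous_openin_preimage_eq by blast
    then have "openin S2 (U \<inter> f -` T)" using U(1) by (rule openin_trans)
    moreover have "U \<subseteq> sphere 0 1" using U(1) by (rule openin_imp_subset)
    ultimately show "\<exists>T'. openin S2 T' \<and> x \<in> T' \<and> T' \<subseteq> sphere 0 1 \<inter> f -` T"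
      using x U by (intro exI[of _ "U \<inter> f -` T"]) auto
  qed
qed

lemma f_local_inj:
  assumes "has_local_degree S2 S2 f x 1"
  obtains T where "open T" "x \<in> T" "inj_on f (sphere 0 1 \<inter> T)"
proof -
  obtain U \<alpha> \<phi> \<psi> where U: "openin S2 U" "x \<in> U" "\<And>u. u \<in> U \<Longrightarrow> \<alpha> (\<phi> u :: complex) = u"
    "\<And>u. u \<in> U \<Longrightarrow> \<psi> (f u) = \<phi> u ^ 1"
    using assms by (rule has_local_degree_S2E) (rule that)
  obtain T where T: "open T" "U = sphere 0 1 \<inter> T" using U(1) by (auto simp: openin_open)
  have "inj_on f U"
  proof (rule inj_onI)
    fix u v assume uv: "u \<in> U" "v \<in> U" "f u = f v"
    have "\<phi> u = \<phi> v" using U(4)[OF uv(1)] U(4)[OF uv(2)] unfolding uv(3) by simp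
    then have "\<alpha> (\<phi> u) = \<alpha> (\<phi> v)" by (rule arg_cong)
    then show "u = v" unfolding U(3)[OF uv(1)] U(3)[OF uv(2)] .
  qed
  then have "inj_on f (sphere 0 1 \<inter> T)" by (simp only: T(2))
  moreover have "x \<in> T" using U(2) T(2) by simp
  ultimately show thesis using T(1) by (intro that)
qed

lemma f_generic_inj:
  assumes "norm x = 1" "f x = p z" "rot_ord z = 1"
  obtains T where "open T" "x \<in> T" "inj_on f (sphere 0 1 \<inter> T)"
proof -
  obtain k where "has_local_degree S2 S2 f x k" "k dvd rot_ord z" using f_deg assms by blast
  then have "has_local_degree S2 S2 f x 1" using assms(3) by simp
  then show thesis using f_local_inj that by blast
qed

definition is_lift :: "(complex \<Rightarrow> real^3) \<Rightarrow> complex set \<Rightarrow> bool" where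
  "is_lift s W \<longleftrightarrow> continuous_on W s \<and> (\<forall>z\<in>W. norm (s z) = 1 \<and> f (s z) = p z)"

lemma is_lift_subset: "is_lift s W \<Longrightarrow> W' \<subseteq> W \<Longrightarrow> is_lift s W'"
  by (auto simp: is_lift_def intro: continuous_on_subset)

text \<open>A horizontal segment inside \<open>W\<close> is uncountable, whereas the points with
  nontrivial stabiliser are countable.\<close>

lemma generic_point:
  assumes "open W" "W \<noteq> {}"
  obtains z where "z \<in> W" "rot_ord z = 1"
proof -
  have "\<exists>z\<in>W. rot_ord z = 1"
  proof (rule ccontr)
    assume no: "\<not> ?thesis"
    obtain w where "w \<in> W" using assms(2) by blast
    then obtain r where r: "r > 0" "ball w r \<subseteq> W" using assms(1) open_contains_ball by blast
    have "{Re w<..<Re w + r} \<subseteq> Re ` {z. rot_ord z \<noteq> 1}"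
    proof
      fix x assume x: "x \<in> {Re w<..<Re w + r}"
      have "dist w (Complex x (Im w)) = \<bar>Re w - x\<bar>" by (simp add: dist_norm cmod_def)
      then have "Complex x (Im w) \<in> W" using x r(2) by auto
      then have "rot_ord (Complex x (Im w)) \<noteq> 1" using no by blast
      then show "x \<in> Re ` {z. rot_ord z \<noteq> 1}" by (intro image_eqI[of _ _ "Complex x (Im w)"]) auto
    qed
    then have "countable {Re w<..<Re w + r}"
      using countable_rot_ord by (meson countable_image countable_subset)
    then show False using r(1) uncountable_open_interval[of "Re w" "Re w + r"] by simp
  qed
  then show thesis using that by blast
qed

text \<open>Local injectivity of \<open>f\<close> is available away from the points over cone
  points, so the coincidence set is first seen to be open and closed in \<open>W0\<close>, which
  stays connected after a countable removal. Density of \<open>W0\<close> settles the remaining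
  points.\<close>

lemma lift_unique:
  assumes W: "open W" "connected W" and s: "is_lift s W" "is_lift s' W"
    and z: "z \<in> W" "rot_ord z = 1" "s z = s' z" and w: "w \<in> W"
  shows "s w = s' w"
proof -
  define W0 where "W0 = W - {z. rot_ord z \<noteq> 1}"
  have W0: "connected W0"
    unfolding W0_def by (rule connected_open_diff_countable) (use W countable_rot_ord in auto)
  define A where "A = {y \<in> W0. s y - s' y = 0}"
  have cont: "continuous_on W s" "continuous_on W s'" using s by (auto simp: is_lift_def)
  have cont0: "continuous_on W0 s" "continuous_on W0 s'"
    using cont by (auto simp: W0_def intro: continuous_on_subset)
  have "closedin (top_of_set W0) A"
    unfolding A_def by (intro continuous_closedin_preimage_constant continuous_intros cont0)
  moreover have "openin (top_of_set W0) A"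
  proof (subst openin_subopen, intro ballI)
    fix y assume y: "y \<in> A"
    then have g: "y \<in> W" "rot_ord y = 1" "s y = s' y" by (auto simp: A_def W0_def)
    obtain T where T: "open T" "s y \<in> T" "inj_on f (sphere 0 1 \<inter> T)"
      by (rule f_generic_inj[of "s y" y]) (use s g in \<open>auto simp: is_lift_def\<close>)
    let ?N = "(W0 \<inter> s -` T) \<inter> (W0 \<inter> s' -` T)"
    have "openin (top_of_set W0) ?N"
    proof (rule openin_Int)
      show "openin (top_of_set W0) (W0 \<inter> s -` T)" "openin (top_of_set W0) (W0 \<inter> s' -` T)"
        using cont0 T(1) unfolding continuous_openin_preimage_eq by blast+
    qed
    moreover have "y \<in> ?N" using y T(2) g by (auto simp: A_def)
    moreover have "?N \<subseteq> A"
    proof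
      fix \<xi> assume \<xi>: "\<xi> \<in> ?N"
      then have "\<xi> \<in> W" by (auto simp: W0_def)
      then have "s \<xi> \<in> sphere 0 1 \<inter> T" "s' \<xi> \<in> sphere 0 1 \<inter> T" "f (s \<xi>) = f (s' \<xi>)"
        using s \<xi> by (auto simp: is_lift_def)
      then have "s \<xi> = s' \<xi>" using T(3) by (metis inj_onD)
      then show "\<xi> \<in> A" using \<xi> by (auto simp: A_def)
    qed
    ultimately show "\<exists>T. openin (top_of_set W0) T \<and> y \<in> T \<and> T \<subseteq> A" by blast
  qed
  moreover have "z \<in> A" using z by (auto simp: A_def W0_def)
  ultimately have A: "A = W0" using W0 unfolding connected_clopen by blast
  show ?thesis
  proof (rule ccontr)
    assume ne: "s w \<noteq> s' w"
    let ?O = "{y \<in> W. s y - s' y \<noteq> 0}"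
    have "?O = W \<inter> (\<lambda>y. s y - s' y) -` (- {0})" by auto
    moreover have "open (W \<inter> (\<lambda>y. s y - s' y) -` (- {0}))"
      by (intro continuous_open_preimage continuous_intros cont W)
    ultimately have "open ?O" by simp
    moreover have "w \<in> ?O" using w ne by simp
    ultimately obtain y where "y \<in> ?O" "rot_ord y = 1" using generic_point by blast
    then have "y \<in> W0" "y \<notin> A" by (auto simp: W0_def A_def)
    then show False using A by simp
  qed
qed

text \<open>Starting points over cone points are left out, since a value there need not determine a
  lift.\<close>

definition liftable :: "complex set \<Rightarrow> bool" where
  "liftable W \<longleftrightarrow> (\<forall>z\<in>W. rot_ord z = 1 \<longrightarrow> (\<forall>x. norm x = 1 \<longrightarrow> f x = p z \<longrightarrow> (\<exists>s. is_lift s W \<and> s z = x)))"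

lemma liftable_subset:
  assumes "liftable W" "W' \<subseteq> W"
  shows "liftable W'"
  unfolding liftable_def
proof (intro ballI impI allI)
  fix z x assume "z \<in> W'" "rot_ord z = 1" "norm x = 1" "f x = p z"
  then obtain s where "is_lift s W" "s z = x" using assms unfolding liftable_def by blast
  then show "\<exists>s. is_lift s W' \<and> s z = x" using is_lift_subset assms(2) by blast
qed

text \<open>In the charts \<open>f\<close> is the power map of exponent \<open>k\<close>. The
  coordinate \<open>q\<close> of \<open>p\<close> vanishes only at \<open>z\<close> and is invariant
  under rotations of order \<open>rot_ord z\<close>, a multiple of \<open>k\<close>, so it has a
  continuous root \<open>g\<close> of exponent \<open>k\<close>. The lifts are
  \<open>\<alpha> (c * g)\<close> with \<open>c ^ k = 1\<close>, and \<open>c\<close> is adjusted to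
  the prescribed value.\<close>

lemma local_liftable_at:
  assumes x: "norm x = 1" "f x = p z"
  shows "\<exists>U r. r > 0 \<and> openin S2 U \<and> x \<in> U \<and>
    (\<forall>y\<in>ball z r. \<forall>x'\<in>U. f x' = p y \<longrightarrow> (\<exists>s. is_lift s (ball z r) \<and> s y = x'))"
proof -
  obtain k where k: "has_local_degree S2 S2 f x k" "k dvd rot_ord z" using f_deg[OF x] by blast
  obtain U V \<alpha> \<phi> \<psi> where UV: "k \<ge> 1" "openin S2 U" "x \<in> U" "openin S2 V" "f ` U \<subseteq> V"
    "\<phi> x = (0 :: complex)" "\<psi> (f x) = (0 :: complex)"
    "continuous_on UNIV \<alpha>" "\<And>w. \<alpha> w \<in> U" "\<And>w. \<phi> (\<alpha> w) = w" "\<And>u. u \<in> U \<Longrightarrow> \<alpha> (\<phi> u) = u"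
    "continuous_on V \<psi>" "inj_on \<psi> V" "\<And>u. u \<in> U \<Longrightarrow> \<psi> (f u) = \<phi> u ^ k" "continuous_on U f"
    using k(1) by (rule has_local_degree_S2E) (rule that)
  obtain T where T: "open T" "V = sphere 0 1 \<inter> T" using UV(4) by (auto simp: openin_open)
  have fxV: "p z \<in> V" using UV(3,5) x(2) by auto
  have "open (p -` T)" using p_cont T(1) by (intro open_vimage) auto
  moreover have "z \<in> p -` T" using fxV T by simp
  ultimately obtain r1 where r1: "r1 > 0" "ball z r1 \<subseteq> p -` T" using open_contains_ball by blast
  obtain r2 where r2: "r2 > 0"
    "\<And>h h'. norm h < r2 \<Longrightarrow> norm h' < r2 \<Longrightarrow> p (z + h) = p (z + h') \<longleftrightarrow> h ^ rot_ord z = h' ^ rot_ord z"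
    using p_local by blast
  define r where "r = min r1 r2"
  have r: "r > 0" "r \<le> r1" "r \<le> r2" using r1 r2 by (auto simp: r_def)
  have pV: "p y \<in> V" if "y \<in> ball z r" for y
  proof -
    have "y \<in> ball z r1" using that r by simp
    then have "p y \<in> T" using r1(2) by blast
    then show ?thesis using T by simp
  qed
  define q where "q = (\<lambda>y. \<psi> (p y))"
  have q_cont: "continuous_on (ball z r) q"
    unfolding q_def
    by (rule continuous_on_compose2[OF UV(12)]) (use pV p_cont in \<open>auto intro: continuous_on_subset\<close>)
  have q0: "q y = 0 \<longleftrightarrow> y = z" if y: "y \<in> ball z r" for y
  proof
    assume "q y = 0"
    then have "\<psi> (p y) = \<psi> (p z)" using UV(7) x by (simp add: q_def)
    then have "p y = p z" using UV(13) pV[OF y] fxV by (auto dest: inj_onD)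
    then have "p (z + (y - z)) = p (z + 0)" by simp
    moreover have "norm (y - z) < r2" using y r by (simp add: dist_norm norm_minus_commute)
    ultimately have "(y - z) ^ rot_ord z = 0 ^ rot_ord z" using r2(1) r2(2)[of "y - z" 0] by simp
    then show "y = z" using rot_ord_pos[of z] by (simp add: zero_power)
  next
    assume "y = z" then show "q y = 0" using UV(7) x by (simp add: q_def)
  qed
  have q_sym: "q (z + u * h) = q (z + h)" if "u ^ rot_ord z = 1" for u h
  proof -
    have u4: "u ^ 4 = 1" by (rule unit_of_rot_ord[OF that])
    then have "- (u * z - z) \<in> gauss_ints" using unit_rot_ord_iff that by blast
    then have "p (u * (z + h) + - (u * z - z)) = p (z + h)" using p_add p_mult[OF u4] by simp
    then show ?thesis by (simp add: q_def algebra_simps)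
  qed
  obtain j where j: "rot_ord z = k * j" using k(2) by blast
  obtain g where g: "continuous_on (ball z r) g" "\<And>y. y \<in> ball z r \<Longrightarrow> g y ^ k = q y"
  proof (rule continuous_root_on_disc[OF r(1) q_cont j rot_ord_pos])
    show "q y = 0 \<longleftrightarrow> y = z" if "y \<in> ball z r" for y using that by (rule q0)
    show "q (z + u * h) = q (z + h)" if "norm h < r" "u ^ rot_ord z = 1" for h u
      using that(2) by (rule q_sym)
  qed (rule that)
  have "\<exists>s. is_lift s (ball z r) \<and> s y = x'" if y: "y \<in> ball z r" and x': "x' \<in> U" "f x' = p y" for y x'
  proof -
    have eq: "\<phi> x' ^ k = g y ^ k" using UV(14)[OF x'(1)] g(2)[OF y] x'(2) by (simp add: q_def)
    have "\<exists>c. c ^ k = 1 \<and> \<phi> x' = c * g y"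
    proof (cases "g y = 0")
      case True
      then have "\<phi> x' = 0" using eq UV(1) by (simp add: zero_power)
      then show ?thesis using True by (intro exI[of _ 1]) simp
    next
      case False
      then show ?thesis using eq by (intro exI[of _ "\<phi> x' / g y"]) (simp add: power_divide)
    qed
    then obtain c where c: "c ^ k = 1" "\<phi> x' = c * g y" by blast
    define s where "s = (\<lambda>\<xi>. \<alpha> (c * g \<xi>))"
    have sU: "s \<xi> \<in> U" for \<xi> using UV(9) by (simp add: s_def)
    have "is_lift s (ball z r)"
      unfolding is_lift_def
    proof (intro conjI ballI)
      show "continuous_on (ball z r) s"
        unfolding s_def by (rule continuous_on_compose2[OF UV(8)]) (auto intro!: continuous_intros g(1))
      fix \<xi> assume \<xi>: "\<xi> \<in> ball z r"
      show "norm (s \<xi>) = 1" using sU[of \<xi>] openin_imp_subset[OF UV(2)] by auto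
      have "\<psi> (f (s \<xi>)) = (c * g \<xi>) ^ k" using UV(14)[OF sU] UV(10) by (simp add: s_def)
      also have "\<dots> = \<psi> (p \<xi>)" using c(1) g(2)[OF \<xi>] by (simp add: power_mult_distrib q_def)
      finally show "f (s \<xi>) = p \<xi>" using UV(5,13) sU[of \<xi>] pV[OF \<xi>] by (auto dest: inj_onD)
    qed
    moreover have "s y = x'" using UV(11)[OF x'(1)] by (simp add: s_def flip: c(2))
    ultimately show ?thesis by blast
  qed
  then show ?thesis using r(1) UV(2,3) by blast
qed

text \<open>Outside neighbourhoods of the finitely many points over \<open>p z\<close>, the image
  under \<open>f\<close> is compact and misses \<open>p z\<close>. Hence for \<open>y\<close> near
  \<open>z\<close> all points over \<open>p y\<close> lie in these neighbourhoods, where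
  \<open>local_liftable_at\<close> applies.\<close>

lemma local_liftable: "\<exists>r>0. liftable (ball z r)"
proof -
  let ?F = "fibre S2 f (p z)"
  have "\<forall>x\<in>?F. \<exists>Ur. snd Ur > 0 \<and> openin S2 (fst Ur) \<and> x \<in> fst Ur \<and>
    (\<forall>y\<in>ball z (snd Ur). \<forall>x'\<in>fst Ur. f x' = p y \<longrightarrow> (\<exists>s. is_lift s (ball z (snd Ur)) \<and> s y = x'))"
  proof
    fix x assume "x \<in> ?F"
    then have "norm x = 1" "f x = p z" by (auto simp: fibre_def)
    from local_liftable_at[OF this] show "\<exists>Ur. snd Ur > 0 \<and> openin S2 (fst Ur) \<and> x \<in> fst Ur \<and>
    (\<forall>y\<in>ball z (snd Ur). \<forall>x'\<in>fst Ur. f x' = p y \<longrightarrow> (\<exists>s. is_lift s (ball z (snd Ur)) \<and> s y = x'))"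
      by auto
  qed
  from bchoice[OF this] obtain Ur where Ur: "\<And>x. x \<in> ?F \<Longrightarrow> snd (Ur x) > 0 \<and> openin S2 (fst (Ur x)) \<and> x \<in> fst (Ur x) \<and>
    (\<forall>y\<in>ball z (snd (Ur x)). \<forall>x'\<in>fst (Ur x). f x' = p y \<longrightarrow>
      (\<exists>s. is_lift s (ball z (snd (Ur x))) \<and> s y = x'))" by blast
  define K where "K = sphere 0 1 - (\<Union>x\<in>?F. fst (Ur x))"
  have "openin S2 (\<Union>x\<in>?F. fst (Ur x))" using Ur by (intro openin_Union) auto
  then have "closedin S2 K" unfolding K_def by (metis closedin_diff closedin_topspace topspace_euclidean_subtopology)
  then have "compact K" using compact_sphere closedin_compact by blast
  moreover have "continuous_on K f" using f_cont by (rule continuous_on_subset) (auto simp: K_def)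
  ultimately have "compact (f ` K)" by (intro compact_continuous_image)
  then have "open (p -` (- (f ` K)))" using p_cont by (intro open_vimage) (auto simp: compact_imp_closed open_Compl)
  moreover have "z \<in> p -` (- (f ` K))"
  proof -
    have "p z \<noteq> f x" if "x \<in> K" for x
    proof
      assume "p z = f x"
      then have "x \<in> ?F" using that by (auto simp: fibre_def K_def)
      then show False using Ur[of x] that by (auto simp: K_def)
    qed
    then show ?thesis by auto
  qed
  ultimately obtain r0 where r0: "r0 > 0" "ball z r0 \<subseteq> p -` (- (f ` K))" using open_contains_ball by blast
  define r where "r = Min (insert r0 ((\<lambda>x. snd (Ur x)) ` ?F))"
  have fin: "finite ?F" by (rule f_fin)
  have fin': "finite (insert r0 ((\<lambda>x. snd (Ur x)) ` ?F))" using fin by simp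
  have r: "r > 0" using fin' r0(1) Ur unfolding r_def by (subst Min_gr_iff) auto
  have r_le: "r \<le> r0" "\<And>x. x \<in> ?F \<Longrightarrow> r \<le> snd (Ur x)"
    unfolding r_def by (auto intro!: Min_le fin')
  have "liftable (ball z r)"
    unfolding liftable_def
  proof (intro ballI impI allI)
    fix y x' assume y: "y \<in> ball z r" and x': "norm x' = 1" "f x' = p y"
    have "y \<in> ball z r0" using y r_le(1) by simp
    then have "p y \<notin> f ` K" using r0(2) by blast
    then have "x' \<notin> K" using x'(2) by (metis imageI)
    then obtain x where x: "x \<in> ?F" "x' \<in> fst (Ur x)" using x'(1) by (auto simp: K_def)
    have "y \<in> ball z (snd (Ur x))" using y r_le(2)[OF x(1)] by simp
    then obtain s where s: "is_lift s (ball z (snd (Ur x)))" "s y = x'"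
      using Ur[OF x(1)] x(2) x'(2) by blast
    moreover have "ball z r \<subseteq> ball z (snd (Ur x))" using r_le(2)[OF x(1)] by (rule subset_ball)
    ultimately show "\<exists>s. is_lift s (ball z r) \<and> s y = x'" using is_lift_subset by blast
  qed
  then show ?thesis using r by blast
qed

text \<open>A lift over one set is continued from a point of the overlap with trivial stabiliser;
  connectedness of the overlap makes both lifts agree on all of it.\<close>

lemma liftable_Un:
  assumes A: "open A" "liftable A" and B: "open B" "liftable B" and AB: "connected (A \<inter> B)" "A \<inter> B \<noteq> {}"
  shows "liftable (A \<union> B)"
proof -
  have *: "\<exists>s. is_lift s (A \<union> B) \<and> s z = x"
    if A: "open A" "liftable A" and B: "open B" "liftable B" and AB: "connected (A \<inter> B)" "A \<inter> B \<noteq> {}"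
      and z: "z \<in> A" "rot_ord z = 1" "norm x = 1" "f x = p z" for A B z x
  proof -
    obtain s where s: "is_lift s A" "s z = x" using A(2) z unfolding liftable_def by blast
    obtain w where w: "w \<in> A \<inter> B" "rot_ord w = 1" using generic_point[of "A \<inter> B"] A(1) B(1) AB(2) by blast
    have "norm (s w) = 1" "f (s w) = p w" using s(1) w by (auto simp: is_lift_def)
    then obtain s' where s': "is_lift s' B" "s' w = s w" using B(2) w unfolding liftable_def by blast
    have eq: "s y = s' y" if "y \<in> A \<inter> B" for y
      by (rule lift_unique[of "A \<inter> B" s s' w]) (use A B AB s s' w that is_lift_subset in auto)
    define t where "t = (\<lambda>y. if y \<in> A then s y else s' y)"
    have tA: "t y = s y" if "y \<in> A" for y using that by (simp add: t_def)
    have tB: "t y = s' y" if "y \<in> B" for y using that eq by (simp add: t_def)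
    have "continuous_on A t" using s(1) tA by (simp add: is_lift_def cong: continuous_on_cong)
    moreover have "continuous_on B t" using s'(1) tB by (simp add: is_lift_def cong: continuous_on_cong)
    ultimately have "continuous_on (A \<union> B) t" using A(1) B(1) by (intro continuous_on_open_Un)
    then have "is_lift t (A \<union> B)" using s(1) s'(1) tA tB by (auto simp: is_lift_def)
    then show ?thesis using tA[OF z(1)] s(2) by blast
  qed
  show ?thesis
    unfolding liftable_def
  proof (intro ballI impI allI)
    fix z x assume z: "z \<in> A \<union> B" "rot_ord z = 1" "norm x = 1" "f x = p z"
    show "\<exists>s. is_lift s (A \<union> B) \<and> s z = x"
    proof (cases "z \<in> A")
      case True
      then show ?thesis using *[OF A B AB] z by blast
    next
      case False
      then have "z \<in> B" using z by blast
      then show ?thesis using *[OF B A, of z x] AB z by (simp add: Int_commute Un_commute)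
    qed
  qed
qed

lemma liftable_translate:
  assumes "liftable W" "\<gamma> \<in> gauss_ints"
  shows "liftable ((\<lambda>z. z + \<gamma>) -` W)"
  unfolding liftable_def
proof (intro ballI impI allI)
  fix z x assume z: "z \<in> (\<lambda>z. z + \<gamma>) -` W" "rot_ord z = 1" "norm x = 1" "f x = p z"
  have pz: "p (z + \<gamma>) = p z" using assms(2) by (rule p_add)
  then have "rot_ord (z + \<gamma>) = 1" using rot_ord_p z(2) by metis
  then obtain s where s: "is_lift s W" "s (z + \<gamma>) = x"
    using assms(1)[unfolded liftable_def, rule_format, of "z + \<gamma>" x] z pz by auto
  have "is_lift (\<lambda>y. s (y + \<gamma>)) ((\<lambda>z. z + \<gamma>) -` W)"
    unfolding is_lift_def
  proof (intro conjI ballI)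
    have "continuous_on W s" using s(1) by (simp add: is_lift_def)
    then show "continuous_on ((\<lambda>z. z + \<gamma>) -` W) (\<lambda>y. s (y + \<gamma>))"
      by (rule continuous_on_compose2) (auto intro!: continuous_intros)
  qed (use s(1) p_add[OF assms(2)] in \<open>auto simp: is_lift_def\<close>)
  then show "\<exists>s. is_lift s ((\<lambda>z. z + \<gamma>) -` W) \<and> s z = x" using s(2) by blast
qed

text \<open>The unit square has a Lebesgue number for the cover by liftable sets, and lattice
  translations bring every ball to a centre in the square.\<close>

lemma uniform_liftable: "\<exists>r>0. \<forall>z. liftable (ball z r)"
proof -
  let ?K = "cbox 0 (Complex 1 1)"
  let ?G = "{B. open B \<and> liftable B}"
  have "?K \<subseteq> \<Union>?G"
  proof
    fix z
    obtain r where "r > 0" "liftable (ball z r)" using local_liftable by blast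
    then show "z \<in> \<Union>?G" by (intro UnionI[of "ball z r"]) auto
  qed
  then obtain r where r: "r > 0" "\<And>z. z \<in> ?K \<Longrightarrow> \<exists>G\<in>?G. ball z r \<subseteq> G"
    using Heine_Borel_lemma[of ?K ?G] compact_cbox by blast
  have "liftable (ball z r)" for z
  proof -
    define \<gamma> where "\<gamma> = - Complex (of_int \<lfloor>Re z\<rfloor>) (of_int \<lfloor>Im z\<rfloor>)"
    have g: "\<gamma> \<in> gauss_ints" unfolding \<gamma>_def gauss_ints_uminus_iff by (simp add: gauss_ints_def)
    have "z + \<gamma> \<in> ?K" by (auto simp: \<gamma>_def in_cbox_complex_iff) linarith+
    then obtain G where G: "liftable G" "ball (z + \<gamma>) r \<subseteq> G" using r(2) by blast
    then have "liftable (ball (z + \<gamma>) r)" by (rule liftable_subset)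
    then have "liftable ((\<lambda>z. z + \<gamma>) -` ball (z + \<gamma>) r)" using g by (rule liftable_translate)
    moreover have "(\<lambda>z. z + \<gamma>) -` ball (z + \<gamma>) r = ball z r" by (auto simp: dist_norm)
    ultimately show ?thesis by simp
  qed
  then show ?thesis using r(1) by blast
qed

end

text \<open>After stereographic projection from one of the removed points, the claim is about a
  plane minus a finite set.\<close>

lemma connected_sphere_diff_finite:
  assumes "finite F"
  shows "connected (sphere (0 :: real^3) 1 - F)"
proof (cases "sphere 0 1 \<inter> F = {}")
  case True
  then have "sphere 0 1 - F = sphere (0 :: real^3) 1" by blast
  then show ?thesis by (simp add: connected_sphere)
next
  case False
  then obtain a where a: "a \<in> sphere 0 1" "a \<in> F" by blast
  have "(sphere 0 1 - {a}) homeomorphic (UNIV :: complex set)"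
    using homeomorphic_punctured_affine_sphere_affine[of 1 a 0 UNIV "UNIV :: complex set"] a
    by simp
  then obtain h k where hk: "homeomorphism (sphere 0 1 - {a}) (UNIV :: complex set) h k"
    by (auto simp: homeomorphic_def)
  let ?F = "F \<inter> (sphere 0 1 - {a})"
  have h: "k (h y) = y" if "y \<in> sphere 0 1 - {a}" for y using hk that by (simp add: homeomorphism_def)
  have k: "h (k w) = w" "k w \<in> sphere 0 1 - {a}" for w
    using hk homeomorphism_image2[OF hk] rangeI[of k w] by (simp_all only: homeomorphism_def UNIV_I)
  have "connected (UNIV - h ` ?F)"
    using assms by (intro connected_open_diff_countable) (auto intro: countable_finite)
  moreover have "continuous_on (UNIV - h ` ?F) k"
    using hk by (auto simp: homeomorphism_def intro: continuous_on_subset)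
  ultimately have "connected (k ` (UNIV - h ` ?F))"
    by (intro connected_continuous_image)
  moreover have "k ` (UNIV - h ` ?F) = sphere 0 1 - F"
  proof (intro equalityI subsetI)
    fix y assume "y \<in> k ` (UNIV - h ` ?F)"
    then obtain w where w: "w \<notin> h ` ?F" "y = k w" by blast
    have y: "y \<in> sphere 0 1 - {a}" "h y = w" using k w(2) by simp_all
    have "y \<notin> F"
    proof
      assume "y \<in> F"
      then have "h y \<in> h ` ?F" using y(1) by blast
      then show False using w(1) y(2) by simp
    qed
    then show "y \<in> sphere 0 1 - F" using y(1) by blast
  next
    fix y assume y: "y \<in> sphere 0 1 - F"
    then have ya: "y \<in> sphere 0 1 - {a}" using a by auto
    have "h y \<notin> h ` ?F"
    proof
      assume "h y \<in> h ` ?F"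
      then obtain y' where y': "y' \<in> ?F" "h y = h y'" by blast
      from arg_cong[OF y'(2), of k] have "y = y'" using h[OF ya] h[of y'] y'(1) by (simp only: Int_iff)
      then show False using y y'(1) by simp
    qed
    then have "k (h y) \<in> k ` (UNIV - h ` ?F)" by (intro imageI) simp
    then show "y \<in> k ` (UNIV - h ` ?F)" by (simp only: h[OF ya])
  qed
  ultimately show ?thesis by (simp only:)
qed

section \<open>Lifts over the whole plane\<close>

context orbifold_factor
begin

definition rect :: "real \<Rightarrow> real \<Rightarrow> real \<Rightarrow> real \<Rightarrow> complex set" where
  "rect a b c d = {z. a < Re z \<and> Re z < b \<and> c < Im z \<and> Im z < d}"

lemma rect_open: "open (rect a b c d)" and rect_connected: "connected (rect a b c d)"
proof -
  have "rect a b c d = box (Complex a c) (Complex b d)" by (auto simp: rect_def in_box_complex_iff)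
  then show "open (rect a b c d)" "connected (rect a b c d)" by (simp_all only: open_box convex_connected[OF convex_box(2)])
qed

lemma rect_nonempty: "a < b \<Longrightarrow> c < d \<Longrightarrow> rect a b c d \<noteq> {}"
proof -
  assume "a < b" "c < d"
  then have "Complex ((a + b) / 2) ((c + d) / 2) \<in> rect a b c d" by (simp add: rect_def)
  then show ?thesis by blast
qed

text \<open>Rectangles are used because their overlaps are again rectangles, hence connected.
  Squares of side \<open>2 * e\<close> are appended in steps of \<open>e\<close> to form rows, and
  rows are stacked in the same way; \<open>e = r / 4\<close> makes each square fit into a ball of
  radius \<open>r\<close>.\<close>

lemma liftable_rect: "\<exists>e>0. \<forall>a c n m. liftable (rect a (a + e * (real n + 1)) c (c + e * (real m + 1)))"
proof -
  obtain r where r: "r > 0" "\<And>z. liftable (ball z r)" using uniform_liftable by blast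
  define e where "e = r / 4"
  have e: "e > 0" using r by (simp add: e_def)
  have base: "liftable (rect a (a + 2 * e) c (c + 2 * e))" for a c
  proof (rule liftable_subset[OF r(2)])
    show "rect a (a + 2 * e) c (c + 2 * e) \<subseteq> ball (Complex (a + e) (c + e)) r"
    proof
      fix z assume z: "z \<in> rect a (a + 2 * e) c (c + 2 * e)"
      have "norm (z - Complex (a + e) (c + e)) \<le> \<bar>Re z - (a + e)\<bar> + \<bar>Im z - (c + e)\<bar>"
        using cmod_le[of "z - Complex (a + e) (c + e)"] by simp
      also have "\<dots> < e + e" using z by (intro add_strict_mono) (auto simp: rect_def abs_less_iff)
      also have "\<dots> < r" using r by (simp add: e_def)
      finally show "z \<in> ball (Complex (a + e) (c + e)) r" by (simp add: dist_norm norm_minus_commute)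
    qed
  qed
  have row: "liftable (rect a (a + e * (real n + 1)) c (c + 2 * e))" for a c n
  proof (induction n)
    case 0
    show ?case by (rule liftable_subset[OF base[of a c]]) (use e in \<open>auto simp: rect_def\<close>)
  next
    case (Suc n)
    define t where "t = e * real n"
    have t: "t \<ge> 0" "e * (real n + 1) = t + e" "e * (real (Suc n) + 1) = t + 2 * e"
      using e by (simp_all add: t_def algebra_simps)
    let ?A = "rect a (a + (t + e)) c (c + 2 * e)"
    let ?B = "rect (a + t) ((a + t) + 2 * e) c (c + 2 * e)"
    have I: "?A \<inter> ?B = rect (a + t) (a + (t + e)) c (c + 2 * e)"
      using t(1) e by (auto simp: rect_def)
    have IH: "liftable ?A" using Suc unfolding t(2) .
    have "liftable (?A \<union> ?B)"
    proof (rule liftable_Un[OF rect_open IH rect_open base])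
      show "connected (?A \<inter> ?B)" unfolding I by (rule rect_connected)
      show "?A \<inter> ?B \<noteq> {}" unfolding I by (rule rect_nonempty) (use e in auto)
    qed
    then show ?case unfolding t(3)
      by (rule liftable_subset) (use t(1) e in \<open>auto simp: rect_def\<close>)
  qed
  have "liftable (rect a (a + e * (real n + 1)) c (c + e * (real m + 1)))" for a c n m
  proof (induction m)
    case 0
    show ?case by (rule liftable_subset[OF row[of a n c]]) (use e in \<open>auto simp: rect_def\<close>)
  next
    case (Suc m)
    define t where "t = e * real m"
    have t: "t \<ge> 0" "e * (real m + 1) = t + e" "e * (real (Suc m) + 1) = t + 2 * e"
      using e by (simp_all add: t_def algebra_simps)
    let ?b = "a + e * (real n + 1)"
    let ?A = "rect a ?b c (c + (t + e))"
    let ?B = "rect a ?b (c + t) ((c + t) + 2 * e)"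
    have ab: "a < ?b" using e by (simp add: add_nonneg_pos)
    have I: "?A \<inter> ?B = rect a ?b (c + t) (c + (t + e))"
      using t(1) e by (auto simp: rect_def)
    have IH: "liftable ?A" using Suc unfolding t(2) .
    have "liftable (?A \<union> ?B)"
    proof (rule liftable_Un[OF rect_open IH rect_open row])
      show "connected (?A \<inter> ?B)" unfolding I by (rule rect_connected)
      show "?A \<inter> ?B \<noteq> {}" unfolding I by (rule rect_nonempty) (use e ab in auto)
    qed
    then show ?case unfolding t(3)
      by (rule liftable_subset) (use t(1) e in \<open>auto simp: rect_def\<close>)
  qed
  then show ?thesis using e by blast
qed

text \<open>The plane is exhausted by squares. Lifts over them with the same value at
  \<open>z\<close> are restrictions of one another by uniqueness; the offset \<open>m\<close>
  ensures that every square used contains \<open>z\<close>.\<close>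

lemma global_lift:
  assumes z: "rot_ord z = 1" "norm x = 1" "f x = p z"
  obtains s where "is_lift s UNIV" "s z = x"
proof -
  obtain e where e: "e > 0" "\<And>a c n m. liftable (rect a (a + e * (real n + 1)) c (c + e * (real m + 1)))"
    using liftable_rect by blast
  define B where "B = (\<lambda>n. rect (- (e * real (n + 1))) (e * real (n + 1)) (- (e * real (n + 1))) (e * real (n + 1)))"
  have Bl: "liftable (B n)" for n
    using e(2)[of "- (e * real (n + 1))" "2 * n + 1" "- (e * real (n + 1))" "2 * n + 1"]
    by (simp add: B_def algebra_simps)
  have B_mono: "B m \<subseteq> B n" if "m \<le> n" for m n
  proof -
    have "e * real (m + 1) \<le> e * real (n + 1)" using that e(1) by (intro mult_left_mono) auto
    then show ?thesis by (auto simp: B_def rect_def)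
  qed
  have B_ex: "\<exists>n. w \<in> B n" for w
  proof -
    obtain n where n: "norm w / e < real n" using reals_Archimedean2 by blast
    then have "norm w < e * real n" using e(1) by (simp add: field_simps)
    also have "\<dots> \<le> e * real (n + 1)" using e(1) by (intro mult_left_mono) auto
    finally have "norm w < e * real (n + 1)" .
    then have "\<bar>Re w\<bar> < e * real (n + 1)" "\<bar>Im w\<bar> < e * real (n + 1)"
      using abs_Re_le_cmod[of w] abs_Im_le_cmod[of w] by linarith+
    then show ?thesis by (intro exI[of _ n]) (auto simp: B_def rect_def abs_less_iff)
  qed
  obtain m where m: "z \<in> B m" using B_ex by blast
  have "\<exists>s. is_lift s (B (m + n)) \<and> s z = x" for n
    using Bl[of "m + n"] B_mono[of m "m + n"] m z unfolding liftable_def by auto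
  then have "\<forall>n. \<exists>s. is_lift s (B (m + n)) \<and> s z = x" by blast
  from choice[OF this] obtain s where s: "\<And>n. is_lift (s n) (B (m + n))" "\<And>n. s n z = x" by blast
  have agree: "s n w = s n' w" if "w \<in> B (m + n)" "n \<le> n'" for n n' w
  proof (rule lift_unique[of "B (m + n)" _ _ z])
    show "is_lift (s n') (B (m + n))" using is_lift_subset[OF s(1)] B_mono that(2) by simp
    show "z \<in> B (m + n)" using m B_mono[of m "m + n"] by auto
  qed (use s z that in \<open>auto simp: B_def rect_open rect_connected\<close>)
  define N where "N = (\<lambda>w. LEAST n. w \<in> B (m + n))"
  define S where "S = (\<lambda>w. s (N w) w)"
  have BN: "w \<in> B (m + N w)" for w
  proof -
    obtain n where "w \<in> B n" using B_ex by blast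
    then have "w \<in> B (m + n)" using B_mono[of n "m + n"] by auto
    then show ?thesis unfolding N_def by (rule LeastI)
  qed
  have S_eq: "S w = s n w" if "w \<in> B (m + n)" for w n
  proof -
    have "N w \<le> n" unfolding N_def using that by (rule Least_le)
    then show ?thesis using agree[OF BN] by (simp add: S_def)
  qed
  have "continuous_on (\<Union>n. B (m + n)) S"
  proof (rule continuous_on_open_UN)
    fix n
    show "open (B (m + n))" by (simp add: B_def rect_open)
    have "continuous_on (B (m + n)) (s n)" using s(1) by (simp add: is_lift_def)
    then show "continuous_on (B (m + n)) S" using S_eq by (simp cong: continuous_on_cong)
  qed
  moreover have "(\<Union>n. B (m + n)) = UNIV" using BN by blast
  moreover have "norm (S w) = 1 \<and> f (S w) = p w" for w
    using s(1)[of "N w"] BN[of w] by (auto simp: is_lift_def S_def)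
  ultimately have "is_lift S UNIV" by (simp add: is_lift_def)
  moreover have "S z = x" using s(2) by (simp add: S_def)
  ultimately show thesis by (rule that)
qed

lemma global_lift_unique:
  assumes "is_lift s UNIV" "is_lift s' UNIV" "rot_ord z = 1" "s z = s' z"
  shows "s = s'"
proof (rule ext)
  fix w
  show "s w = s' w"
    by (rule lift_unique[OF open_UNIV connected_UNIV assms(1,2) UNIV_I assms(3,4) UNIV_I])
qed

lemma lift_shift:
  assumes "is_lift s UNIV" "l \<in> gauss_ints"
  shows "is_lift (\<lambda>z. s (z + l)) UNIV"
  unfolding is_lift_def
proof (intro conjI ballI)
  have "continuous_on UNIV s" using assms(1) by (simp add: is_lift_def)
  then show "continuous_on UNIV (\<lambda>z. s (z + l))"
    by (rule continuous_on_compose2) (auto intro!: continuous_intros)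
qed (use assms(1) p_add[OF assms(2)] in \<open>auto simp: is_lift_def\<close>)

lemma lift_in_fibre: "is_lift s UNIV \<Longrightarrow> p z = p w \<Longrightarrow> s z \<in> fibre S2 f (p w)"
  by (simp add: is_lift_def fibre_def)

text \<open>Without the points over cone points the source remains a connected set \<open>X\<close>.
  The range of \<open>s\<close> is compact: a translate of \<open>s\<close> is determined by its
  value in one finite fibre, so there are finitely many, and their restrictions to the unit square
  cover the range. Within \<open>X\<close> the range is open, because \<open>f\<close> is locally
  injective there and \<open>p\<close> is open.\<close>

lemma lift_surj:
  assumes s: "is_lift s UNIV" and x: "norm x = 1" "f x = p w" "rot_ord w = 1"
  shows "x \<in> range s"
proof -
  let ?K = "cbox 0 (Complex 1 1)"
  let ?c = "(1 + \<i>) / 2 :: complex" and ?h = "1 / 2 :: complex"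
  define X where "X = sphere 0 1 - (fibre S2 f (p 0) \<union> fibre S2 f (p ?c) \<union> fibre S2 f (p ?h))"
  have X: "connected X" unfolding X_def by (intro connected_sphere_diff_finite) (simp add: f_fin)
  have X_iff: "y \<in> X \<longleftrightarrow> norm y = 1 \<and> rot_ord z = 1" if "norm y = 1" "f y = p z" for y z
  proof -
    have "y \<in> X \<longleftrightarrow> p z \<noteq> p 0 \<and> p z \<noteq> p ?c \<and> p z \<noteq> p ?h"
      using that by (auto simp: X_def fibre_def)
    also have "\<dots> \<longleftrightarrow> rot_ord z = 1"
    proof
      assume *: "p z \<noteq> p 0 \<and> p z \<noteq> p ?c \<and> p z \<noteq> p ?h"
      have "\<not> (gauss_rel 0 z \<or> gauss_rel ?c z)" "\<not> gauss_rel ?h z"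
        using * by (simp_all only: p_eq[symmetric]) auto
      then have "rot_ord z \<noteq> 4" "rot_ord z \<noteq> 2" using rot_ord_4 rot_ord_2 by blast+
      then show "rot_ord z = 1" using rot_ord_cases[of z] by blast
    next
      assume "rot_ord z = 1"
      then show "p z \<noteq> p 0 \<and> p z \<noteq> p ?c \<and> p z \<noteq> p ?h"
        using rot_ord_p[of z 0] rot_ord_p[of z ?c] rot_ord_p[of z ?h] by auto
    qed
    finally show ?thesis using that by simp
  qed
  have sp: "norm (s z) = 1" "f (s z) = p z" for z using s by (auto simp: is_lift_def)
  have s_cont: "continuous_on UNIV s" using s by (simp add: is_lift_def)
  define G where "G = (\<lambda>l. (\<lambda>z. s (z + l))) ` gauss_ints"
  have G_lift: "is_lift t UNIV" if "t \<in> G" for t using that lift_shift[OF s] by (auto simp: G_def)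
  obtain w0 where w0: "rot_ord w0 = 1" using generic_point[OF open_UNIV] by blast
  have "finite ((\<lambda>t. t w0) ` G)"
    using f_fin[of w0] by (rule finite_subset[rotated]) (use lift_in_fibre G_lift in blast)
  moreover have "inj_on (\<lambda>t. t w0) G"
    using global_lift_unique[OF G_lift G_lift w0] by (intro inj_onI) blast
  ultimately have G_fin: "finite G" by (rule finite_imageD)
  have "range s = (\<Union>t\<in>G. t ` ?K)"
  proof (intro equalityI subsetI)
    fix y assume "y \<in> range s"
    then obtain z where z: "y = s z" by blast
    define l where "l = Complex (of_int \<lfloor>Re z\<rfloor>) (of_int \<lfloor>Im z\<rfloor>)"
    have g: "l \<in> gauss_ints" by (simp add: l_def gauss_ints_def)
    have K: "z - l \<in> ?K" by (auto simp: l_def in_cbox_complex_iff) linarith+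
    have "y = (\<lambda>z. s (z + l)) (z - l)" using z by simp
    then have "y \<in> (\<lambda>z. s (z + l)) ` ?K" using K by (rule image_eqI)
    then show "y \<in> (\<Union>t\<in>G. t ` ?K)" using g unfolding G_def by blast
  next
    fix y assume "y \<in> (\<Union>t\<in>G. t ` ?K)"
    then show "y \<in> range s" by (auto simp: G_def)
  qed
  moreover have "compact (t ` ?K)" if "t \<in> G" for t
    using G_lift[OF that]
    by (intro compact_continuous_image compact_cbox) (auto simp: is_lift_def intro: continuous_on_subset)
  ultimately have "compact (range s)" using G_fin by (simp add: compact_UN)
  then have "closedin (top_of_set X) (X \<inter> range s)"
    by (intro closedin_closed_Int compact_imp_closed)
  moreover have "openin (top_of_set X) (X \<inter> range s)"
  proof (subst openin_subopen, intro ballI)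
    fix y assume y: "y \<in> X \<inter> range s"
    then obtain z where z: "y = s z" by blast
    then have z1: "rot_ord z = 1" using y X_iff[OF sp] by auto
    obtain T where T: "open T" "s z \<in> T" "inj_on f (sphere 0 1 \<inter> T)"
      by (rule f_generic_inj[OF sp z1])
    have "open (s -` T)" using s_cont T(1) by (intro open_vimage)
    then have "openin S2 (p ` (s -` T))" by (rule p_open)
    then obtain T' where T': "open T'" "p ` (s -` T) = sphere 0 1 \<inter> T'" by (auto simp: openin_open)
    have "continuous_on X f" using f_cont by (rule continuous_on_subset) (auto simp: X_def)
    then have "openin (top_of_set X) (X \<inter> f -` T')" using T'(1) continuous_openin_preimage_eq by blast
    moreover have "openin (top_of_set X) (X \<inter> T)" using T(1) by (rule openin_open_Int)
    ultimately have "openin (top_of_set X) ((X \<inter> f -` T') \<inter> (X \<inter> T))" by (rule openin_Int)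
    moreover have "p z \<in> T'" using T' T(2) by blast
    then have "y \<in> (X \<inter> f -` T') \<inter> (X \<inter> T)" using y z sp T(2) by auto
    moreover have "(X \<inter> f -` T') \<inter> (X \<inter> T) \<subseteq> X \<inter> range s"
    proof
      fix y' assume y': "y' \<in> (X \<inter> f -` T') \<inter> (X \<inter> T)"
      then have n: "norm y' = 1" by (auto simp: X_def)
      then have "f y' \<in> sphere 0 1 \<inter> T'" using y' f_in by auto
      then obtain z' where z': "s z' \<in> T" "f y' = p z'" unfolding T'(2)[symmetric] by blast
      have "f y' = f (s z')" using z' sp by simp
      then have "y' = s z'" by (rule inj_onD[OF T(3)]) (use y' n z' sp in auto)
      then show "y' \<in> X \<inter> range s" using y' by blast
    qed
    ultimately show "\<exists>T. openin (top_of_set X) T \<and> y \<in> T \<and> T \<subseteq> X \<inter> range s" by blast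
  qed
  moreover have "s w0 \<in> X \<inter> range s" using X_iff[OF sp, of w0] w0 sp by simp
  ultimately have "X \<inter> range s = X" using X unfolding connected_clopen by blast
  moreover have "x \<in> X" using X_iff[OF x(1,2)] x by simp
  ultimately show ?thesis by blast
qed

text \<open>An unramified point over a cone point of order 4 gives a lift invariant under the rotation
  by \<open>\<i>\<close>; its periods then form an ideal of the Gaussian integers.\<close>

theorem degree_is_gauss_norm:
  assumes x0: "norm x0 = 1" "f x0 = p 0" "has_local_degree S2 S2 f x0 1"
    and w0: "rot_ord w0 = 1"
  obtains \<mu> where "\<mu> \<in> gauss_ints" "(norm \<mu>)\<^sup>2 = real (card (fibre S2 f (p w0)))"
proof -
  \<comment> \<open>The point 0 is a cone point and cannot serve as a starting point for
    \<open>global_lift\<close>. A local lift with value \<open>x0\<close> at 0 is taken first and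
    then continued from a nearby point \<open>w\<close> with trivial stabiliser.\<close>
  obtain U r where Ur: "r > 0" "x0 \<in> U"
    "\<forall>\<zeta>\<in>ball 0 r. \<forall>x'\<in>U. f x' = p \<zeta> \<longrightarrow> (\<exists>s. is_lift s (ball 0 r) \<and> s \<zeta> = x')"
    using local_liftable_at[OF x0(1,2)] by blast
  have "0 \<in> ball 0 r" using Ur(1) by simp
  then obtain s0 where s0: "is_lift s0 (ball 0 r)" "s0 0 = x0" using Ur x0(2) by blast
  obtain w where w: "w \<in> ball 0 r" "rot_ord w = 1" using generic_point[of "ball 0 r"] Ur(1) by auto
  have "norm (s0 w) = 1" "f (s0 w) = p w" using s0(1) w(1) by (simp_all add: is_lift_def)
  then obtain s where s: "is_lift s UNIV" "s w = s0 w" using global_lift[OF w(2)] by blast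
  have "s 0 = s0 0"
    by (rule lift_unique[of "ball 0 r" s s0 w]) (use s s0 w Ur(1) is_lift_subset in auto)
  then have s_0: "s 0 = x0" using s0(2) by simp
  have sp: "norm (s z) = 1" "f (s z) = p z" for z using s(1) by (auto simp: is_lift_def)
  have s_cont: "continuous_on UNIV s" using s(1) by (simp add: is_lift_def)
  have i4: "\<i> ^ 4 = 1" by (simp add: power4_eq_xxxx)
  have si_lift: "is_lift (\<lambda>z. s (\<i> * z)) UNIV"
    unfolding is_lift_def
  proof (intro conjI ballI)
    show "continuous_on UNIV (\<lambda>z. s (\<i> * z))"
      by (rule continuous_on_compose2[OF s_cont]) (auto intro!: continuous_intros)
  qed (use sp p_mult[OF i4] in auto)
  \<comment> \<open>Both \<open>s\<close> and its rotation have the value \<open>x0\<close> at 0,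
    and \<open>f\<close> is injective near \<open>x0\<close>; they agree near 0, in particular at
    some \<open>v\<close> with trivial stabiliser, hence everywhere.\<close>
  obtain T where T: "open T" "x0 \<in> T" "inj_on f (sphere 0 1 \<inter> T)"
    by (rule f_local_inj[OF x0(3)])
  have "open (s -` T \<inter> (\<lambda>z. s (\<i> * z)) -` T)"
    using s_cont si_lift T(1) by (intro open_Int open_vimage) (auto simp: is_lift_def)
  moreover have "0 \<in> s -` T \<inter> (\<lambda>z. s (\<i> * z)) -` T" using s_0 T(2) by simp
  ultimately obtain v where v: "v \<in> s -` T \<inter> (\<lambda>z. s (\<i> * z)) -` T" "rot_ord v = 1"
    using generic_point by blast
  have "f (s v) = f (s (\<i> * v))" using sp p_mult[OF i4] by simp
  then have "s v = s (\<i> * v)" by (rule inj_onD[OF T(3)]) (use v sp in auto)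
  then have "s = (\<lambda>z. s (\<i> * z))" by (rule global_lift_unique[OF s(1) si_lift v(2)])
  then have s_i: "s (\<i> * z) = s z" for z by (metis (mono_tags))
  have s_unit: "s (u * z) = s z" if "u ^ 4 = 1" for u z
  proof -
    have "s (- 1 * z) = s z" using s_i[of "\<i> * z"] s_i[of z] by simp
    moreover have "s (- \<i> * z) = s z" using s_i[of "- z"] calculation by simp
    ultimately show ?thesis using unit_cases[OF that] s_i[of z] by (elim disjE) simp_all
  qed
  define L where "L = {l \<in> gauss_ints. \<forall>z. s (z + l) = s z}"
  have L_per: "s (z + l) = s z" if "l \<in> L" for z l using that by (simp add: L_def)
  have L_diff: "l - l' \<in> L" if "l \<in> L" "l' \<in> L" for l l'
  proof -
    have "s (z + (l - l')) = s z" for z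
    proof -
      have "s (z + (l - l')) = s ((z - l') + l)" by (simp add: algebra_simps)
      also have "\<dots> = s ((z - l') + l')" by (simp only: L_per[OF that(1)] L_per[OF that(2)])
      finally show ?thesis by simp
    qed
    then show ?thesis using that by (simp add: L_def)
  qed
  have L_0: "0 \<in> L" by (simp add: L_def)
  have L_add: "l + l' \<in> L" if "l \<in> L" "l' \<in> L" for l l'
    using L_diff[OF that(1) L_diff[OF L_0 that(2)]] by simp
  have L_i: "\<i> * l \<in> L" if "l \<in> L" for l
  proof -
    have "s (z + \<i> * l) = s z" for z
    proof -
      have "z + \<i> * l = \<i> * (- \<i> * z + l)" by (simp add: algebra_simps)
      then have "s (z + \<i> * l) = s (- \<i> * z + l)" by (simp only: s_i)
      also have "\<dots> = s (- \<i> * z)" by (rule L_per[OF that])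
      also have "\<dots> = s z" by (rule s_unit) (simp add: power4_eq_xxxx)
      finally show ?thesis .
    qed
    then show ?thesis using that by (simp add: L_def)
  qed
  have L_nat: "of_nat n * l \<in> L" if "l \<in> L" for n l
    by (induction n) (use that L_0 L_add in \<open>auto simp: distrib_right\<close>)
  have L_int: "of_int n * l \<in> L" if "l \<in> L" for n l
  proof (cases n)
    case (nonneg m)
    then show ?thesis using L_nat[OF that] by simp
  next
    case (neg m)
    have "of_int n * l = 0 - of_nat (Suc m) * l" by (simp add: neg algebra_simps)
    then show ?thesis using L_diff[OF L_0 L_nat[OF that, of "Suc m"]] by (simp only:)
  qed
  have L_mult: "q * l \<in> L" if k: "q \<in> gauss_ints" and g: "l \<in> L" for q l
  proof -
    obtain a b :: int where "q = Complex (of_int a) (of_int b)" using k gauss_ints_iff by blast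
    then have "q * l = of_int a * l + \<i> * (of_int b * l)"
      by (simp add: complex_eq_iff)
    then show ?thesis using L_add[OF L_int[OF g] L_i[OF L_int[OF g]]] by simp
  qed
  have L_iff: "s (w0 + l) = s (w0 + l') \<longleftrightarrow> l - l' \<in> L" if g: "l \<in> gauss_ints" "l' \<in> gauss_ints" for l l'
  proof
    assume "s (w0 + l) = s (w0 + l')"
    then have eq: "(\<lambda>z. s (z + l)) = (\<lambda>z. s (z + l'))"
      by (rule global_lift_unique[OF lift_shift[OF s(1) g(1)] lift_shift[OF s(1) g(2)] w0])
    have "s (z + (l - l')) = s z" for z
      using fun_cong[OF eq, of "z - l'"] by (simp add: algebra_simps)
    then show "l - l' \<in> L" using g by (simp add: L_def)
  next
    assume "l - l' \<in> L"
    then have "s ((w0 + l') + (l - l')) = s (w0 + l')" by (rule L_per)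
    then show "s (w0 + l) = s (w0 + l')" by simp
  qed
  have fib: "s (w0 + l) \<in> fibre S2 f (p w0)" if "l \<in> gauss_ints" for l
    using lift_in_fibre[OF s(1)] p_add[OF that] by blast
  \<comment> \<open>Without a nonzero period the infinite lattice would embed into a finite
    fibre.\<close>
  have nz: "\<exists>l\<in>L. l \<noteq> 0"
  proof (rule ccontr)
    assume no: "\<not> ?thesis"
    have "inj_on (\<lambda>l. s (w0 + l)) gauss_ints"
    proof (rule inj_onI)
      fix l l' assume "l \<in> gauss_ints" "l' \<in> gauss_ints" "s (w0 + l) = s (w0 + l')"
      then have "l - l' \<in> L" using L_iff by blast
      then have "l - l' = 0" using no by blast
      then show "l = l'" by simp
    qed
    moreover have "finite ((\<lambda>l. s (w0 + l)) ` gauss_ints)"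
      using f_fin[of w0] by (rule finite_subset[rotated]) (use fib in blast)
    ultimately show False using infinite_gauss_ints finite_imageD by blast
  qed
  have L_sub: "L \<subseteq> gauss_ints" by (auto simp: L_def)
  obtain \<mu> where \<mu>: "\<mu> \<in> L" "\<mu> \<noteq> 0" "L = (\<lambda>q. \<mu> * q) ` gauss_ints"
    by (rule gauss_principal[OF L_sub nz L_diff L_mult]; (assumption | rule that))
  have \<mu>g: "\<mu> \<in> gauss_ints" using \<mu>(1) L_sub by blast
  then obtain n :: nat where n: "(norm \<mu>)\<^sup>2 = real n" using norm_gauss_ints_sq by blast
  obtain D where D: "finite D" "card D = n" "D \<subseteq> gauss_ints"
    "\<And>l. l \<in> gauss_ints \<Longrightarrow> \<exists>\<delta>\<in>D. \<exists>q\<in>gauss_ints. l = \<delta> + \<mu> * q"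
    "\<And>\<delta> \<delta>' q. \<delta> \<in> D \<Longrightarrow> \<delta>' \<in> D \<Longrightarrow> q \<in> gauss_ints \<Longrightarrow> \<delta> = \<delta>' + \<mu> * q \<Longrightarrow> \<delta> = \<delta>'"
    by (rule gauss_residues[OF \<mu>g \<mu>(2) n]) (rule that)
  have "bij_betw (\<lambda>\<delta>. s (w0 + \<delta>)) D (fibre S2 f (p w0))"
  proof (rule bij_betw_imageI)
    show "inj_on (\<lambda>\<delta>. s (w0 + \<delta>)) D"
    proof (rule inj_onI)
      fix \<delta> \<delta>' assume d: "\<delta> \<in> D" "\<delta>' \<in> D" "s (w0 + \<delta>) = s (w0 + \<delta>')"
      have "\<delta> - \<delta>' \<in> L" using L_iff[of \<delta> \<delta>'] d D(3) by blast
      then obtain q where k: "q \<in> gauss_ints" "\<delta> - \<delta>' = \<mu> * q" unfolding \<mu>(3) by blast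
      then have "\<delta> = \<delta>' + \<mu> * q" by (simp add: algebra_simps)
      then show "\<delta> = \<delta>'" by (rule D(5)[OF d(1,2) k(1)])
    qed
    show "(\<lambda>\<delta>. s (w0 + \<delta>)) ` D = fibre S2 f (p w0)"
    proof (intro equalityI subsetI)
      fix x assume "x \<in> fibre S2 f (p w0)"
      then have x: "norm x = 1" "f x = p w0" by (auto simp: fibre_def)
      obtain z where z: "x = s z" using lift_surj[OF s(1) x w0] by blast
      then have "p w0 = p z" using sp x(2) by simp
      then obtain u l where u: "u ^ 4 = 1" "l \<in> gauss_ints" "z = u * w0 + l"
        by (auto simp: p_eq gauss_rel_def)
      \<comment> \<open>The unit is pulled out in front, where the invariance of \<open>s\<close>
        under rotations discards it; the point of the fibre is thus reached by a translation of
        \<open>w0\<close>.\<close>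
      have "z = u * w0 + u ^ 4 * l" using u by simp
      also have "\<dots> = u * (w0 + u ^ 3 * l)" by (simp add: power3_eq_cube power4_eq_xxxx algebra_simps)
      finally have "x = s (w0 + u ^ 3 * l)" using z s_unit[OF u(1)] by simp
      moreover have ug: "u ^ 3 * l \<in> gauss_ints" using u by blast
      moreover obtain \<delta> q where \<delta>: "\<delta> \<in> D" "q \<in> gauss_ints" "u ^ 3 * l = \<delta> + \<mu> * q" using D(4)[OF ug] by blast
      moreover have "\<mu> * q \<in> L" by (subst \<mu>(3)) (rule imageI[OF \<delta>(2)])
      then have "u ^ 3 * l - \<delta> \<in> L" by (simp add: \<delta>(3))
      moreover have "\<delta> \<in> gauss_ints" using \<delta>(1) D(3) by blast
      ultimately have "x = s (w0 + \<delta>)" using L_iff[of "u ^ 3 * l" \<delta>] by simp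
      then show "x \<in> (\<lambda>\<delta>. s (w0 + \<delta>)) ` D" using \<delta>(1) by blast
    next
      fix x assume "x \<in> (\<lambda>\<delta>. s (w0 + \<delta>)) ` D"
      then show "x \<in> fibre S2 f (p w0)" using fib D(3) by blast
    qed
  qed
  then have "card (fibre S2 f (p w0)) = n" using bij_betw_same_card D(2) by metis
  then show thesis using that \<mu>g n by simp
qed

end

section \<open>The equivalence\<close>

lemma exists_square_orbifold: "\<exists>p. square_orbifold p"
proof -
  have "axis 1 1 \<noteq> (axis 2 1 :: real^3)" "axis 1 1 \<noteq> (axis 3 1 :: real^3)" "axis 2 1 \<noteq> (axis 3 1 :: real^3)"
    by (simp_all add: axis_eq_axis)
  then obtain p :: "complex \<Rightarrow> real^3" where "continuous_on UNIV p" "range p = sphere 0 1"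
    "\<And>z w. p z = p w \<longleftrightarrow> gauss_rel z w"
    by (rule square_orbifold_map[of "axis 1 1" "axis 2 1" "axis 3 1", rotated 3]) (simp_all add: norm_axis_1)
  then show ?thesis by (intro exI[of _ p] square_orbifold.intro)
qed

text \<open>The quotient charts of \<open>p_chart\<close> also serve as manifold charts of the
  sphere.\<close>

lemma closed_connected_surface_S2: "closed_connected_surface S2"
  unfolding closed_connected_surface_def
proof (intro conjI ballI)
  obtain p where "square_orbifold p" using exists_square_orbifold by blast
  then interpret square_orbifold p .
  show "topspace S2 \<noteq> {}" using p_range by auto
  show "compact_space S2" by (simp add: compact_space_subtopology)
  have "connectedin euclidean (sphere (0 :: real^3) 1)" by (simp add: connected_sphere)
  then show "connected_space S2" by (simp add: connectedin_def)
  show "Hausdorff_space S2" by (simp add: Hausdorff_space_subtopology)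
  fix x assume "x \<in> topspace S2"
  then obtain z where z: "x = p z" using p_surj by auto
  obtain r where r: "r > 0"
    "\<And>h h'. norm h < r \<Longrightarrow> norm h' < r \<Longrightarrow> p (z + h) = p (z + h') \<longleftrightarrow> h ^ rot_ord z = h' ^ rot_ord z"
    using p_local by blast
  let ?U = "p ` (\<lambda>h. z + 1 * h) ` ball 0 r"
  obtain \<phi> where \<phi>: "openin S2 ?U" "homeomorphic_map (subtopology S2 ?U) (euclidean :: complex topology) \<phi>"
    by (rule p_chart[of 1 r "rot_ord z" z]) (use r in auto)
  have "subtopology S2 ?U homeomorphic_space top_of_set (UNIV :: complex set)"
    using homeomorphic_map_imp_homeomorphic_space[OF \<phi>(2)] by simp
  moreover have "z + 1 * 0 \<in> (\<lambda>h. z + 1 * h) ` ball 0 r" using r(1) by (intro imageI) simp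
  then have "x \<in> ?U" using z by auto
  ultimately show "\<exists>U (W :: complex set). openin S2 U \<and> x \<in> U \<and> open W \<and>
      subtopology S2 U homeomorphic_space top_of_set W"
    using \<phi>(1) open_UNIV by blast
qed

text \<open>\<open>mset_set\<close> of an infinite set is empty. This yields finiteness of the
  fibres over branching points, about which the definition of the degree is silent.\<close>

lemma local_degrees_over_nonempty:
  assumes "local_degrees_over X Y f y \<noteq> {#}"
  shows "finite (fibre X f y)"
  using assms unfolding local_degrees_over_def by (metis image_mset_empty mset_set.infinite)

lemma local_degrees_over_iff:
  assumes "finite (fibre X f y)"
  shows "k \<in># local_degrees_over X Y f y \<longleftrightarrow> (\<exists>x\<in>fibre X f y. local_degree X Y f x = k)"
  using assms by (auto simp: local_degrees_over_def)

text \<open>The cone point of order 2 is placed at the branching point with entries 2, those of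
  order 4 at the two with entries 4. Every local degree is then 1 or the cone order below it, and
  the entry 1 over \<open>p 0\<close> provides the unramified point \<open>x0\<close>.\<close>

lemma realizable_imp_sum_two_squares:
  assumes real: "realizable S2 S2 d {# replicate_mset (2 * k) 2 + {#1#}, replicate_mset k 4 + {#1#},
                 replicate_mset k 4 + {#1#} #}"
  shows "\<exists>x y :: nat. d = x\<^sup>2 + y\<^sup>2"
proof -
  let ?A = "replicate_mset (2 * k) 2 + {#1 :: nat#}" and ?C = "replicate_mset k 4 + {#1 :: nat#}"
  let ?B = "\<lambda>f. branching_points S2 S2 f" and ?l = "\<lambda>f. local_degrees_over S2 S2 f"
  obtain f where f: "branched_cover_of_degree S2 S2 f d" "finite (?B f)"
    and im: "image_mset (?l f) (mset_set (?B f)) = {# ?A, ?C, ?C #}"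
    using real unfolding realizable_def by blast
  obtain M1 y1 where 1: "mset_set (?B f) = add_mset y1 M1" "?l f y1 = ?A" "image_mset (?l f) M1 = {# ?C, ?C #}"
    using msed_map_invR[OF im] by blast
  obtain M2 y2 where 2: "M1 = add_mset y2 M2" "?l f y2 = ?C" "image_mset (?l f) M2 = {# ?C #}"
    using msed_map_invR[OF 1(3)] by blast
  obtain M3 y3 where 3: "M2 = add_mset y3 M3" "?l f y3 = ?C" "image_mset (?l f) M3 = {#}"
    using msed_map_invR[OF 2(3)] by blast
  have ms: "mset_set (?B f) = {#y1, y2, y3#}" using 1 2 3 by simp
  have B: "?B f = {y1, y2, y3}" using arg_cong[OF ms, of set_mset] f(2) by simp
  \<comment> \<open>The equal partitions still belong to different branching points, as
    \<open>mset_set\<close> lists each point once.\<close>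
  have "card {y1, y2, y3} = 3" using arg_cong[OF ms, of size] B by simp
  then have dist: "y1 \<noteq> y2" "y1 \<noteq> y3" "y2 \<noteq> y3" by (auto simp: card_insert_if split: if_splits)
  have yn: "norm y1 = 1" "norm y2 = 1" "norm y3 = 1"
    using B by (auto simp: branching_points_def)
  obtain p :: "complex \<Rightarrow> real^3" where p: "continuous_on UNIV p" "range p = sphere 0 1"
    "\<And>z w. p z = p w \<longleftrightarrow> gauss_rel z w" "p (1 / 2) = y1" "p ((1 + \<i>) / 2) = y2" "p 0 = y3"
    by (rule square_orbifold_map[OF yn dist]) (rule that)
  interpret square_orbifold p using p(1-3) by (rule square_orbifold.intro)
  have ld: "\<exists>k. has_local_degree S2 S2 f x k" if "norm x = 1" for x
    using f(1) that unfolding branched_cover_of_degree_def branched_cover_def by simp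
  have ld_eq: "has_local_degree S2 S2 f x (local_degree S2 S2 f x)" if "norm x = 1" for x
    using ld[OF that] local_degree_eq[of S2 S2 f x] by blast
  have B_iff: "p z \<in> ?B f \<longleftrightarrow> rot_ord z \<noteq> 1" for z
  proof
    assume "p z \<in> ?B f"
    then have "p z = p (1 / 2) \<or> p z = p ((1 + \<i>) / 2) \<or> p z = p 0" using B p(4-6) by auto
    then have "rot_ord z = rot_ord (1 / 2) \<or> rot_ord z = rot_ord ((1 + \<i>) / 2) \<or> rot_ord z = rot_ord 0"
      using rot_ord_p by blast
    then show "rot_ord z \<noteq> 1" by auto
  next
    assume "rot_ord z \<noteq> 1"
    then have "rot_ord z = 2 \<or> rot_ord z = 4" using rot_ord_cases[of z] by blast
    then have "gauss_rel (1 / 2) z \<or> gauss_rel 0 z \<or> gauss_rel ((1 + \<i>) / 2) z" using rot_ord_2 rot_ord_4 by blast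
    then have "p (1 / 2) = p z \<or> p 0 = p z \<or> p ((1 + \<i>) / 2) = p z" by (simp only: p_eq)
    then show "p z \<in> ?B f" unfolding B p(4-6) by auto
  qed
  have lp: "?l f (p z) = (if rot_ord z = 2 then ?A else ?C)" if "rot_ord z \<noteq> 1" for z
  proof (cases "rot_ord z = 2")
    case True
    then have "p (1 / 2) = p z" using rot_ord_2 p_eq by blast
    then show ?thesis using 1(2) p(4) True by simp
  next
    case False
    then have "rot_ord z = 4" using that rot_ord_cases[of z] by blast
    then have "p 0 = p z \<or> p ((1 + \<i>) / 2) = p z" using rot_ord_4 p_eq by blast
    then show ?thesis using 2(2) 3(2) p(5,6) False by auto
  qed
  have deg: "finite (fibre S2 f (p z)) \<and> card (fibre S2 f (p z)) = d" if "rot_ord z = 1" for z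
    using f(1) that B_iff[of z] unfolding branched_cover_of_degree_def by simp
  have fin: "finite (fibre S2 f (p z))" for z
  proof (cases "rot_ord z = 1")
    case True
    then show ?thesis using deg by blast
  next
    case False
    then have "?l f (p z) \<noteq> {#}" using lp[of z] by simp
    then show ?thesis by (rule local_degrees_over_nonempty)
  qed
  interpret orbifold_factor p f
  proof
    show "finite (fibre S2 f (p z))" for z by (rule fin)
    show "norm (f x) = 1" if x: "norm x = 1" for x
    proof -
      obtain k where "has_local_degree S2 S2 f x k" using ld[OF x] by blast
      then obtain U V where "x \<in> U" "openin S2 V" "f ` U \<subseteq> V"
        unfolding has_local_degree_def by blast
      then show ?thesis using openin_imp_subset by fastforce
    qed
    fix z x assume x: "norm x = 1" "f x = p z"
    then have xf: "x \<in> fibre S2 f (p z)" by (simp add: fibre_def)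
    let ?k = "local_degree S2 S2 f x"
    have "?k dvd rot_ord z"
    proof (cases "rot_ord z = 1")
      case True
      then have "\<not> ?k > 1" using B_iff[of z] xf by (auto simp: branching_points_def)
      moreover have "?k \<ge> 1" using ld_eq[OF x(1)] by (simp add: has_local_degree_def)
      ultimately have "?k = 1" by linarith
      then show ?thesis by (metis one_dvd)
    next
      case False
      have "?k \<in># ?l f (p z)" using xf local_degrees_over_iff[OF fin[of z]] by blast
      then have "?k = 1 \<or> ?k = rot_ord z"
        using lp[OF False] False rot_ord_cases[of z] by (auto split: if_splits)
      then show ?thesis by (metis dvd_refl one_dvd)
    qed
    then show "\<exists>k. has_local_degree S2 S2 f x k \<and> k dvd rot_ord z" using ld_eq[OF x(1)] by blast
  qed
  have "1 \<in># ?l f (p 0)" using 3(2) p(6) by simp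
  then obtain x0 where x0: "x0 \<in> fibre S2 f (p 0)" "local_degree S2 S2 f x0 = 1"
    using local_degrees_over_iff[OF fin[of 0]] by blast
  then have x0': "norm x0 = 1" "f x0 = p 0" by (auto simp: fibre_def)
  then have x0'': "has_local_degree S2 S2 f x0 1" using ld_eq[of x0] x0(2) by simp
  obtain w0 where w0: "rot_ord w0 = 1" using generic_point[OF open_UNIV] by blast
  obtain \<mu> where \<mu>: "\<mu> \<in> gauss_ints" "(norm \<mu>)\<^sup>2 = real (card (fibre S2 f (p w0)))"
    by (rule degree_is_gauss_norm[OF x0' x0'' w0])
  then obtain a b :: int where ab: "\<mu> = Complex (of_int a) (of_int b)" using gauss_ints_iff by blast
  have "real_of_int (a\<^sup>2 + b\<^sup>2) = real d" using \<mu>(2) deg[OF w0] by (simp add: ab cmod_power2)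
  then have "int d = a\<^sup>2 + b\<^sup>2" by linarith
  also have "\<dots> = int ((nat \<bar>a\<bar>)\<^sup>2 + (nat \<bar>b\<bar>)\<^sup>2)" by simp
  finally have "d = (nat \<bar>a\<bar>)\<^sup>2 + (nat \<bar>b\<bar>)\<^sup>2" by (simp only: of_nat_eq_iff)
  then show ?thesis by blast
qed

theorem theorem0p4:
  fixes k d :: nat and Ps :: "nat multiset multiset"
  assumes "k \<ge> 1"
    and "d = 4 * k + 1"
    and "Ps = {# replicate_mset (2 * k) 2 + {#1#},
                 replicate_mset k 4 + {#1#},
                 replicate_mset k 4 + {#1#} #}"
  shows "candidate_surface_branched_cover S2 S2 d Ps \<and>
         (realizable S2 S2 d Ps \<longleftrightarrow> (\<exists>x y :: nat. d = x\<^sup>2 + y\<^sup>2))"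
proof
  let ?A = "replicate_mset (2 * k) 2 + {#1 :: nat#}" and ?C = "replicate_mset k 4 + {#1 :: nat#}"
  have S2: "closed_connected_orientable_surface S2"
    by (simp add: closed_connected_orientable_surface_def closed_connected_surface_S2 orientable_S2)
  have "is_partition_of d ?A" "is_partition_of d ?C"
    using assms(2) by (auto simp: is_partition_of_def)
  \<comment> \<open>The Riemann-Hurwitz condition amounts to 2 - (2k + 1) - 2(k + 1) = - (4k + 1) =
    d (2 - 3).\<close>
  moreover have "euler_characteristic S2 - (\<Sum>P\<in>#Ps. int (size P)) = int d * (euler_characteristic S2 - int (size Ps))"
    unfolding assms(2,3) euler_characteristic_S2 by simp
  ultimately show "candidate_surface_branched_cover S2 S2 d Ps"
    using S2 assms unfolding candidate_surface_branched_cover_def by auto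
  show "realizable S2 S2 d Ps \<longleftrightarrow> (\<exists>x y :: nat. d = x\<^sup>2 + y\<^sup>2)"
  proof
    assume "realizable S2 S2 d Ps"
    then show "\<exists>x y :: nat. d = x\<^sup>2 + y\<^sup>2"
      unfolding assms(3) by (rule realizable_imp_sum_two_squares)
  next
    assume "\<exists>x y :: nat. d = x\<^sup>2 + y\<^sup>2"
    then obtain x y :: nat where d: "d = x\<^sup>2 + y\<^sup>2" by blast
    obtain p where "square_orbifold p" using exists_square_orbifold by blast
    then interpret square_orbifold p .
    have "Complex (real x) (real y) \<in> gauss_ints" by (simp add: gauss_ints_def)
    moreover have "(norm (Complex (real x) (real y)))\<^sup>2 = real d" by (simp add: d cmod_power2)
    ultimately show "realizable S2 S2 d Ps"
      unfolding assms(3) using assms(1,2) by (intro realizable_gauss_norm)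
  qed
qed

end
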